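(* Let $(P,\{\cdot,\cdot\},\mathcal{I},H)$ be a dynamical $\mathcal{I}$-Poisson manifold. Then the Hamiltonian flow of $H$ locally preserves $\mathcal{I}$, i.e. for every $q_0\in P$ there exist an open neighborhood $U\subset P$ of $q_0$ and $\epsilon>0$ such that $\Phi_H^t|_U$ is defined for $t\in(-\epsilon,\epsilon)$ and $$(\Phi_H^t)^*\,\mathcal{I}(\Phi_H^t(U))=\mathcal{I}(U)\qquad\text{for all }t\in(-\epsilon,\epsilon).$$ In the case that the Hamiltonian vector field $X_H$ is complete, one has, for all $t\in\mathbb{R}$, $(\Phi_H^t)^*\,\mathcal{I}\circ\Phi_H^t=\mathcal{I}$ (i.e. $(\Phi_H^t)^*\,\mathcal{I}(\Phi_H^t(V))=\mathcal{I}(V)$ for every open $V\subset P$) and, in particular, $(\Phi_H^t)^*\,\mathcal{I}(P)=\mathcal{I}(P)$.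
   Context: Let $P$ be a manifold with an $\mathbb{R}$-bilinear skew-symmetric bracket $\{\cdot,\cdot\}$ on $C^\infty(P)$ satisfying the Leibniz rule (not necessarily the Jacobi identity), i.e. given by a bivector field; it restricts to open subsets. For a subsheaf $\mathcal{I}$ of the sheaf $C^\infty$ of smooth functions on $P$ let $N(\mathcal{I}):=\{f\in C^\infty(P):\{f|_U,\mathcal{I}(U)\}\subset\mathcal{I}(U)\text{ for every open }U\subset P\}$. $(P,\{\cdot,\cdot\},\mathcal{I})$ is an $\mathcal{I}$-Poisson manifold if $\mathcal{I}$ is locally finitely generated (every point has an open neighborhood $U$ and $g_1,\dots,g_N\in C^\infty(U)$ with $\mathcal{I}(V)=\langle g_1|_V,\dots,g_N|_V\rangle_{C^\infty(V)}$ for every open $V\subset U$) and for every open $U\subset P$: (1) $\mathcal{I}(U)$ is a $C^\infty(U)$-module; (2) $\{\mathcal{I}(U),\mathcal{I}(U)\}\subset\mathcal{I}(U)$; (3) $\{\{f,g\},h\}+\{\{g,h\},f\}+\{\{h,f\},g\}\in\mathcal{I}(P)$ for all $f,g,h\in N(\mathcal{I})$. A dynamical $\mathcal{I}$-Poisson manifold $(P,\{\cdot,\cdot\},\mathcal{I},H)$ is an $\mathcal{I}$-Poisson manifold together with a function $H\in N(\mathcal{I})$. $X_H:=\{H,\cdot\}$ is the Hamiltonian vector field of $H$ and $\Phi_H^t$ its flow. *)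

theory Defs
  imports "HOL-Analysis.Analysis" "HOL-Library.FuncSet"
begin

section \<open>Smooth maps between subsets of Euclidean spaces\<close>

primrec Ck_on :: "nat \<Rightarrow> 'a::real_normed_vector set \<Rightarrow> ('a \<Rightarrow> 'b::real_normed_vector) \<Rightarrow> bool" where
  "Ck_on 0 S f \<longleftrightarrow> continuous_on S f"
| "Ck_on (Suc k) S f \<longleftrightarrow>
     (\<forall>x\<in>S. f differentiable (at x)) \<and> (\<forall>v. Ck_on k S (\<lambda>x. frechet_derivative f (at x) v))"

text \<open>\<open>Ck_on\<close> is meaningful for open sets only. A map on an arbitrary set is smooth if near every
  point of the set it extends to a smooth map on an open set of the ambient space.\<close>

definition smooth_on :: "'a::real_normed_vector set \<Rightarrow> ('a \<Rightarrow> 'b::real_normed_vector) \<Rightarrow> bool" where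
  "smooth_on S f \<longleftrightarrow>
     (\<forall>x\<in>S. \<exists>W g. open W \<and> x \<in> W \<and> (\<forall>k. Ck_on k W g) \<and> (\<forall>y\<in>S \<inter> W. g y = f y))"

section \<open>Smooth manifolds\<close>

text \<open>The underlying set of the manifold \<open>P\<close> is a Hausdorff, second countable type \<open>'p\<close>.
  The model space \<open>\<real>\<^sup>n\<close> is a linear subspace \<open>E\<close> of dimension \<open>n\<close> of a Euclidean space \<open>'e\<close>; with
  \<open>E = UNIV\<close> this is the usual notion, and \<open>E = {0}\<close> covers dimension 0, for which there is no type
  of class \<^class>\<open>euclidean_space\<close>. A chart is a pair of its domain and its coordinate map;
  the values of the latter outside the domain are irrelevant.\<close>

definition smooth_manifold ::
  "'e::euclidean_space set \<Rightarrow> ('p::{t2_space,second_countable_topology} set \<times> ('p \<Rightarrow> 'e)) set \<Rightarrow> bool" where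
  "smooth_manifold E A \<longleftrightarrow>
     subspace E \<and>
     (\<Union>(U,\<phi>)\<in>A. U) = UNIV \<and>
     (\<forall>(U,\<phi>)\<in>A. open U \<and> openin (top_of_set E) (\<phi> ` U) \<and>
        homeomorphism U (\<phi> ` U) \<phi> (inv_into U \<phi>)) \<and>
     (\<forall>(U,\<phi>)\<in>A. \<forall>(V,\<psi>)\<in>A. smooth_on (\<phi> ` (U \<inter> V)) (\<psi> \<circ> inv_into U \<phi>))"

text \<open>The space \<open>C\<^sup>\<infinity>(U)\<close> for open \<open>U\<close>. So that a function on \<open>U\<close> is a single HOL function,
  its value outside \<open>U\<close> is fixed to be \<^const>\<open>undefined\<close>; the restriction of \<open>f\<close> to \<open>V\<close>
  is \<open>restrict f V\<close>.\<close>

definition Cinf :: "('p::topological_space set \<times> ('p \<Rightarrow> 'e::euclidean_space)) set \<Rightarrow> 'p set \<Rightarrow> ('p \<Rightarrow> real) set" where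
  "Cinf A U = {f \<in> extensional U. \<forall>(V,\<phi>)\<in>A. smooth_on (\<phi> ` (U \<inter> V)) (f \<circ> inv_into V \<phi>)}"

section \<open>Brackets satisfying the Leibniz rule\<close>

type_synonym 'p bracket = "('p \<Rightarrow> real) \<Rightarrow> ('p \<Rightarrow> real) \<Rightarrow> ('p \<Rightarrow> real)"

definition leibniz_bracket ::
  "('p::topological_space set \<times> ('p \<Rightarrow> 'e::euclidean_space)) set \<Rightarrow> 'p bracket \<Rightarrow> bool" where
  "leibniz_bracket A br \<longleftrightarrow>
     (\<forall>f\<in>Cinf A UNIV. \<forall>g\<in>Cinf A UNIV.
        br f g \<in> Cinf A UNIV \<and>
        br f g = (\<lambda>x. - br g f x) \<and>
        (\<forall>h\<in>Cinf A UNIV. 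
           (\<forall>a b. br (\<lambda>x. a * f x + b * g x) h = (\<lambda>x. a * br f h x + b * br g h x)) \<and>
           (\<forall>a b. br h (\<lambda>x. a * f x + b * g x) = (\<lambda>x. a * br h f x + b * br h g x)) \<and>
           br h (\<lambda>x. f x * g x) = (\<lambda>x. br h f x * g x + f x * br h g x)))"

text \<open>The induced bracket on \<open>C\<^sup>\<infinity>(U)\<close>: its value at \<open>x\<close> is that of the bracket of any two global
  smooth functions which agree with the given ones near \<open>x\<close>. Such functions exist, and the value
  does not depend on the choice, since the bracket is a derivation in each argument.\<close>

definition local_bracket ::
  "('p::topological_space set \<times> ('p \<Rightarrow> 'e::euclidean_space)) set \<Rightarrow> 'p bracket \<Rightarrow> 'p set \<Rightarrow> 'p bracket" where
  "local_bracket A br U f g = (\<lambda>x\<in>U. THE c. \<exists>F\<in>Cinf A UNIV. \<exists>G\<in>Cinf A UNIV.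
     (\<forall>\<^sub>F y in nhds x. F y = f y) \<and> (\<forall>\<^sub>F y in nhds x. G y = g y) \<and> c = br F G x)"

section \<open>Subsheaves of the sheaf of smooth functions\<close>

text \<open>A presheaf \<open>I\<close> assigns sets of functions to open sets; its values on other sets are
  irrelevant.\<close>

type_synonym 'p fun_sheaf = "'p set \<Rightarrow> ('p \<Rightarrow> real) set"

definition subsheaf_Cinf ::
  "('p::topological_space set \<times> ('p \<Rightarrow> 'e::euclidean_space)) set \<Rightarrow> 'p fun_sheaf \<Rightarrow> bool" where
  "subsheaf_Cinf A I \<longleftrightarrow>
     (\<forall>U. open U \<longrightarrow> I U \<subseteq> Cinf A U) \<and>
     (\<forall>U V f. open U \<and> open V \<and> V \<subseteq> U \<and> f \<in> I U \<longrightarrow> restrict f V \<in> I V) \<and>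
     (\<forall>\<U> f. (\<forall>U\<in>\<U>. open U) \<and> f \<in> Cinf A (\<Union>\<U>) \<and> (\<forall>U\<in>\<U>. restrict f U \<in> I U) \<longrightarrow> f \<in> I (\<Union>\<U>))"

definition Cinf_submodule ::
  "('p::topological_space set \<times> ('p \<Rightarrow> 'e::euclidean_space)) set \<Rightarrow> 'p set \<Rightarrow> ('p \<Rightarrow> real) set \<Rightarrow> bool" where
  "Cinf_submodule A U M \<longleftrightarrow>
     M \<subseteq> Cinf A U \<and>
     (\<lambda>x\<in>U. 0) \<in> M \<and>
     (\<forall>f\<in>M. \<forall>g\<in>M. (\<lambda>x\<in>U. f x + g x) \<in> M) \<and>
     (\<forall>a\<in>Cinf A U. \<forall>f\<in>M. (\<lambda>x\<in>U. a x * f x) \<in> M)"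

definition Cinf_span ::
  "('p::topological_space set \<times> ('p \<Rightarrow> 'e::euclidean_space)) set \<Rightarrow> 'p set \<Rightarrow> nat \<Rightarrow> (nat \<Rightarrow> 'p \<Rightarrow> real) \<Rightarrow> ('p \<Rightarrow> real) set" where
  "Cinf_span A V N g = {(\<lambda>x\<in>V. \<Sum>i<N. a i x * g i x) | a. \<forall>i<N. a i \<in> Cinf A V}"

definition locally_finitely_generated ::
  "('p::topological_space set \<times> ('p \<Rightarrow> 'e::euclidean_space)) set \<Rightarrow> 'p fun_sheaf \<Rightarrow> bool" where
  "locally_finitely_generated A I \<longleftrightarrow>
     (\<forall>x. \<exists>U N g. open U \<and> x \<in> U \<and> (\<forall>i<N. g i \<in> Cinf A U) \<and>
        (\<forall>V. open V \<and> V \<subseteq> U \<longrightarrow> I V = Cinf_span A V N (\<lambda>i. restrict (g i) V)))"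

section \<open>\<open>\<I>\<close>-Poisson manifolds\<close>

text \<open>The set \<open>N(\<I>)\<close>.\<close>

definition sheaf_normalizer ::
  "('p::topological_space set \<times> ('p \<Rightarrow> 'e::euclidean_space)) set \<Rightarrow> 'p bracket \<Rightarrow> 'p fun_sheaf \<Rightarrow> ('p \<Rightarrow> real) set" where
  "sheaf_normalizer A br I = {f \<in> Cinf A UNIV. \<forall>U. open U \<longrightarrow>
     (\<forall>g\<in>I U. local_bracket A br U (restrict f U) g \<in> I U)}"

definition I_Poisson_manifold ::
  "'e::euclidean_space set \<Rightarrow> ('p::{t2_space,second_countable_topology} set \<times> ('p \<Rightarrow> 'e)) set \<Rightarrow>
   'p bracket \<Rightarrow> 'p fun_sheaf \<Rightarrow> bool" where
  "I_Poisson_manifold E A br I \<longleftrightarrow>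
     smooth_manifold E A \<and> leibniz_bracket A br \<and> subsheaf_Cinf A I \<and>
     locally_finitely_generated A I \<and>
     (\<forall>U. open U \<longrightarrow> Cinf_submodule A U (I U)) \<and>
     (\<forall>U. open U \<longrightarrow> (\<forall>f\<in>I U. \<forall>g\<in>I U. local_bracket A br U f g \<in> I U)) \<and>
     (\<forall>f\<in>sheaf_normalizer A br I. \<forall>g\<in>sheaf_normalizer A br I. \<forall>h\<in>sheaf_normalizer A br I.
        (\<lambda>x. br (br f g) h x + br (br g h) f x + br (br h f) g x) \<in> I UNIV)"

definition dynamical_I_Poisson_manifold ::
  "'e::euclidean_space set \<Rightarrow> ('p::{t2_space,second_countable_topology} set \<times> ('p \<Rightarrow> 'e)) set \<Rightarrow>
   'p bracket \<Rightarrow> 'p fun_sheaf \<Rightarrow> ('p \<Rightarrow> real) \<Rightarrow> bool" where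
  "dynamical_I_Poisson_manifold E A br I H \<longleftrightarrow>
     I_Poisson_manifold E A br I \<and> H \<in> sheaf_normalizer A br I"

section \<open>Vector fields and their flows\<close>

text \<open>Vector fields are regarded as derivations of \<open>C\<^sup>\<infinity>(P)\<close>.\<close>

definition hamiltonian_vf :: "'p bracket \<Rightarrow> ('p \<Rightarrow> real) \<Rightarrow> ('p \<Rightarrow> real) \<Rightarrow> ('p \<Rightarrow> real)" where
  "hamiltonian_vf br H = (\<lambda>f. br H f)"

text \<open>The equation \<open>\<gamma>'(s) = X(\<gamma>(s))\<close> between tangent vectors, which are derivations
  on smooth functions; \<open>\<gamma>'(s)\<close> maps \<open>f\<close> to the derivative of \<open>f \<circ> \<gamma>\<close> at \<open>s\<close>.\<close>

definition integral_curve ::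
  "('p::topological_space set \<times> ('p \<Rightarrow> 'e::euclidean_space)) set \<Rightarrow> (('p \<Rightarrow> real) \<Rightarrow> ('p \<Rightarrow> real)) \<Rightarrow>
   real set \<Rightarrow> (real \<Rightarrow> 'p) \<Rightarrow> bool" where
  "integral_curve A X J \<gamma> \<longleftrightarrow>
     open J \<and> is_interval J \<and> continuous_on J \<gamma> \<and>
     (\<forall>s\<in>J. \<forall>f\<in>Cinf A UNIV. ((\<lambda>t. f (\<gamma> t)) has_real_derivative X f (\<gamma> s)) (at s))"

definition flow_defined ::
  "('p::topological_space set \<times> ('p \<Rightarrow> 'e::euclidean_space)) set \<Rightarrow> (('p \<Rightarrow> real) \<Rightarrow> ('p \<Rightarrow> real)) \<Rightarrow>
   real \<Rightarrow> 'p \<Rightarrow> bool" where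
  "flow_defined A X t x \<longleftrightarrow> (\<exists>J \<gamma>. integral_curve A X J \<gamma> \<and> 0 \<in> J \<and> t \<in> J \<and> \<gamma> 0 = x)"

definition flow ::
  "('p::topological_space set \<times> ('p \<Rightarrow> 'e::euclidean_space)) set \<Rightarrow> (('p \<Rightarrow> real) \<Rightarrow> ('p \<Rightarrow> real)) \<Rightarrow>
   real \<Rightarrow> 'p \<Rightarrow> 'p" where
  "flow A X t x = (THE y. \<exists>J \<gamma>. integral_curve A X J \<gamma> \<and> 0 \<in> J \<and> t \<in> J \<and> \<gamma> 0 = x \<and> \<gamma> t = y)"

definition complete_vf ::
  "('p::topological_space set \<times> ('p \<Rightarrow> 'e::euclidean_space)) set \<Rightarrow> (('p \<Rightarrow> real) \<Rightarrow> ('p \<Rightarrow> real)) \<Rightarrow> bool" where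
  "complete_vf A X \<longleftrightarrow> (\<forall>x. \<exists>\<gamma>. integral_curve A X UNIV \<gamma> \<and> \<gamma> 0 = x)"

text \<open>The set \<open>\<phi>\<^sup>* F\<close> of functions on \<open>U\<close>, for a set \<open>F\<close> of functions on \<open>\<phi>(U)\<close>.\<close>

definition pullback :: "('p \<Rightarrow> 'q) \<Rightarrow> 'p set \<Rightarrow> ('q \<Rightarrow> real) set \<Rightarrow> ('p \<Rightarrow> real) set" where
  "pullback \<phi> U F = (\<lambda>f. \<lambda>x\<in>U. f (\<phi> x)) ` F"

end

(* The flow of the Hamiltonian vector field is computed in a chart. There the vector field is cut off
   to a compactly supported one, whose flow \<Phi> is global, smooth and agrees with the given one for
   small times. If g_1, ..., g_N generate I near q0, then {H, g_i} = sum_j a_ij g_j with smooth a_ij,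
   because H normalizes I. Along an integral curve the g_i hence solve the linear equation
   (g_i o \<Phi>_t)' = sum_j (a_ij o \<Phi>_t) (g_j o \<Phi>_t), so that g_i o \<Phi>_t = sum_j m_ij(t, -) g_j, where the
   fundamental matrix m depends smoothly on the initial point. Thus pulling back by \<Phi>_t maps I into I,
   and applying this to -t gives equality. For a complete vector field the property propagates along
   each orbit by connectedness of the time axis, and is glued by the sheaf property.

   Smooth dependence on initial values is reduced to continuous dependence: by Hadamard's lemma the
   difference of two solutions is R(t, x, y) (y - x), where R solves a linear equation with continuous
   coefficients. Higher derivatives follow by induction, since the variational equation is linear. *)

theory Submission
  imports Defs
begin

section \<open>Calculus of \<open>C\<^sup>k\<close> maps\<close>

text \<open>Charts take values in a linear subspace \<open>E\<close> of the Euclidean space, so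
  chart images need not be open in it, and the derivative of an ambient extension also sees
  directions outside \<open>E\<close>. A linear projection \<open>\<pi>\<close> onto
  \<open>E\<close> extends chart data to the ambient space and keeps the vector field, hence its
  flow, tangent to \<open>E\<close>.

  The vector field is given only as a derivation of global functions. Bump functions make it local,
  a smooth Hadamard lemma shows that at a point it sees only the derivative of a chart
  representative, and global extensions of the coordinates let integral curves, which are tested
  against global functions only, be read in the chart.

  The ball of radius \<open>R\<close> is split into quarters: within time \<open>\<epsilon>\<close>
  a point moves by less than \<open>R / 4\<close>. A set in the first ball has its image in the
  second, on which the flow for time \<open>-t\<close> still works, and everything stays inside the
  third, where the generators live.

  For large times continuity of the flow is not known in advance; it is carried along each orbit
  together with the preservation property.\<close>

lemma Ck_on_mono: "Ck_on k S f \<Longrightarrow> T \<subseteq> S \<Longrightarrow> Ck_on k T f"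
  by (induction k arbitrary: f) (auto intro: continuous_on_subset)

lemma Ck_on_cong:
  assumes "open S" "\<And>x. x \<in> S \<Longrightarrow> f x = g x" "Ck_on k S f"
  shows "Ck_on k S g"
  using assms(2,3)
proof (induction k arbitrary: f g)
  case 0
  then show ?case using continuous_on_cong[of S S f g] by auto
next
  case (Suc k)
  have d: "(g has_derivative frechet_derivative f (at x)) (at x)" if "x \<in> S" for x
  proof (rule has_derivative_transform_within_open[OF _ assms(1) that])
    show "(f has_derivative frechet_derivative f (at x)) (at x)"
      using Suc.prems(2) that frechet_derivative_works by auto
  qed (simp add: Suc.prems(1))
  have e: "frechet_derivative g (at x) = frechet_derivative f (at x)" if "x \<in> S" for x
    using frechet_derivative_at[OF d[OF that]] by simp
  show ?case
    unfolding Ck_on.simps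
  proof (intro conjI ballI allI)
    show "g differentiable at x" if "x \<in> S" for x
      using d[OF that] by (auto simp: differentiable_def)
    show "Ck_on k S (\<lambda>x. frechet_derivative g (at x) v)" for v
      using Suc.prems(2) by (auto simp: e intro: Suc.IH[of "\<lambda>x. frechet_derivative f (at x) v"])
  qed
qed

text \<open>\<open>frechet_derivative\<close> is a choice; uniqueness of derivatives on open sets
  allows any derivative found by the usual rules to be used in its place.\<close>

lemma Ck_on_SucI:
  assumes "open S" "\<And>x. x \<in> S \<Longrightarrow> (f has_derivative f' x) (at x)" "\<And>v. Ck_on k S (\<lambda>x. f' x v)"
  shows "Ck_on (Suc k) S f"
proof -
  have e: "f' x = frechet_derivative f (at x)" if "x \<in> S" for x
    using frechet_derivative_at[OF assms(2)[OF that]] .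
  show ?thesis
    unfolding Ck_on.simps
  proof (intro conjI ballI allI)
    show "f differentiable at x" if "x \<in> S" for x
      using assms(2)[OF that] by (auto simp: differentiable_def)
    show "Ck_on k S (\<lambda>x. frechet_derivative f (at x) v)" for v
      using assms(3)[of v] by (rule Ck_on_cong[OF assms(1), rotated]) (simp add: e)
  qed
qed

lemma Ck_on_SucD:
  assumes "Ck_on (Suc k) S f"
  shows "Ck_on k S f"
  using assms
proof (induction k arbitrary: f)
  case 0
  then show ?case
    by (auto intro!: continuous_at_imp_continuous_on differentiable_imp_continuous_within)
next
  case (Suc k)
  then show ?case by auto
qed

lemma Ck_on_has_derivative:
  "Ck_on (Suc k) S f \<Longrightarrow> x \<in> S \<Longrightarrow> (f has_derivative frechet_derivative f (at x)) (at x)"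
  by (simp add: frechet_derivative_works)

lemma Ck_on_continuous_on: "Ck_on k S f \<Longrightarrow> continuous_on S f"
proof (induction k)
  case (Suc k)
  then show ?case using Ck_on_SucD by blast
qed simp

lemma Ck_on_const: "open S \<Longrightarrow> Ck_on k S (\<lambda>x. c)"
proof (induction k arbitrary: c)
  case (Suc k)
  show ?case by (rule Ck_on_SucI[where f' = "\<lambda>_ _. 0"]) (use Suc in auto)
qed simp

lemma Ck_on_bounded_linear_id:
  assumes "open S" "bounded_linear L"
  shows "Ck_on k S L"
proof (cases k)
  case 0
  then show ?thesis using assms by (simp add: linear_continuous_on)
next
  case (Suc m)
  show ?thesis unfolding Suc
    by (rule Ck_on_SucI[where f' = "\<lambda>_. L"])
       (use assms in \<open>auto intro: bounded_linear_imp_has_derivative Ck_on_const\<close>)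
qed

lemma Ck_on_add:
  assumes "open S" "Ck_on k S f" "Ck_on k S g"
  shows "Ck_on k S (\<lambda>x. f x + g x)"
  using assms(2,3)
proof (induction k arbitrary: f g)
  case 0
  then show ?case by (auto intro: continuous_intros)
next
  case (Suc k)
  show ?case
    by (rule Ck_on_SucI[OF assms(1)
          has_derivative_add[OF Ck_on_has_derivative[OF Suc.prems(1)] Ck_on_has_derivative[OF Suc.prems(2)]]])
       (use Suc in auto)
qed

lemma Ck_on_bilinear:
  assumes "bounded_bilinear pr" "open S" "Ck_on k S f" "Ck_on k S g"
  shows "Ck_on k S (\<lambda>x. pr (f x) (g x))"
  using assms(3,4)
proof (induction k arbitrary: f g)
  case 0
  then show ?case using bounded_bilinear.continuous_on[OF assms(1)] by auto
next
  case (Suc k)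
  show ?case
  proof (rule Ck_on_SucI[OF assms(2)])
    fix x assume "x \<in> S"
    then show "((\<lambda>x. pr (f x) (g x)) has_derivative
      (\<lambda>v. pr (f x) (frechet_derivative g (at x) v) + pr (frechet_derivative f (at x) v) (g x))) (at x)"
      by (intro bounded_bilinear.FDERIV[OF assms(1)] Ck_on_has_derivative[OF Suc.prems(1)]
          Ck_on_has_derivative[OF Suc.prems(2)])
  next
    fix v
    show "Ck_on k S (\<lambda>x. pr (f x) (frechet_derivative g (at x) v) + pr (frechet_derivative f (at x) v) (g x))"
      using Suc.prems Suc.prems[THEN Ck_on_SucD] by (intro Ck_on_add assms Suc.IH) auto
  qed
qed

lemmas Ck_on_scaleR = Ck_on_bilinear[OF bounded_bilinear_scaleR]
lemmas Ck_on_mult = Ck_on_bilinear[OF bounded_bilinear_mult]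
lemmas Ck_on_blinfun_apply = Ck_on_bilinear[OF bounded_bilinear_blinfun_apply]

lemma Ck_on_sum:
  assumes "open S" "\<And>i. i \<in> I \<Longrightarrow> Ck_on k S (f i)"
  shows "Ck_on k S (\<lambda>x. \<Sum>i\<in>I. f i x)"
  using assms by (induction I rule: infinite_finite_induct) (auto intro: Ck_on_const Ck_on_add)

lemma Ck_on_bounded_linear:
  assumes "open S" "bounded_linear L" "Ck_on k S f"
  shows "Ck_on k S (\<lambda>x. L (f x))"
  using assms(3)
proof (induction k arbitrary: f)
  case 0
  then show ?case by (auto intro: bounded_linear.continuous_on[OF assms(2)])
next
  case (Suc k)
  show ?case
    by (rule Ck_on_SucI[OF assms(1) bounded_linear.has_derivative[OF assms(2)]])
       (use Suc Ck_on_has_derivative in blast, use Suc in auto)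
qed

lemma linear_euclidean_sum:
  fixes L :: "'a::euclidean_space \<Rightarrow> 'b::real_vector"
  assumes "linear L"
  shows "L v = (\<Sum>b\<in>Basis. (v \<bullet> b) *\<^sub>R L b)"
proof -
  have "L v = L (\<Sum>b\<in>Basis. (v \<bullet> b) *\<^sub>R b)" by (simp add: euclidean_representation)
  then show ?thesis by (simp add: linear_sum[OF assms] linear_scale[OF assms])
qed

text \<open>\<open>Ck_on\<close> controls a derivative only in fixed directions, whereas the chain
  rule applies the derivative of \<open>f\<close> to a direction that varies with \<open>x\<close>.
  Expanding this direction in the basis leaves sums of products to which the induction hypothesis
  applies.\<close>

lemma Ck_on_compose:
  fixes f :: "'b::euclidean_space \<Rightarrow> 'c::real_normed_vector"
  assumes "open S" "open T" "Ck_on k T f" "Ck_on k S g" "\<And>x. x \<in> S \<Longrightarrow> g x \<in> T"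
  shows "Ck_on k S (\<lambda>x. f (g x))"
  using assms(3,4)
proof (induction k arbitrary: f)
  case 0
  then show ?case using assms(5) by (auto intro: continuous_on_compose2)
next
  case (Suc k)
  show ?case
  proof (rule Ck_on_SucI[OF assms(1)])
    fix x assume x: "x \<in> S"
    have d: "(f has_derivative frechet_derivative f (at (g x))) (at (g x))"
      using Ck_on_has_derivative[OF Suc.prems(1) assms(5)[OF x]] .
    have "frechet_derivative f (at (g x)) (frechet_derivative g (at x) v) =
      (\<Sum>b\<in>Basis. (frechet_derivative g (at x) v \<bullet> b) *\<^sub>R frechet_derivative f (at (g x)) b)" for v
      using linear_euclidean_sum has_derivative_linear[OF d] by blast
    then show "((\<lambda>x. f (g x)) has_derivative
        (\<lambda>v. \<Sum>b\<in>Basis. (frechet_derivative g (at x) v \<bullet> b) *\<^sub>R frechet_derivative f (at (g x)) b)) (at x)"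
      using has_derivative_compose[OF Ck_on_has_derivative[OF Suc.prems(2) x] d] by simp
  next
    fix v
    show "Ck_on k S (\<lambda>x. \<Sum>b\<in>Basis. (frechet_derivative g (at x) v \<bullet> b) *\<^sub>R frechet_derivative f (at (g x)) b)"
      using Suc.prems Suc.prems[THEN Ck_on_SucD]
      by (intro Ck_on_sum Ck_on_scaleR assms Ck_on_bounded_linear[OF _ bounded_linear_inner_left]
           Suc.IH[of "\<lambda>y. frechet_derivative f (at y) _"]) auto
  qed
qed

lemma Ck_on_local:
  assumes "\<And>x. x \<in> S \<Longrightarrow> \<exists>W. open W \<and> x \<in> W \<and> Ck_on k W f"
  shows "Ck_on k S f"
  using assms
proof (induction k arbitrary: f)
  case 0
  then show ?case
    by (metis Ck_on.simps(1) continuous_at_imp_continuous_on continuous_on_eq_continuous_at)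
next
  case (Suc k)
  have "Ck_on k S (\<lambda>x. frechet_derivative f (at x) v)" for v
    by (rule Suc.IH) (use Suc.prems in force)
  moreover have "f differentiable at x" if "x \<in> S" for x
    using Suc.prems[OF that] by auto
  ultimately show ?case by simp
qed

lemma Ck_on_Pair:
  assumes "open S" "Ck_on k S f" "Ck_on k S g"
  shows "Ck_on k S (\<lambda>x. (f x, g x))"
proof -
  have "Ck_on k S (\<lambda>x. (f x, 0) + (0, g x))"
    using assms by (intro Ck_on_add Ck_on_bounded_linear[where L = "\<lambda>y. (y, 0)"] 
        Ck_on_bounded_linear[where L = "\<lambda>y. (0, y)"]) 
       (auto intro!: bounded_linear_Pair bounded_linear_ident bounded_linear_zero)
  then show ?thesis by simp
qed

lemma Ck_on_fst: "open S \<Longrightarrow> Ck_on k S fst"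
  by (rule Ck_on_bounded_linear_id[OF _ bounded_linear_fst])

lemma Ck_on_snd: "open S \<Longrightarrow> Ck_on k S snd"
  by (rule Ck_on_bounded_linear_id[OF _ bounded_linear_snd])

lemma Ck_on_ident: "open S \<Longrightarrow> Ck_on k S (\<lambda>x. x)"
  by (rule Ck_on_bounded_linear_id[OF _ bounded_linear_ident])

section \<open>Ordinary differential equations with parameters\<close>

text \<open>One integration turns the n-th term of an exponential series into the next one.
  Iterated, it gives uniqueness and the convergence of Picard iteration; with \<open>n = 0\<close>
  it is a mean value estimate. Negative times follow by reflection.\<close>

lemma power_bound_step:
  fixes f :: "real \<Rightarrow> 'a::real_normed_vector"
  assumes "K \<ge> 0" "M \<ge> 0"
    and "\<And>t. \<bar>t\<bar> \<le> r \<Longrightarrow> (f has_vector_derivative f' t) (at t)"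
    and "\<And>t. \<bar>t\<bar> \<le> r \<Longrightarrow> norm (f' t) \<le> K * (M * (K * \<bar>t\<bar>) ^ n / fact n)"
    and "f 0 = 0" "\<bar>t\<bar> \<le> r"
  shows "norm (f t) \<le> M * (K * \<bar>t\<bar>) ^ Suc n / fact (Suc n)"
proof -
  define \<phi> where "\<phi> s = M * (K * s) ^ Suc n / fact (Suc n)" for s
  have "(\<phi> has_real_derivative M * (real (Suc n) * (K * s) ^ n * K) / fact (Suc n)) (at s)" for s
    unfolding \<phi>_def by (rule derivative_eq_intros refl | simp)+
  moreover have "M * (real (Suc n) * (K * s) ^ n * K) / fact (Suc n) = K * (M * (K * s) ^ n / fact n)" for s
    by (simp add: divide_simps del: of_nat_Suc)
  ultimately have \<phi>': "(\<phi> has_vector_derivative K * (M * (K * s) ^ n / fact n)) (at s)" for s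
    by (simp only: has_real_derivative_iff_has_vector_derivative)
  have main: "norm (g s) \<le> \<phi> s" if "0 \<le> s" "s \<le> r" "g 0 = 0"
    and g: "\<And>t. 0 \<le> t \<Longrightarrow> t \<le> r \<Longrightarrow> (g has_vector_derivative g' t) (at t)"
      "\<And>t. 0 \<le> t \<Longrightarrow> t \<le> r \<Longrightarrow> norm (g' t) \<le> K * (M * (K * t) ^ n / fact n)"
    for s and g g' :: "real \<Rightarrow> 'a"
  proof (cases "s = 0")
    case False
    have "norm (g s - g 0) \<le> \<phi> s - \<phi> 0"
    proof (rule differentiable_bound_general[where f' = g' and \<phi>' = "\<lambda>s. K * (M * (K * s) ^ n / fact n)"])
      show "continuous_on {0..s} g"
        using that by (intro continuous_at_imp_continuous_on ballI has_vector_derivative_continuous[OF g(1)]) auto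
      show "continuous_on {0..s} \<phi>"
        by (intro continuous_at_imp_continuous_on ballI has_vector_derivative_continuous[OF \<phi>'])
    qed (use that False \<phi>' in auto)
    then show ?thesis using \<open>g 0 = 0\<close> by (simp add: \<phi>_def)
  qed (use that in \<open>simp add: \<phi>_def\<close>)
  show ?thesis
  proof (cases "t \<ge> 0")
    case True
    have "norm (f' s) \<le> K * (M * (K * s) ^ n / fact n)" if "0 \<le> s" "s \<le> r" for s
      using assms(4)[of s] that by simp
    then have "norm (f t) \<le> \<phi> t"
      using True assms(3,5,6) by (intro main[where g' = f']) auto
    then show ?thesis using True by (simp add: \<phi>_def)
  next
    case False
    have "((\<lambda>s. f (- s)) has_vector_derivative - f' (- s)) (at s)" if "0 \<le> s" "s \<le> r" for s
    proof -
      have "(uminus has_vector_derivative - 1) (at s)"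
        using has_vector_derivative_minus[OF has_vector_derivative_id] by blast
      then show ?thesis
        using vector_diff_chain_at[of uminus "- 1" s f "f' (- s)"] assms(3)[of "- s"] that by (simp add: o_def)
    qed
    moreover have "norm (- f' (- s)) \<le> K * (M * (K * s) ^ n / fact n)" if "0 \<le> s" "s \<le> r" for s
      using assms(4)[of "- s"] that by simp
    ultimately have "norm (f (- (- t))) \<le> \<phi> (- t)"
      using False assms by (intro main[where g = "\<lambda>s. f (- s)" and g' = "\<lambda>s. - f' (- s)"]) auto
    then show ?thesis using False by (simp add: \<phi>_def)
  qed
qed

lemma power_fact_tendsto_0: "(\<lambda>n. M * (x::real) ^ n / fact n) \<longlonglongrightarrow> 0"
  using tendsto_mult_right_zero[OF summable_LIMSEQ_zero[OF summable_exp[of x]], of M]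
  by (simp add: field_simps)

text \<open>Takes the place of Gronwall's inequality: a crude bound \<open>M\<close> on the compact
  interval improves step by step to \<open>M * (L * \<bar>t\<bar>) ^ n / fact n\<close>, which tends
  to 0.\<close>

lemma ode_zero_unique:
  fixes d :: "real \<Rightarrow> 'a::real_normed_vector"
  assumes d: "\<And>t. \<bar>t\<bar> \<le> r \<Longrightarrow> (d has_vector_derivative d' t) (at t)"
    and K: "\<And>t. \<bar>t\<bar> \<le> r \<Longrightarrow> norm (d' t) \<le> K * norm (d t)"
    and "d 0 = 0" "\<bar>t\<bar> \<le> r"
  shows "d t = 0"
proof -
  have "continuous_on {-r..r} d"
    by (intro continuous_at_imp_continuous_on ballI has_vector_derivative_continuous[OF d]) auto
  then have "bounded (d ` {-r..r})"
    by (intro compact_imp_bounded compact_continuous_image) auto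
  then obtain M where M: "M > 0" "\<And>t. \<bar>t\<bar> \<le> r \<Longrightarrow> norm (d t) \<le> M"
    unfolding bounded_pos by (auto simp: abs_le_iff)
  define L where "L = \<bar>K\<bar>"
  have L: "norm (d' t) \<le> L * norm (d t)" if "\<bar>t\<bar> \<le> r" for t
    using K[OF that] mult_right_mono[OF abs_ge_self norm_ge_zero, of K "d t"] by (simp add: L_def)
  have "norm (d t) \<le> M * (L * \<bar>t\<bar>) ^ n / fact n" if "\<bar>t\<bar> \<le> r" for t n
    using that
  proof (induction n arbitrary: t)
    case 0
    then show ?case using M by simp
  next
    case (Suc n)
    show ?case
    proof (rule power_bound_step[OF _ _ d _ \<open>d 0 = 0\<close> Suc.prems])
      show "norm (d' t) \<le> L * (M * (L * \<bar>t\<bar>) ^ n / fact n)" if "\<bar>t\<bar> \<le> r" for t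
        using L[OF that] mult_left_mono[OF Suc.IH[OF that], of L] by (simp add: L_def)
    qed (use M in \<open>auto simp: L_def\<close>)
  qed
  then have "norm (d t) \<le> 0"
    using assms(4) by (intro LIMSEQ_le_const[OF power_fact_tendsto_0[of M "L * \<bar>t\<bar>"]]) auto
  then show ?thesis by simp
qed

text \<open>This is the integral from 0 to \<open>t\<close>, rescaled to the fixed interval
  \<open>{0..1}\<close>: one formula serves both signs of \<open>t\<close>, and continuity in
  parameters becomes that of an integral over a fixed domain.\<close>

lemma continuous_antiderivative:
  fixes g :: "real \<Rightarrow> 'a::banach"
  assumes "continuous_on UNIV g"
  shows "((\<lambda>t. t *\<^sub>R integral {0..1} (\<lambda>s. g (t * s))) has_vector_derivative g t) (at t)"
proof -
  define r where "r = \<bar>t\<bar> + 1"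
  obtain P where P: "\<And>x. x \<in> {-r..r} \<Longrightarrow> (P has_vector_derivative g x) (at x within {-r..r})"
    using antiderivative_continuous continuous_on_subset[OF assms] by (metis top_greatest)
  have eq: "P u - P 0 = u *\<^sub>R integral {0..1} (\<lambda>s. g (u * s))" if u: "u \<in> {-r..r}" for u
  proof -
    have "((\<lambda>s. P (u * s)) has_vector_derivative u *\<^sub>R g (u * s)) (at s within {0..1})" if "s \<in> {0..1}" for s
    proof -
      have in_r: "u * s' \<in> {-r..r}" if "s' \<in> {0..1}" for s'
      proof -
        have "\<bar>u * s'\<bar> \<le> \<bar>u\<bar>" using that mult_left_mono[of "s'" 1 "\<bar>u\<bar>"] by (auto simp: abs_mult)
        then show ?thesis using u by auto
      qed
      then have "(P has_vector_derivative g (u * s)) (at (u * s) within (\<lambda>s. u * s) ` {0..1})"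
        using P[OF in_r[OF that]] by (auto intro: has_vector_derivative_within_subset)
      moreover have "((\<lambda>s. u * s) has_vector_derivative u) (at s within {0..1})"
        unfolding has_real_derivative_iff_has_vector_derivative[symmetric]
        by (auto intro!: derivative_eq_intros)
      ultimately show ?thesis
        using vector_diff_chain_within[of "\<lambda>s. u * s" u s "{0..1}" P "g (u * s)"] by (simp add: o_def)
    qed
    then have "((\<lambda>s. u *\<^sub>R g (u * s)) has_integral P (u * 1) - P (u * 0)) {0..1}"
      by (intro fundamental_theorem_of_calculus) auto
    from integral_unique[OF this] show ?thesis by simp
  qed
  have "(P has_vector_derivative g t) (at t within {-r<..<r})"
    by (rule has_vector_derivative_within_subset[OF P]) (auto simp: r_def)
  moreover have "at t within {-r<..<r} = at t"
    by (rule at_within_open) (auto simp: r_def)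
  ultimately have "((\<lambda>t. P t - P 0) has_vector_derivative g t) (at t)"
    by (simp add: has_vector_derivative_diff_const)
  then show ?thesis
    by (rule has_vector_derivative_transform_within_open[of _ _ _ "{-r<..<r}"])
       (use eq in \<open>auto simp: r_def\<close>)
qed

text \<open>Since the Lipschitz bound holds for all \<open>y\<close>, Picard iteration converges for
  all times, uniformly on bounded sets of times and parameters. The unknown lives in any Banach
  space because it will also be an operator or a vector of generators.\<close>

lemma picard_parametric:
  fixes G :: "real \<Rightarrow> 'p::euclidean_space \<Rightarrow> 'y::banach \<Rightarrow> 'y"
  assumes contG: "continuous_on UNIV (\<lambda>(t,p,y). G t p y)"
    and cont0: "continuous_on UNIV y0"
    and Lip: "\<And>r. \<exists>K. \<forall>t p. \<bar>t\<bar> \<le> r \<and> norm p \<le> r \<longrightarrow> (\<forall>y y'. norm (G t p y - G t p y') \<le> K * norm (y - y'))"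
  obtains u where "continuous_on UNIV (\<lambda>(t,p). u t p)" "\<And>p. u 0 p = y0 p"
    "\<And>t p. ((\<lambda>t. u t p) has_vector_derivative G t p (u t p)) (at t)"
proof -
  define T where "T u t p = y0 p + t *\<^sub>R integral {0..1} (\<lambda>s. G (t * s) p (u (t * s) p))" for u t p
  define c where "c u \<longleftrightarrow> continuous_on UNIV (\<lambda>(t,p). u t p)" for u :: "real \<Rightarrow> 'p \<Rightarrow> 'y"
  note cG = continuous_on_compose2[OF contG, where f = "\<lambda>x. (t x, p x, y x)" for t p y, simplified]
  have cu: "continuous_on S (\<lambda>x. u (t x) (p x))" if "c u" "continuous_on S t" "continuous_on S p"
    for u t p and S :: "'q::topological_space set"
    using continuous_on_compose2[OF that(1)[unfolded c_def], of S "\<lambda>x. (t x, p x)"] that(2,3)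
    by (auto intro: continuous_intros)
  have T_deriv: "((\<lambda>t. T u t p) has_vector_derivative G t p (u t p)) (at t)" if "c u" for u t p
  proof -
    have "continuous_on UNIV (\<lambda>t. G t p (u t p))"
      by (intro cG continuous_intros cu[OF that])
    from continuous_antiderivative[OF this, of t] show ?thesis
      unfolding T_def using has_vector_derivative_add[OF has_vector_derivative_const] by fastforce
  qed
  have cT: "c (T u)" if "c u" for u
  proof -
    have "continuous_on UNIV (\<lambda>x. integral (cbox 0 1) (\<lambda>s. G (fst x * s) (snd x) (u (fst x * s) (snd x))))"
      by (rule integral_continuous_on_param)
         (auto simp: split_beta intro!: cG continuous_intros cu[OF that])
    then show ?thesis
      unfolding c_def T_def
      by (auto simp: split_beta intro!: continuous_intros continuous_on_compose2[OF cont0])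
  qed
  define v where "v n = (T ^^ n) (\<lambda>t p. y0 p)" for n
  have v_Suc: "v (Suc n) = T (v n)" for n by (simp add: v_def)
  have cv: "c (v n)" for n
  proof (induction n)
    case 0
    then show ?case
      by (auto simp: v_def c_def split_beta intro!: continuous_on_compose2[OF cont0] continuous_intros)
  qed (simp add: v_Suc cT)
  have v0: "v n 0 p = y0 p" for n p by (cases n) (simp_all add: v_def T_def)
  have ex: "\<exists>K M. K \<ge> 0 \<and> M \<ge> 0 \<and>
     (\<forall>t p y y'. \<bar>t\<bar> \<le> r \<and> norm p \<le> r \<longrightarrow> norm (G t p y - G t p y') \<le> K * norm (y - y')) \<and>
     (\<forall>n t p. \<bar>t\<bar> \<le> r \<and> norm p \<le> r \<longrightarrow> norm (v (Suc n) t p - v n t p) \<le> M * (K * \<bar>t\<bar>) ^ n / fact n)" for r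
  proof -
    obtain K' where K': "\<And>t p y y'. \<bar>t\<bar> \<le> r \<Longrightarrow> norm p \<le> r \<Longrightarrow> norm (G t p y - G t p y') \<le> K' * norm (y - y')"
      using Lip[of r] by blast
    define K where "K = \<bar>K'\<bar>"
    have K: "K \<ge> 0" "norm (G t p y - G t p y') \<le> K * norm (y - y')" if "\<bar>t\<bar> \<le> r" "norm p \<le> r" for t p y y'
      using K'[OF that, of y y'] mult_right_mono[OF abs_ge_self norm_ge_zero, of K' "y - y'"] by (auto simp: K_def)
    have "compact ({-r..r} \<times> cball (0::'p) r)" by (intro compact_Times) auto
    then have "bounded ((\<lambda>x. v 1 (fst x) (snd x) - v 0 (fst x) (snd x)) ` ({-r..r} \<times> cball (0::'p) r))"
      by (intro compact_imp_bounded compact_continuous_image continuous_intros cu[OF cv])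
    then obtain M where M: "M > 0"
      "\<And>x. x \<in> {-r..r} \<times> cball (0::'p) r \<Longrightarrow> norm (v 1 (fst x) (snd x) - v 0 (fst x) (snd x)) \<le> M"
      unfolding bounded_pos by auto
    have "norm (v (Suc n) t p - v n t p) \<le> M * (K * \<bar>t\<bar>) ^ n / fact n" if "norm p \<le> r" "\<bar>t\<bar> \<le> r" for n t p
      using that(2)
    proof (induction n arbitrary: t)
      case 0
      then show ?case using M(2)[of "(t, p)"] that(1) by (auto simp: abs_le_iff)
    next
      case (Suc n)
      show ?case
      proof (rule power_bound_step[OF _ _ _ _ _ Suc.prems, where f' = "\<lambda>t. G t p (v (Suc n) t p) - G t p (v n t p)"])
        show "((\<lambda>t. v (Suc (Suc n)) t p - v (Suc n) t p) has_vector_derivative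
           G t p (v (Suc n) t p) - G t p (v n t p)) (at t)" for t
          unfolding v_Suc[of "Suc n"] v_Suc[of n] using cT[OF cv[of n]] cv[of n]
          by (auto intro!: has_vector_derivative_diff T_deriv)
        show "norm (G t p (v (Suc n) t p) - G t p (v n t p)) \<le> K * (M * (K * \<bar>t\<bar>) ^ n / fact n)"
          if "\<bar>t\<bar> \<le> r" for t
          using K(2)[OF that \<open>norm p \<le> r\<close>] mult_left_mono[OF Suc.IH[OF that], of K] order_trans
          unfolding K_def by fastforce
        show "v (Suc (Suc n)) 0 p - v (Suc n) 0 p = 0" by (simp add: v0)
      qed (use M K_def in auto)
    qed
    then show ?thesis
      using M(1) K(2) K_def by (intro exI[of _ K] exI[of _ M]) auto
  qed
  \<comment> \<open>The limit of the iterates is written as a telescoping series in order to apply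
    the Weierstrass test.\<close>
  define u where "u t p = y0 p + (\<Sum>n. v (Suc n) t p - v n t p)" for t p
  have partial: "(\<Sum>n<m. v (Suc n) t p - v n t p) = v m t p - y0 p" for m t p
    using sum_lessThan_telescope[of "\<lambda>n. v n t p" m] by (simp add: v_def)
  have unif: "uniform_limit ({-r..r} \<times> cball 0 r) (\<lambda>n x. v n (fst x) (snd x)) (\<lambda>x. u (fst x) (snd x)) sequentially" for r
  proof -
    obtain K M where KM: "K \<ge> 0" "M \<ge> 0"
      "\<And>n t p. \<bar>t\<bar> \<le> r \<Longrightarrow> norm p \<le> r \<Longrightarrow> norm (v (Suc n) t p - v n t p) \<le> M * (K * \<bar>t\<bar>) ^ n / fact n"
      using ex[of r] by blast
    have "uniform_limit ({-r..r} \<times> cball 0 r) (\<lambda>m x. \<Sum>n<m. v (Suc n) (fst x) (snd x) - v n (fst x) (snd x))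
       (\<lambda>x. \<Sum>n. v (Suc n) (fst x) (snd x) - v n (fst x) (snd x)) sequentially"
    proof (rule Weierstrass_m_test)
      fix n and x :: "real \<times> 'p" assume x: "x \<in> {-r..r} \<times> cball 0 r"
      then have "norm (v (Suc n) (fst x) (snd x) - v n (fst x) (snd x)) \<le> M * (K * \<bar>fst x\<bar>) ^ n / fact n"
        by (intro KM) auto
      also have "\<dots> \<le> M * (K * r) ^ n / fact n"
        using x KM(1,2) by (intro divide_right_mono mult_left_mono power_mono) auto
      finally show "norm (v (Suc n) (fst x) (snd x) - v n (fst x) (snd x)) \<le> M * (K * r) ^ n / fact n" .
    next
      show "summable (\<lambda>n. M * (K * r) ^ n / fact n)"
        using summable_mult[OF summable_exp[of "K * r"], of M] by (simp add: field_simps)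
    qed
    from uniform_limit_add[OF uniform_limit_const[where c = "\<lambda>x. y0 (snd x)"] this]
    show ?thesis by (simp add: partial u_def)
  qed
  have "c u"
    unfolding c_def
  proof (rule continuous_at_imp_continuous_on, rule ballI)
    fix x :: "real \<times> 'p"
    define r where "r = \<bar>fst x\<bar> + norm (snd x) + 1"
    have "continuous_on ({-r..r} \<times> cball 0 r) (\<lambda>x. u (fst x) (snd x))"
      by (rule uniform_limit_theorem[OF _ unif]) (auto intro!: always_eventually cu[OF cv] continuous_intros)
    then have "continuous_on ({-r<..<r} \<times> ball 0 r) (\<lambda>x. u (fst x) (snd x))"
      by (rule continuous_on_subset) auto
    moreover have "open ({-r<..<r} \<times> ball (0::'p) r)" by (intro open_Times) auto
    moreover have "\<bar>fst x\<bar> < r" "norm (snd x) < r"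
      using norm_ge_zero[of "snd x"] unfolding r_def by linarith+
    then have "x \<in> {-r<..<r} \<times> ball 0 r" by (auto simp: mem_Times_iff abs_less_iff)
    ultimately show "continuous (at x) (\<lambda>(t, p). u t p)"
      unfolding split_beta by (metis continuous_on_eq_continuous_at)
  qed
  moreover have Tu: "T u t p = u t p" for t p
  proof -
    define r where "r = \<bar>t\<bar> + norm p + 1"
    obtain K where K: "K \<ge> 0"
      "\<And>t p y y'. \<bar>t\<bar> \<le> r \<Longrightarrow> norm p \<le> r \<Longrightarrow> norm (G t p y - G t p y') \<le> K * norm (y - y')"
      using ex[of r] by blast
    have r: "\<bar>t\<bar> \<le> r" "norm p \<le> r" "r > 0"
      using norm_ge_zero[of p] unfolding r_def by linarith+
    have lim1: "(\<lambda>n. v n t p) \<longlonglongrightarrow> u t p"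
      using tendsto_uniform_limitI[OF unif[of r], of "(t, p)"] r by (auto simp: abs_le_iff)
    have "(\<lambda>n. T (v n) t p) \<longlonglongrightarrow> T u t p"
    proof (rule LIMSEQ_I)
      fix e :: real assume "e > 0"
      \<comment> \<open>Integrating an error \<open>e'\<close> over a time at most \<open>r\<close>
        costs at most the factor \<open>K * r\<close>; the summand 1 keeps the quotient defined when
        \<open>K = 0\<close>.\<close>
      define e' where "e' = e / (K * r + 1)"
      have "K * r + 1 > 0" using K(1) r(3) by (simp add: add_nonneg_pos)
      then have e': "e' > 0" "K * r * e' < e" using \<open>e > 0\<close> by (auto simp: e'_def field_simps)
      from uniform_limitD[OF unif[of r] e'(1)] obtain N where
        N: "\<And>n x. n \<ge> N \<Longrightarrow> x \<in> {-r..r} \<times> cball 0 r \<Longrightarrow> dist (v n (fst x) (snd x)) (u (fst x) (snd x)) < e'"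
        unfolding eventually_sequentially by blast
      have "norm (T (v n) t p - T u t p) < e" if "n \<ge> N" for n
      proof -
        have "norm (T (v n) t p - T u t p) \<le> e' * (K * \<bar>t\<bar>) ^ Suc 0 / fact (Suc 0)"
          proof (rule power_bound_step[where f = "\<lambda>t. T (v n) t p - T u t p" and r = r
                 and f' = "\<lambda>t. G t p (v n t p) - G t p (u t p)"])
            show "((\<lambda>t. T (v n) t p - T u t p) has_vector_derivative G s p (v n s p) - G s p (u s p)) (at s)" for s
              using cv[of n] \<open>c u\<close> by (intro has_vector_derivative_diff T_deriv)
            show "norm (G s p (v n s p) - G s p (u s p)) \<le> K * (e' * (K * \<bar>s\<bar>) ^ 0 / fact 0)" if "\<bar>s\<bar> \<le> r" for s
            proof -
              have "norm (v n s p - u s p) \<le> e'"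
                using N[OF \<open>n \<ge> N\<close>, of "(s, p)"] that r by (auto simp: dist_norm abs_le_iff)
              then show ?thesis
                using K(2)[OF that r(2)] mult_left_mono[of "norm (v n s p - u s p)" e' K] K(1) order_trans by fastforce
            qed
          qed (use K e' r in \<open>auto simp: T_def\<close>)
        then have "norm (T (v n) t p - T u t p) \<le> K * e' * \<bar>t\<bar>" by (simp add: mult_ac)
        also have "\<dots> \<le> K * e' * r" using r K e' by (intro mult_left_mono) auto
        also have "\<dots> < e" using e' by (simp add: mult_ac)
        finally show ?thesis .
      qed
      then show "\<exists>N. \<forall>n\<ge>N. norm (T (v n) t p - T u t p) < e" by blast
    qed
    moreover have "(\<lambda>n. T (v n) t p) \<longlonglongrightarrow> u t p"
      using LIMSEQ_Suc[OF lim1] by (simp add: v_Suc)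
    ultimately show ?thesis using LIMSEQ_unique by blast
  qed
  moreover have "u 0 p = y0 p" for p using Tu[of 0 p] by (simp add: T_def)
  moreover have "((\<lambda>t. u t p) has_vector_derivative G t p (u t p)) (at t)" for t p
    using T_deriv[OF \<open>c u\<close>, of p t] by (simp add: Tu)
  ultimately show ?thesis using that unfolding c_def by blast
qed

section \<open>Smooth dependence on initial values and parameters\<close>

text \<open>Rebuilds a linear map as a bounded operator from its values on the basis, so that
  continuity or smoothness in each basis direction passes to the operator.\<close>

definition blinfun_of_basis :: "('e::euclidean_space \<Rightarrow> 'y::real_normed_vector) \<Rightarrow> 'e \<Rightarrow>\<^sub>L 'y" where
  "blinfun_of_basis D = (\<Sum>b\<in>Basis. blinfun_scaleR_left (D b) o\<^sub>L blinfun_inner_left b)"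

lemma blinfun_of_basis_apply: "linear D \<Longrightarrow> blinfun_apply (blinfun_of_basis D) v = D v"
  by (subst linear_euclidean_sum[of D])
     (auto simp: blinfun_of_basis_def blinfun.sum_left inner_commute)

lemma bounded_linear_blinfun_tensor:
  "bounded_linear (\<lambda>v. blinfun_scaleR_left v o\<^sub>L blinfun_inner_left b)"
  by (rule bounded_linear_compose[OF
        bounded_bilinear.bounded_linear_left[OF bounded_bilinear_blinfun_compose]
        bounded_linear_blinfun_scaleR_left])

lemma continuous_on_blinfun_of_basis:
  "(\<And>b. b \<in> Basis \<Longrightarrow> continuous_on S (\<lambda>x. D x b)) \<Longrightarrow> continuous_on S (\<lambda>x. blinfun_of_basis (D x))"
  unfolding blinfun_of_basis_def
  by (intro continuous_on_sum bounded_linear.continuous_on[OF bounded_linear_blinfun_tensor])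

lemma Ck_on_blinfun_of_basis:
  "open S \<Longrightarrow> (\<And>b. b \<in> Basis \<Longrightarrow> Ck_on k S (\<lambda>x. D x b)) \<Longrightarrow> Ck_on k S (\<lambda>x. blinfun_of_basis (D x))"
  unfolding blinfun_of_basis_def
  by (intro Ck_on_sum Ck_on_bounded_linear[OF _ bounded_linear_blinfun_tensor])

lemma has_vector_derivative_scaleR_left: "((\<lambda>s. s *\<^sub>R c) has_vector_derivative c) (at t)"
  unfolding has_vector_derivative_def
  by (rule bounded_linear_imp_has_derivative[OF bounded_linear_scaleR_left])

lemma continuous_on_compact_norm_bound:
  assumes "continuous_on S f" "compact S"
  obtains K where "\<And>x. x \<in> S \<Longrightarrow> norm (f x) \<le> K"
  using compact_imp_bounded[OF compact_continuous_image[OF assms]] unfolding bounded_iff by auto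

lemma zero_derivative_eq:
  fixes d :: "real \<Rightarrow> 'a::real_normed_vector"
  assumes "\<And>t. (d has_vector_derivative 0) (at t)"
  shows "d t = d s"
  using has_derivative_zero_unique[of UNIV d t s] assms by (auto simp: has_vector_derivative_def)

text \<open>\<open>C q x y\<close> is the mean of \<open>D q\<close> over the segment from
  \<open>x\<close> to \<open>y\<close>. It turns the difference of two solutions into the solution
  of a linear equation.\<close>

lemma hadamard_parametric:
  fixes F :: "'q::euclidean_space \<Rightarrow> 'e::euclidean_space \<Rightarrow> 'y::banach"
  assumes F: "\<And>q x. (F q has_derivative blinfun_apply (D q x)) (at x)"
    and D: "continuous_on UNIV (\<lambda>(q,x). D q x)"
  obtains C where "continuous_on UNIV (\<lambda>(q,x,y). C q x y)"
    "\<And>q x y. F q y - F q x = blinfun_apply (C q x y) (y - x)" "\<And>q x. C q x x = D q x"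
proof -
  \<comment> \<open>\<open>G\<close> ignores the unknown \<open>z\<close>, so solving the equation
    is plain integration; Picard's lemma supplies joint continuity of the integral in
    \<open>q\<close>, \<open>x\<close>, \<open>y\<close>.\<close>
  define G where "G t p (z :: 'e \<Rightarrow>\<^sub>L 'y) = (case p of (q,x,y) \<Rightarrow> D q (x + t *\<^sub>R (y - x)))" for t p z
  have "continuous_on UNIV (\<lambda>(t, p, z). G t p z)"
    unfolding G_def split_beta by (intro continuous_on_compose2[OF D[unfolded split_beta], of _ "\<lambda>x. (f x, g x)" for f g, simplified] continuous_intros)
  then obtain u where u: "continuous_on UNIV (\<lambda>(t,p). u t p)" "\<And>p. u 0 p = 0"
    "\<And>t p. ((\<lambda>t. u t p) has_vector_derivative G t p (u t p)) (at t)"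
    by (rule picard_parametric[of G "\<lambda>_. 0"]) (auto simp: G_def intro: exI[of _ 0])
  show ?thesis
  proof (rule that[of "\<lambda>q x y. u 1 (q,x,y)"])
    show "continuous_on UNIV (\<lambda>(q, x, y). u 1 (q, x, y))"
      unfolding split_beta by (intro continuous_on_compose2[OF u(1)[unfolded split_beta], of _ "\<lambda>x. (1, f x)" for f, simplified] continuous_intros)
    show "F q y - F q x = blinfun_apply (u 1 (q, x, y)) (y - x)" for q x y
    proof -
      define d where "d s = F q (x + s *\<^sub>R (y - x)) - blinfun_apply (u s (q, x, y)) (y - x)" for s
      have "(d has_vector_derivative 0) (at s)" for s
      proof -
        have "((\<lambda>s. x + s *\<^sub>R (y - x)) has_derivative (\<lambda>h. h *\<^sub>R (y - x))) (at s)"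
          by (auto intro!: derivative_eq_intros)
        from has_derivative_compose[OF this F] 
        have "((\<lambda>s. F q (x + s *\<^sub>R (y - x))) has_vector_derivative D q (x + s *\<^sub>R (y - x)) (y - x)) (at s)"
          by (simp add: has_vector_derivative_def blinfun.scaleR_right)
        moreover have "((\<lambda>s. blinfun_apply (u s (q, x, y)) (y - x)) has_vector_derivative D q (x + s *\<^sub>R (y - x)) (y - x)) (at s)"
          using bounded_linear.has_vector_derivative[OF blinfun.bounded_linear_left u(3)[of "(q,x,y)" s]]
          by (simp add: G_def)
        ultimately show ?thesis
          unfolding d_def using has_vector_derivative_diff by fastforce
      qed
      from zero_derivative_eq[OF this, of 1 0] show ?thesis by (simp add: d_def u(2) algebra_simps)
    qed
    show "u 1 (q, x, x) = D q x" for q x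
    proof -
      have "((\<lambda>s. u s (q,x,x) - s *\<^sub>R D q x) has_vector_derivative 0) (at s)" for s
        using has_vector_derivative_diff[OF u(3)[of "(q,x,x)" s] has_vector_derivative_scaleR_left[of "D q x"]]
        by (simp add: G_def)
      from zero_derivative_eq[OF this, of 1 0] show ?thesis by (simp add: u(2))
    qed
  qed
qed

lemma linear_ode_exists:
  fixes a :: "real \<Rightarrow> 'p::euclidean_space \<Rightarrow> 'y::banach \<Rightarrow>\<^sub>L 'y"
  assumes a: "continuous_on UNIV (\<lambda>(t,p). a t p)" and b: "continuous_on UNIV (\<lambda>(t,p). b t p)"
  obtains u where "continuous_on UNIV (\<lambda>(t,p). u t p)" "\<And>p. u 0 p = c"
    "\<And>t p. ((\<lambda>t. u t p) has_vector_derivative a t p (u t p) + b t p) (at t)"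
proof (rule picard_parametric[of "\<lambda>t p y. a t p y + b t p" "\<lambda>_. c"])
  show "continuous_on UNIV (\<lambda>(t, p, y). a t p y + b t p)"
    using a b unfolding split_beta
    by (intro continuous_intros continuous_on_compose2[OF a[unfolded split_beta], of _ "\<lambda>x. (f x, g x)" for f g, simplified]
      continuous_on_compose2[OF b[unfolded split_beta], of _ "\<lambda>x. (f x, g x)" for f g, simplified])
  show "\<exists>K. \<forall>t p. \<bar>t\<bar> \<le> r \<and> norm p \<le> r \<longrightarrow>
      (\<forall>y y'. norm (a t p y + b t p - (a t p y' + b t p)) \<le> K * norm (y - y'))" for r
  proof -
    have "compact ({-r..r} \<times> cball (0::'p) r)" by (intro compact_Times) auto
    from continuous_on_compact_norm_bound[OF continuous_on_subset[OF a subset_UNIV] this]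
    obtain K where K: "\<And>z. z \<in> {-r..r} \<times> cball (0::'p) r \<Longrightarrow> norm (a (fst z) (snd z)) \<le> K"
      unfolding split_beta by blast
    have "norm (a t p y + b t p - (a t p y' + b t p)) \<le> K * norm (y - y')" if "\<bar>t\<bar> \<le> r" "norm p \<le> r" for t p y y'
    proof -
      have "norm (a t p y + b t p - (a t p y' + b t p)) = norm (a t p (y - y'))" by (simp add: blinfun.diff_right)
      also have "\<dots> \<le> norm (a t p) * norm (y - y')" by (rule norm_blinfun)
      also have "\<dots> \<le> K * norm (y - y')"
        using K[of "(t,p)"] that by (intro mult_right_mono) (auto simp: abs_le_iff)
      finally show ?thesis .
    qed
    then show ?thesis by blast
  qed
qed auto

lemma linear_ode_unique:
  fixes a :: "real \<Rightarrow> 'y::real_normed_vector \<Rightarrow>\<^sub>L 'y"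
  assumes a: "continuous_on UNIV a"
    and "\<And>t. (u has_vector_derivative a t (u t) + b t) (at t)"
    and "\<And>t. (v has_vector_derivative a t (v t) + b t) (at t)" "u 0 = v 0"
  shows "u t = v t"
proof -
  obtain K where "\<And>s. s \<in> {-\<bar>t\<bar>..\<bar>t\<bar>} \<Longrightarrow> norm (a s) \<le> K"
    using continuous_on_compact_norm_bound[OF continuous_on_subset[OF a subset_UNIV] compact_Icc] by blast
  then have K: "norm (a s) \<le> K" if "\<bar>s\<bar> \<le> \<bar>t\<bar>" for s
    using that by (auto simp: abs_le_iff)
  have "u t - v t = 0"
  proof (rule ode_zero_unique[of "\<bar>t\<bar>"])
    show "((\<lambda>t. u t - v t) has_vector_derivative a s (u s - v s)) (at s)" for s
      using has_vector_derivative_diff[OF assms(2,3)] by (simp add: blinfun.diff_right)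
    show "norm (a s (u s - v s)) \<le> K * norm (u s - v s)" if "\<bar>s\<bar> \<le> \<bar>t\<bar>" for s
      using norm_blinfun[of "a s"] mult_right_mono[OF K[OF that] norm_ge_zero] order_trans by blast
  qed (use assms(4) in auto)
  then show ?thesis by simp
qed

text \<open>The difference quotient \<open>R t x y\<close> of a family of solutions solves a linear equation whose
  coefficients depend continuously on \<open>(x, y)\<close>; on the diagonal this is the variational equation.\<close>

lemma differentiable_dependence:
  fixes u :: "real \<Rightarrow> 'e::euclidean_space \<Rightarrow> 'y::banach"
  assumes ode: "\<And>t x. ((\<lambda>t. u t x) has_vector_derivative F t x) (at t)"
    and diff: "\<And>t x y. F t y - F t x = blinfun_apply (B t x y) (u t y - u t x) + blinfun_apply (C t x y) (y - x)"
    and B: "continuous_on UNIV (\<lambda>(t,x,y). B t x y)" and C: "continuous_on UNIV (\<lambda>(t,x,y). C t x y)"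
    and init: "\<And>x y. u 0 y - u 0 x = blinfun_apply c (y - x)"
  obtains R where "\<And>x. R 0 x = c"
    "\<And>t x. ((\<lambda>t. R t x) has_vector_derivative (B t x x o\<^sub>L R t x) + C t x x) (at t)"
    "\<And>t x. ((\<lambda>(t,x). u t x) has_derivative (\<lambda>(\<tau>,\<xi>). \<tau> *\<^sub>R F t x + R t x \<xi>)) (at (t, x))"
proof -
  \<comment> \<open>Composition from the left, as a bounded operator on the space of operators; it
    makes the equation for \<open>R\<close> an instance of \<open>linear_ode_exists\<close>.\<close>
  let ?comp = "bounded_bilinear.prod_right ((o\<^sub>L) :: ('y \<Rightarrow>\<^sub>L 'y) \<Rightarrow> ('e \<Rightarrow>\<^sub>L 'y) \<Rightarrow> _)"
  note comp_apply = bounded_bilinear.prod_right.rep_eq[OF bounded_bilinear_blinfun_compose]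
  have "continuous_on UNIV (\<lambda>(t,p). ?comp (B t (fst p) (snd p)))"
    using B unfolding split_beta
    by (intro bounded_linear.continuous_on[OF bounded_bilinear.bounded_linear_prod_right[OF bounded_bilinear_blinfun_compose]]) simp
  moreover have "continuous_on UNIV (\<lambda>(t,p). C t (fst p) (snd p))" using C by (simp add: split_beta split_beta')
  ultimately obtain R where R: "continuous_on UNIV (\<lambda>(t,p). R t p)" "\<And>p. R 0 p = c"
    "\<And>t p. ((\<lambda>t. R t p) has_vector_derivative
       blinfun_apply (?comp (B t (fst p) (snd p))) (R t p) + C t (fst p) (snd p)) (at t)"
    using linear_ode_exists by blast
  have contR: "continuous_on S (\<lambda>z. R (t z) (p z))" if "continuous_on S t" "continuous_on S p" for t p and S :: "'z::topological_space set"
    using continuous_on_compose2[OF R(1), of S "\<lambda>z. (t z, p z)"] that by (auto intro: continuous_intros)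
  \<comment> \<open>For a fixed pair \<open>(x, y)\<close> both sides solve the same linear equation
    with the same initial value. Setting \<open>x\<close> fixed and letting \<open>y\<close> tend to
    \<open>x\<close> then gives the derivative by continuity of \<open>R\<close>.\<close>
  have eq: "u t y - u t x = R t (x,y) (y - x)" for t x y
  proof (rule linear_ode_unique[where b = "\<lambda>t. C t x y (y - x)"])
    show "continuous_on UNIV (\<lambda>t. B t x y)"
    proof -
      have "continuous_on UNIV (\<lambda>t::real. (t, x, y))" by (intro continuous_intros)
      from continuous_on_compose2[OF B this] show ?thesis by simp
    qed
    show "((\<lambda>t. u t y - u t x) has_vector_derivative B t x y (u t y - u t x) + C t x y (y - x)) (at t)" for t
      using has_vector_derivative_diff[OF ode ode] diff by metis
    show "((\<lambda>t. R t (x,y) (y - x)) has_vector_derivative B t x y (R t (x,y) (y - x)) + C t x y (y - x)) (at t)" for t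
      using bounded_linear.has_vector_derivative[OF blinfun.bounded_linear_left R(3)[of "(x,y)" t]]
      by (simp add: comp_apply blinfun.add_left)
  qed (simp add: init R(2))
  have du: "(u t has_derivative blinfun_apply (R t (x,x))) (at x)" for t x
  proof (rule has_derivativeI_sandwich[of 1])
    have "continuous_on UNIV (\<lambda>y. norm (R t (x,y) - R t (x,x)))"
      by (intro continuous_intros contR)
    then have "isCont (\<lambda>y. norm (R t (x,y) - R t (x,x))) x"
      by (simp add: continuous_on_eq_continuous_at)
    then show "((\<lambda>y. norm (R t (x,y) - R t (x,x))) \<longlongrightarrow> 0) (at x)"
      by (auto simp: isCont_def)
    show "norm (u t y - u t x - R t (x,x) (y - x)) / norm (y - x) \<le> norm (R t (x,y) - R t (x,x))"
      if "y \<noteq> x" for y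
      using norm_blinfun[of "R t (x,y) - R t (x,x)" "y - x"] that by (simp add: eq blinfun.diff_left divide_simps)
  qed (auto intro: blinfun.bounded_linear_right)
  show ?thesis
  proof (rule that[of "\<lambda>t x. R t (x,x)"])
    \<comment> \<open>Two partial derivatives, of which the one in \<open>x\<close> is jointly
      continuous, combine to a total derivative.\<close>
    show "((\<lambda>(t,x). u t x) has_derivative (\<lambda>(\<tau>,\<xi>). \<tau> *\<^sub>R F t x + R t (x,x) \<xi>)) (at (t, x))" for t x
      using has_derivative_partialsI[of u x "\<lambda>\<tau>. \<tau> *\<^sub>R F t x" t UNIV UNIV "\<lambda>t x. R t (x,x)"] ode du
        contR[of UNIV fst "\<lambda>z. (snd z, snd z)"]
      by (auto simp: has_vector_derivative_def split_beta split_beta' continuous_on_eq_continuous_at intro: continuous_intros)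
  qed (use R(2) R(3)[of "(x, x)" for x] in \<open>simp_all add: comp_apply\<close>)
qed

text \<open>The induction varies \<open>b\<close>, \<open>u\<close> and \<open>c\<close> but keeps
  \<open>a\<close>. For a fixed direction \<open>\<xi>\<close> the vector \<open>R t x \<xi>\<close>
  again solves an equation with coefficient \<open>a\<close>, and its inhomogeneous term involves
  only \<open>u\<close> and first derivatives of \<open>a\<close> and \<open>b\<close>. Evaluating
  at \<open>\<xi>\<close> also keeps the type of the unknown, which the induction cannot
  change.\<close>

lemma linear_ode_Ck:
  fixes a :: "real \<times> 'e::euclidean_space \<Rightarrow> 'y::banach \<Rightarrow>\<^sub>L 'y"
  assumes "Ck_on k UNIV a" "Ck_on k UNIV b"
    "\<And>t x. ((\<lambda>t. u t x) has_vector_derivative a (t,x) (u t x) + b (t,x)) (at t)" "\<And>x. u 0 x = c"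
  shows "Ck_on k UNIV (\<lambda>(t,x). u t x)"
  using assms
proof (induction k arbitrary: b u c)
  case 0
  then have cont: "continuous_on UNIV a" "continuous_on UNIV b" by auto
  then have "continuous_on UNIV (\<lambda>(t,x). a (t,x))" "continuous_on UNIV (\<lambda>(t,x). b (t,x))"
    by (simp_all add: split_beta split_beta')
  then obtain v where v: "continuous_on UNIV (\<lambda>(t,p). v t p)" "\<And>p. v 0 p = c"
    "\<And>t p. ((\<lambda>t. v t p) has_vector_derivative a (t,p) (v t p) + b (t,p)) (at t)"
    using linear_ode_exists[of "\<lambda>t x. a (t,x)" "\<lambda>t x. b (t,x)" c] by blast
  \<comment> \<open>\<open>u\<close> is given pointwise in \<open>x\<close> only; its continuity
    comes from identifying it with the solution that Picard's lemma constructs.\<close>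
  have "u t x = v t x" for t x
  proof (rule linear_ode_unique[of "\<lambda>t. a (t,x)" "\<lambda>t. u t x" "\<lambda>t. b (t,x)"])
    show "continuous_on UNIV (\<lambda>t. a (t,x))"
      by (rule continuous_on_compose2[OF cont(1)]) (auto intro: continuous_intros)
  qed (use 0(3,4) v in auto)
  then show ?case using v(1) by (simp add: split_beta split_beta')
next
  case (Suc k)
  have a: "Ck_on k UNIV a" and b: "Ck_on k UNIV b" using Suc.prems(1,2)[THEN Ck_on_SucD] by auto
  have u: "Ck_on k UNIV (\<lambda>z. u (fst z) (snd z))"
    using Suc.IH[OF a b Suc.prems(3,4)] by (simp add: split_beta split_beta')
  define DA where "DA \<xi> z = frechet_derivative a (at z) (0, \<xi>)" for \<xi> z
  define DB where "DB \<xi> z = frechet_derivative b (at z) (0, \<xi>)" for \<xi> z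
  have part: "((\<lambda>y. f (t,y)) has_derivative (\<lambda>\<xi>. frechet_derivative f (at (t,y)) (0,\<xi>))) (at y)"
    if "Ck_on (Suc k) UNIV f" for f :: "real \<times> 'e \<Rightarrow> 'z::real_normed_vector" and t y
    by (rule has_derivative_compose[OF _ Ck_on_has_derivative[OF that UNIV_I], of "\<lambda>y. (t,y)" "\<lambda>\<xi>. (0,\<xi>)"])
       (auto intro!: derivative_eq_intros)
  have Ck_DA: "Ck_on k UNIV (DA \<xi>)" and Ck_DB: "Ck_on k UNIV (DB \<xi>)" for \<xi>
    using Suc.prems(1,2) unfolding DA_def DB_def by auto
  \<comment> \<open>The derivative in \<open>y\<close> of the right-hand side, with the solution
    value frozen at the parameter \<open>q = (t, x)\<close>.\<close>
  define D where "D q y = blinfun_of_basis (\<lambda>\<xi>. DA \<xi> (fst q, y) (u (fst q) (snd q)) + DB \<xi> (fst q, y))" for q y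
  have lin: "linear (\<lambda>\<xi>. DA \<xi> z w + DB \<xi> z)" and
    F_deriv: "((\<lambda>y. a (t,y) w + b (t,y)) has_derivative (\<lambda>\<xi>. DA \<xi> (t,y) w + DB \<xi> (t,y))) (at y)" for z w t y
  proof -
    show *: "((\<lambda>y. a (t,y) w + b (t,y)) has_derivative (\<lambda>\<xi>. DA \<xi> (t,y) w + DB \<xi> (t,y))) (at y)" for t y
      unfolding DA_def DB_def
      by (intro has_derivative_add bounded_linear.has_derivative[OF blinfun.bounded_linear_left]
            part[OF Suc.prems(1)] part[OF Suc.prems(2)])
    show "linear (\<lambda>\<xi>. DA \<xi> z w + DB \<xi> z)"
      using has_derivative_linear[OF *[of "fst z" "snd z"]] by simp
  qed
  obtain C where C: "continuous_on UNIV (\<lambda>(q,x,y). C q x y)"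
    "\<And>q x y. (a (fst q,y) (u (fst q) (snd q)) + b (fst q,y)) - (a (fst q,x) (u (fst q) (snd q)) + b (fst q,x))
       = blinfun_apply (C q x y) (y - x)" "\<And>q x. C q x x = D q x"
  proof (rule hadamard_parametric[of "\<lambda>q y. a (fst q,y) (u (fst q) (snd q)) + b (fst q,y)" D])
    show "((\<lambda>y. a (fst q,y) (u (fst q) (snd q)) + b (fst q,y)) has_derivative blinfun_apply (D q x)) (at x)" for q x
      using F_deriv unfolding D_def by (subst blinfun_of_basis_apply[OF lin, abs_def])
    have comp: "continuous_on UNIV (\<lambda>z::(real \<times> 'e) \<times> 'e. h (fst (fst z), snd z))" if "Ck_on k UNIV h"
      for h :: "real \<times> 'e \<Rightarrow> 'z::real_normed_vector"
      by (rule continuous_on_compose2[OF Ck_on_continuous_on[OF that]]) (auto intro!: continuous_intros)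
    have "continuous_on UNIV (\<lambda>z::(real \<times> 'e) \<times> 'e. u (fst (fst z)) (snd (fst z)))"
      by (rule continuous_on_compose2[OF Ck_on_continuous_on[OF u], of _ fst, simplified]) (auto intro!: continuous_intros)
    then show "continuous_on UNIV (\<lambda>(q, x). D q x)"
      unfolding D_def split_beta
      by (intro continuous_on_blinfun_of_basis continuous_on_add blinfun.continuous_on comp[OF Ck_DA] comp[OF Ck_DB])
  qed auto
  obtain R where R: "\<And>x. R 0 x = 0"
    "\<And>t x. ((\<lambda>t. R t x) has_vector_derivative (a (t,x) o\<^sub>L R t x) + C (t,x) x x) (at t)"
    "\<And>t x. ((\<lambda>(t,x). u t x) has_derivative (\<lambda>(\<tau>,\<xi>). \<tau> *\<^sub>R (a (t,x) (u t x) + b (t,x)) + R t x \<xi>)) (at (t, x))"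
  \<comment> \<open>The difference of the right-hand sides at \<open>y\<close> and \<open>x\<close>
    splits into \<open>a (t,y)\<close> applied to \<open>u t y - u t x\<close>, plus a difference
    with \<open>u t x\<close> held fixed; the latter is the Hadamard term \<open>C\<close>.\<close>
  proof (rule differentiable_dependence[OF Suc.prems(3), where B = "\<lambda>t x y. a (t,y)" and C = "\<lambda>t x y. C (t,x) x y" and c = 0])
    show "a (t, y) (u t y) + b (t, y) - (a (t, x) (u t x) + b (t, x)) =
       a (t, y) (u t y - u t x) + C (t, x) x y (y - x)" for t x y
      using C(2)[of "(t,x)" y x] by (simp add: blinfun.diff_right algebra_simps)
    show "continuous_on UNIV (\<lambda>(t, x, y). a (t, y))"
      unfolding split_beta by (rule continuous_on_compose2[OF Ck_on_continuous_on[OF a]]) (auto intro!: continuous_intros)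
    show "continuous_on UNIV (\<lambda>(t, x, y). C (t, x) x y)"
    proof -
      have "continuous_on UNIV (\<lambda>z::real \<times> 'e \<times> 'e. ((fst z, fst (snd z)), fst (snd z), snd (snd z)))"
        by (intro continuous_intros)
      from continuous_on_compose2[OF C(1) this] show ?thesis by (simp add: split_beta split_beta')
    qed
  qed (auto simp: Suc.prems(4))
  have Ck_R: "Ck_on k UNIV (\<lambda>(t,x). R t x \<xi>)" for \<xi>
  proof (rule Suc.IH[OF a])
    show "Ck_on k UNIV (\<lambda>z. DA \<xi> z (u (fst z) (snd z)) + DB \<xi> z)"
      by (intro Ck_on_add Ck_on_blinfun_apply Ck_DA Ck_DB u open_UNIV)
    show "((\<lambda>t. R t x \<xi>) has_vector_derivative a (t,x) (R t x \<xi>) +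
       (DA \<xi> (t,x) (u (fst (t,x)) (snd (t,x))) + DB \<xi> (t,x))) (at t)" for t x
      using bounded_linear.has_vector_derivative[OF blinfun.bounded_linear_left R(2)[of x t], of \<xi>]
      by (simp add: blinfun.add_left C(3) D_def blinfun_of_basis_apply[OF lin])
  qed (simp add: R(1))
  show ?case
  proof (rule Ck_on_SucI[OF open_UNIV])
    show "((\<lambda>(t,x). u t x) has_derivative (\<lambda>v. fst v *\<^sub>R (a z (u (fst z) (snd z)) + b z) + R (fst z) (snd z) (snd v))) (at z)" for z
      using R(3)[of "fst z" "snd z"] by (simp add: split_beta split_beta')
    show "Ck_on k UNIV (\<lambda>z. fst v *\<^sub>R (a z (u (fst z) (snd z)) + b z) + R (fst z) (snd z) (snd v))" for v
      using Ck_R[of "snd v"] Ck_on_blinfun_apply[OF open_UNIV a u] b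
      by (intro Ck_on_add Ck_on_scaleR Ck_on_const open_UNIV) (simp_all add: split_beta split_beta')
  qed
qed

text \<open>If \<open>\<Phi>\<close> is C^k, so is the coefficient \<open>D (\<Phi> t x)\<close> of
  the variational equation; \<open>linear_ode_Ck\<close> makes the space derivative C^k, and
  together with the time derivative \<open>X (\<Phi> t x)\<close> this gives one more order for
  \<open>\<Phi>\<close>.\<close>

lemma flow_Ck:
  fixes X :: "'e::euclidean_space \<Rightarrow> 'e"
  assumes X: "\<And>k. Ck_on k UNIV X" and Lip: "\<And>x y. norm (X x - X y) \<le> K * norm (x - y)"
  obtains \<Phi> where "\<And>k. Ck_on k UNIV (\<lambda>(t,x). \<Phi> t x)" "\<And>x. \<Phi> 0 x = x"
    "\<And>t x. ((\<lambda>t. \<Phi> t x) has_vector_derivative X (\<Phi> t x)) (at t)"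
proof -
  have cX: "continuous_on UNIV X" using X[of 0] by simp
  obtain \<Phi> where \<Phi>: "continuous_on UNIV (\<lambda>(t,x). \<Phi> t x)" "\<And>x. \<Phi> 0 x = x"
    "\<And>t x. ((\<lambda>t. \<Phi> t x) has_vector_derivative X (\<Phi> t x)) (at t)"
  proof (rule picard_parametric[of "\<lambda>t (p::'e) y. X y" "\<lambda>x. x"])
    show "continuous_on UNIV (\<lambda>(t, p, y). X y)"
      unfolding split_beta by (rule continuous_on_compose2[OF cX]) (auto intro!: continuous_intros)
  qed (use Lip in \<open>auto intro: continuous_intros\<close>)
  have c\<Phi>: "continuous_on UNIV (\<lambda>z. \<Phi> (fst z) (snd z))" using \<Phi>(1) by (simp add: split_beta split_beta')
  have c\<Phi>2: "continuous_on S (\<lambda>z. \<Phi> (t z) (x z))" if "continuous_on S t" "continuous_on S x" for t x and S :: "'z::topological_space set"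
    using continuous_on_compose2[OF c\<Phi>, of S "\<lambda>z. (t z, x z)"] that by (auto intro: continuous_intros)
  define D where "D y = blinfun_of_basis (frechet_derivative X (at y))" for y
  have XD: "(X has_derivative frechet_derivative X (at y)) (at y)" for y
    using Ck_on_has_derivative[OF X[of 1, unfolded One_nat_def]] by blast
  have D_apply: "blinfun_apply (D y) v = frechet_derivative X (at y) v" for y v
    unfolding D_def using XD by (intro blinfun_of_basis_apply has_derivative_linear)
  have CkD: "Ck_on k UNIV D" for k
    unfolding D_def using X[of "Suc k"] by (intro Ck_on_blinfun_of_basis) auto
  \<comment> \<open>\<open>X\<close> depends on no parameter, so a dummy real \<open>q\<close>
    stands in for it.\<close>
  obtain C where C: "continuous_on UNIV (\<lambda>(q::real,x,y). C q x y)"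
    "\<And>q x y. X y - X x = blinfun_apply (C q x y) (y - x)" "\<And>q x. C q x x = D x"
  proof (rule hadamard_parametric[of "\<lambda>q::real. X" "\<lambda>q. D"])
    show "(X has_derivative blinfun_apply (D x)) (at x)" for x
      using XD[of x] by (simp add: D_apply[abs_def])
    show "continuous_on UNIV (\<lambda>(q::real, x). D x)"
      unfolding split_beta by (rule continuous_on_compose2[OF Ck_on_continuous_on[OF CkD]]) (auto intro!: continuous_intros)
  qed auto
  obtain R where R: "\<And>x. R 0 x = id_blinfun"
    "\<And>t x. ((\<lambda>t. R t x) has_vector_derivative (C 0 (\<Phi> t x) (\<Phi> t x) o\<^sub>L R t x) + 0) (at t)"
    "\<And>t x. ((\<lambda>(t,x). \<Phi> t x) has_derivative (\<lambda>(\<tau>,\<xi>). \<tau> *\<^sub>R X (\<Phi> t x) + R t x \<xi>)) (at (t, x))"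
  proof (rule differentiable_dependence[OF \<Phi>(3), where B = "\<lambda>t x y. C 0 (\<Phi> t x) (\<Phi> t y)" and C = "\<lambda>t x y. 0" and c = id_blinfun])
    show "X (\<Phi> t y) - X (\<Phi> t x) = C 0 (\<Phi> t x) (\<Phi> t y) (\<Phi> t y - \<Phi> t x) + blinfun_apply 0 (y - x)" for t x y
      using C(2) by simp
    have "continuous_on UNIV (\<lambda>z::real \<times> 'e \<times> 'e. (0::real, \<Phi> (fst z) (fst (snd z)), \<Phi> (fst z) (snd (snd z))))"
      by (intro continuous_intros c\<Phi>2)
    from continuous_on_compose2[OF C(1) this]
    show "continuous_on UNIV (\<lambda>(t, x, y). C 0 (\<Phi> t x) (\<Phi> t y))" by (simp add: split_beta split_beta')
  qed (auto simp: \<Phi>(2))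
  have "Ck_on k UNIV (\<lambda>z. \<Phi> (fst z) (snd z))" for k
  proof (induction k)
    case 0
    then show ?case using c\<Phi> by simp
  next
    case (Suc k)
    have Ck_R: "Ck_on k UNIV (\<lambda>(t,x). R t x \<xi>)" for \<xi>
    proof (rule linear_ode_Ck[where b = "\<lambda>_. 0"])
      show "Ck_on k UNIV (\<lambda>z. D (\<Phi> (fst z) (snd z)))"
        by (rule Ck_on_compose[OF open_UNIV open_UNIV CkD Suc.IH]) simp
      show "((\<lambda>t. R t x \<xi>) has_vector_derivative D (\<Phi> (fst (t,x)) (snd (t,x))) (R t x \<xi>) + 0) (at t)" for t x
        using bounded_linear.has_vector_derivative[OF blinfun.bounded_linear_left R(2)[of x t], of \<xi>]
        by (simp add: C(3))
    qed (auto simp: R(1) Ck_on_const)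
    show ?case
    proof (rule Ck_on_SucI[OF open_UNIV])
      show "((\<lambda>z. \<Phi> (fst z) (snd z)) has_derivative (\<lambda>v. fst v *\<^sub>R X (\<Phi> (fst z) (snd z)) + R (fst z) (snd z) (snd v))) (at z)" for z
        using R(3)[of "fst z" "snd z"] by (simp add: split_beta split_beta')
      show "Ck_on k UNIV (\<lambda>z. fst v *\<^sub>R X (\<Phi> (fst z) (snd z)) + R (fst z) (snd z) (snd v))" for v
        using Ck_R[of "snd v"] Ck_on_compose[OF open_UNIV open_UNIV X Suc.IH]
        by (intro Ck_on_add Ck_on_scaleR Ck_on_const open_UNIV) (simp_all add: split_beta split_beta')
    qed
  qed
  then show ?thesis using that[of \<Phi>] \<Phi> by (simp add: split_beta split_beta')
qed

text \<open>Here the base point is fixed and the factors must be smooth. \<open>g b z\<close> is the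
  integral of the \<open>b\<close>-th partial derivative along the segment from \<open>z0\<close> to
  \<open>z\<close>, and its smoothness in \<open>z\<close> comes from \<open>linear_ode_Ck\<close>
  with zero coefficient.\<close>

lemma hadamard_smooth:
  fixes f :: "'e::euclidean_space \<Rightarrow> 'y::banach"
  assumes f: "\<And>k. Ck_on k UNIV f"
  obtains g where "\<And>k b. Ck_on k UNIV (g b)" "\<And>z. f z - f z0 = (\<Sum>b\<in>Basis. ((z - z0) \<bullet> b) *\<^sub>R g b z)"
    "\<And>b. g b z0 = frechet_derivative f (at z0) b"
proof -
  let ?D = "\<lambda>b z. frechet_derivative f (at z) b"
  have CkD: "Ck_on k UNIV (\<lambda>(s, z). ?D b (z0 + s *\<^sub>R (z - z0)))" for b k
  proof -
    have "Ck_on k UNIV (\<lambda>p :: real \<times> 'e. z0 + fst p *\<^sub>R (snd p + - z0))"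
      by (intro Ck_on_add Ck_on_scaleR Ck_on_const Ck_on_fst Ck_on_snd open_UNIV)
    moreover have "Ck_on k UNIV (?D b)" using f[of "Suc k"] by auto
    ultimately have "Ck_on k UNIV (\<lambda>p :: real \<times> 'e. ?D b (z0 + fst p *\<^sub>R (snd p + - z0)))"
      using Ck_on_compose[OF open_UNIV open_UNIV] by blast
    then show ?thesis by (simp add: split_beta split_beta')
  qed
  have "\<exists>u. (\<forall>p. u 0 p = 0) \<and> (\<forall>t p. ((\<lambda>t. u t p) has_vector_derivative ?D b (z0 + t *\<^sub>R (p - z0))) (at t))" for b
    using linear_ode_exists[of "\<lambda>_ _. 0" "\<lambda>s z. ?D b (z0 + s *\<^sub>R (z - z0))" 0] CkD[of 0]
    by (auto simp: split_beta) metis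
  then obtain u where u: "\<And>b p. u b 0 p = 0"
    "\<And>b t p. ((\<lambda>t. u b t p) has_vector_derivative ?D b (z0 + t *\<^sub>R (p - z0))) (at t)" by metis
  have Cku: "Ck_on k UNIV (\<lambda>(t, x). u b t x)" for b k
    by (rule linear_ode_Ck[where a = "\<lambda>_. 0" and c = 0, OF _ CkD[of k b]]) (auto simp: u Ck_on_const)
  show ?thesis
  proof (rule that[of "\<lambda>b z. u b 1 z"])
    show "Ck_on k UNIV (u b 1)" for k b
      using Ck_on_compose[OF open_UNIV open_UNIV Cku[of k b] Ck_on_Pair[OF open_UNIV Ck_on_const Ck_on_ident], of 1]
      by simp
    have lin: "linear (frechet_derivative f (at z))" for z
      using Ck_on_has_derivative[OF f[of "Suc 0"]] by (blast intro: has_derivative_linear)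
    show "f z - f z0 = (\<Sum>b\<in>Basis. ((z - z0) \<bullet> b) *\<^sub>R u b 1 z)" for z
    proof -
      define d where "d s = f (z0 + s *\<^sub>R (z - z0)) - (\<Sum>b\<in>Basis. ((z - z0) \<bullet> b) *\<^sub>R u b s z)" for s
      have "(d has_vector_derivative 0) (at s)" for s
      proof -
        let ?y = "z0 + s *\<^sub>R (z - z0)"
        have "((\<lambda>s. z0 + s *\<^sub>R (z - z0)) has_derivative (\<lambda>h. h *\<^sub>R (z - z0))) (at s)"
          by (auto intro!: derivative_eq_intros)
        from has_derivative_compose[OF this Ck_on_has_derivative[OF f[of "Suc 0"] UNIV_I]]
        have "((\<lambda>s. f (z0 + s *\<^sub>R (z - z0))) has_vector_derivative frechet_derivative f (at ?y) (z - z0)) (at s)"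
          by (simp add: has_vector_derivative_def linear_scale[OF lin])
        moreover have "((\<lambda>s. \<Sum>b\<in>Basis. ((z - z0) \<bullet> b) *\<^sub>R u b s z) has_vector_derivative
            (\<Sum>b\<in>Basis. ((z - z0) \<bullet> b) *\<^sub>R ?D b ?y)) (at s)"
          by (intro has_vector_derivative_sum bounded_linear.has_vector_derivative[OF bounded_linear_scaleR_right] u)
        ultimately show ?thesis
          unfolding d_def using linear_euclidean_sum[OF lin, of ?y "z - z0"] has_vector_derivative_diff by fastforce
      qed
      from zero_derivative_eq[OF this, of 1 0] show ?thesis by (simp add: d_def u diff_eq_eq)
    qed
    show "u b 1 z0 = ?D b z0" for b
    proof -
      have "((\<lambda>s. u b s z0 - s *\<^sub>R ?D b z0) has_vector_derivative 0) (at s)" for s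
        using has_vector_derivative_diff[OF u(2)[of b z0 s] has_vector_derivative_scaleR_left[of "?D b z0"]] by simp
      from zero_derivative_eq[OF this, of 1 0] show ?thesis by (simp add: u)
    qed
  qed
qed

section \<open>Bump functions\<close>

text \<open>The powers of \<open>inverse s\<close> close the family under differentiation, and the
  difference quotient of \<open>flat_exp n\<close> at 0 is \<open>flat_exp (Suc n)\<close>.
  Smoothness of all members is then one induction on the order.\<close>

definition flat_exp :: "nat \<Rightarrow> real \<Rightarrow> real" where
  "flat_exp n s = (if s > 0 then exp (- inverse s) * inverse s ^ n else 0)"

lemma flat_exp_tendsto_0: "(flat_exp n \<longlongrightarrow> 0) (at 0)"
proof -
  have "((\<lambda>s::real. inverse s ^ n / exp (inverse s)) \<longlongrightarrow> 0) (at_right 0)"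
    by (rule filterlim_compose[OF tendsto_power_div_exp_0 filterlim_inverse_at_top_right])
  moreover have "\<forall>\<^sub>F s in at_right 0. inverse s ^ n / exp (inverse s) = flat_exp n s"
    by (auto simp: eventually_at_filter flat_exp_def exp_minus field_simps)
  ultimately have "(flat_exp n \<longlongrightarrow> 0) (at_right 0)"
    by (rule Lim_transform_eventually)
  moreover have "\<forall>\<^sub>F s in at_left 0. flat_exp n s = 0"
    by (auto simp: eventually_at_filter flat_exp_def)
  then have "(flat_exp n \<longlongrightarrow> 0) (at_left 0)"
    by (rule tendsto_eventually)
  ultimately show ?thesis using filterlim_at_split by blast
qed

lemma flat_exp_deriv:
  "(flat_exp n has_real_derivative flat_exp (n + 2) s - real n * flat_exp (Suc n) s) (at s)"
proof -
  consider "s > 0" | "s < 0" | "s = 0" by linarith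
  then show ?thesis
  proof cases
    case 1
    have "((\<lambda>s. exp (- inverse s) * inverse s ^ n) has_real_derivative
        flat_exp (n + 2) s - real n * flat_exp (Suc n) s) (at s)"
      using 1 by (cases n)
        (auto intro!: derivative_eq_intros simp: flat_exp_def field_simps power2_eq_square,
         metis One_nat_def mult.commute not_gr_zero power_minus_mult)
    then show ?thesis
      by (rule has_field_derivative_transform_within_open[of _ _ _ "{0<..}"])
         (use 1 in \<open>auto simp: flat_exp_def\<close>)
  next
    case 2
    have "((\<lambda>s. 0) has_real_derivative 0) (at s)" by simp
    then have "(flat_exp n has_real_derivative 0) (at s)"
      by (rule has_field_derivative_transform_within_open[of _ _ _ "{..<0}"])
         (use 2 in \<open>auto simp: flat_exp_def\<close>)
    then show ?thesis using 2 by (simp add: flat_exp_def)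
  next
    case 3
    have "flat_exp (Suc n) = (\<lambda>h. (flat_exp n (0 + h) - flat_exp n 0) / h)"
      by (auto simp: flat_exp_def divide_inverse)
    then have "(flat_exp n has_real_derivative 0) (at 0)"
      using flat_exp_tendsto_0[of "Suc n"] unfolding DERIV_def by metis
    then show ?thesis using 3 by (simp add: flat_exp_def)
  qed
qed

lemma flat_exp_Ck: "Ck_on k UNIV (flat_exp n)"
proof (induction k arbitrary: n)
  case 0
  show ?case
    by (simp add: continuous_at_imp_continuous_on DERIV_isCont[OF flat_exp_deriv])
next
  case (Suc k)
  show ?case
  proof (rule Ck_on_SucI[OF open_UNIV])
    show "(flat_exp n has_derivative (\<lambda>h. (flat_exp (n + 2) s + (- real n) * flat_exp (Suc n) s) * h)) (at s)" for s
      using flat_exp_deriv[of n s] by (simp add: has_field_derivative_def)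
    show "Ck_on k UNIV (\<lambda>s. (flat_exp (n + 2) s + (- real n) * flat_exp (Suc n) s) * v)" for v
      by (intro Ck_on_mult Ck_on_add Ck_on_const Suc.IH open_UNIV)
  qed
qed

lemma smooth_bump:
  fixes x0 :: "'e::euclidean_space"
  assumes "0 < r" "r < R"
  obtains \<beta> :: "'e \<Rightarrow> real" where "\<And>k. Ck_on k UNIV \<beta>"
    "\<And>z. z \<in> cball x0 r \<Longrightarrow> \<beta> z = 1" "\<And>z. z \<notin> ball x0 R \<Longrightarrow> \<beta> z = 0"
proof -
  define c where "c = flat_exp 0 1"
  have c: "c > 0" by (simp add: c_def flat_exp_def)
  \<comment> \<open>\<open>\<rho>\<close> is at most 0 on the inner ball and at least 1 off the
    outer one. The inner \<open>flat_exp\<close> is thus 0, respectively at least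
    \<open>c = flat_exp 0 1\<close>, so the outer one is maximal, respectively 0; the last factor of
    \<open>\<beta>\<close> normalises the maximum to 1.\<close>
  define \<rho> where "\<rho> z = ((z + - x0) \<bullet> (z + - x0) + - r\<^sup>2) * inverse (R\<^sup>2 - r\<^sup>2)" for z
  define \<beta> where "\<beta> z = flat_exp 0 (c + (- 1) * flat_exp 0 (\<rho> z)) * inverse (flat_exp 0 c)" for z
  have pos: "R\<^sup>2 - r\<^sup>2 > 0" using assms power_strict_mono[of r R 2] by simp
  show ?thesis
  proof (rule that[of \<beta>])
    show "Ck_on k UNIV \<beta>" for k
    proof -
      have "Ck_on k UNIV \<rho>"
        unfolding \<rho>_def
        by (intro Ck_on_mult Ck_on_add Ck_on_bilinear[OF bounded_bilinear_inner] Ck_on_ident Ck_on_const open_UNIV)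
      then have "Ck_on k UNIV (\<lambda>z. flat_exp 0 (\<rho> z))"
        using Ck_on_compose[OF open_UNIV open_UNIV flat_exp_Ck] by blast
      then have "Ck_on k UNIV (\<lambda>z. c + (- 1) * flat_exp 0 (\<rho> z))"
        by (intro Ck_on_mult Ck_on_add Ck_on_const open_UNIV)
      then have "Ck_on k UNIV (\<lambda>z. flat_exp 0 (c + (- 1) * flat_exp 0 (\<rho> z)))"
        using Ck_on_compose[OF open_UNIV open_UNIV flat_exp_Ck] by blast
      then show ?thesis unfolding \<beta>_def by (intro Ck_on_mult Ck_on_const open_UNIV)
    qed
    have \<rho>: "\<rho> z = ((dist x0 z)\<^sup>2 - r\<^sup>2) / (R\<^sup>2 - r\<^sup>2)" for z
      by (simp add: \<rho>_def dist_norm norm_minus_commute[of x0] divide_inverse flip: power2_norm_eq_inner)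
    show "\<beta> z = 1" if "z \<in> cball x0 r" for z
    proof -
      have "(dist x0 z)\<^sup>2 \<le> r\<^sup>2" using that by (intro power_mono) auto
      then have "\<rho> z \<le> 0" using pos by (simp add: \<rho> divide_nonpos_pos)
      then have "flat_exp 0 (\<rho> z) = 0" by (simp add: flat_exp_def)
      then show ?thesis using c by (simp add: \<beta>_def flat_exp_def)
    qed
    show "\<beta> z = 0" if "z \<notin> ball x0 R" for z
    proof -
      have "(dist x0 z)\<^sup>2 \<ge> R\<^sup>2" using that assms by (intro power_mono) auto
      then have "\<rho> z \<ge> 1" using pos by (simp add: \<rho> le_divide_eq)
      then have "flat_exp 0 (\<rho> z) \<ge> c"
        by (simp add: c_def flat_exp_def inverse_le_1_iff)
      then show ?thesis by (simp add: \<beta>_def flat_exp_def)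
    qed
  qed
qed

lemma Ck_on_cutoff:
  fixes f :: "'e::real_normed_vector \<Rightarrow> 'y::real_normed_vector"
  assumes "open W" "closed C" "C \<subseteq> W" "Ck_on k W f" "Ck_on k UNIV \<beta>" "\<And>z. z \<notin> C \<Longrightarrow> \<beta> z = 0"
  shows "Ck_on k UNIV (\<lambda>z. \<beta> z *\<^sub>R f z)"
proof (rule Ck_on_local)
  fix z
  show "\<exists>W. open W \<and> z \<in> W \<and> Ck_on k W (\<lambda>z. \<beta> z *\<^sub>R f z)"
  proof (cases "z \<in> W")
    case True
    have "Ck_on k W (\<lambda>z. \<beta> z *\<^sub>R f z)"
      using assms Ck_on_mono by (intro Ck_on_scaleR) blast+
    then show ?thesis using True assms(1) by blast
  next
    case False
    have "open (- C)" using assms(2) by blast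
    moreover from this have "Ck_on k (- C) (\<lambda>z. \<beta> z *\<^sub>R f z)"
      by (rule Ck_on_cong[OF _ _ Ck_on_const[of _ _ 0]]) (use assms(6) \<open>open (- C)\<close> in auto)
    ultimately show ?thesis using False assms(3) by blast
  qed
qed

text \<open>Off \<open>C\<close> the function vanishes on an open set, so its directional
  derivatives are bounded globally; their bounds over the basis add up to a Lipschitz
  constant.\<close>

lemma compact_support_Lipschitz:
  fixes f :: "'e::euclidean_space \<Rightarrow> 'y::real_normed_vector"
  assumes f: "Ck_on 1 UNIV f" and C: "compact C" "\<And>z. z \<notin> C \<Longrightarrow> f z = 0"
  obtains K where "\<And>x y. norm (f x - f y) \<le> K * norm (x - y)"
proof -
  let ?D = "\<lambda>z. frechet_derivative f (at z)"
  have D: "(f has_derivative ?D z) (at z)" for z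
    using Ck_on_has_derivative[of 0 UNIV f] f by simp
  have lin: "linear (?D z)" for z using D has_derivative_linear by blast
  have "\<exists>K. \<forall>z. norm (?D z b) \<le> K" for b
  proof -
    have "continuous_on UNIV (\<lambda>z. ?D z b)" using f by simp
    from continuous_on_compact_norm_bound[OF continuous_on_subset[OF this subset_UNIV] C(1)]
    obtain K where K: "\<And>z. z \<in> C \<Longrightarrow> norm (?D z b) \<le> K" by blast
    have "?D z b = 0" if "z \<notin> C" for z
    proof -
      have "((\<lambda>z. 0) has_derivative (\<lambda>h. 0)) (at z)" by simp
      then have "(f has_derivative (\<lambda>h. 0)) (at z)"
        by (rule has_derivative_transform_within_open[of _ _ _ _ "- C"])
           (use that C compact_imp_closed in auto)
      from frechet_derivative_at[OF this] show ?thesis by metis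
    qed
    then show ?thesis using K by (metis abs_ge_self abs_ge_zero norm_zero order_trans)
  qed
  then obtain B where B: "\<And>z b. norm (?D z b) \<le> B b" by metis
  define K where "K = (\<Sum>b\<in>(Basis::'e set). B b)"
  have "onorm (?D z) \<le> K" for z
  proof (rule onorm_le)
    fix v
    have "norm (?D z v) \<le> (\<Sum>b\<in>Basis. norm ((v \<bullet> b) *\<^sub>R ?D z b))"
      unfolding linear_euclidean_sum[OF lin, of z v] by (rule norm_sum)
    also have "\<dots> \<le> (\<Sum>b\<in>Basis. B b * norm v)"
      using B by (intro sum_mono) (auto simp: mult.commute[of _ "norm v"] intro!: mult_mono Basis_le_norm)
    finally show "norm (?D z v) \<le> K * norm v" by (simp add: K_def sum_distrib_right)
  qed
  then have "norm (f x - f y) \<le> K * norm (x - y)" for x y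
    using differentiable_bound[of UNIV f ?D K x y] D by auto
  then show ?thesis using that by blast
qed

section \<open>Smooth functions on a manifold\<close>

text \<open>\<open>g\<close> is an ambient extension of \<open>f\<close> in coordinates. The chart
  image is open only in \<open>E\<close>, so \<open>g\<close> is not determined off
  \<open>E\<close>.\<close>

definition chart_rep :: "'p set \<Rightarrow> ('p \<Rightarrow> 'e::euclidean_space) \<Rightarrow> ('p \<Rightarrow> real) \<Rightarrow> 'p \<Rightarrow> 'e set \<Rightarrow> ('e \<Rightarrow> real) \<Rightarrow> bool" where
  "chart_rep V \<phi> f p W g \<longleftrightarrow>
     open W \<and> \<phi> p \<in> W \<and> (\<forall>k. Ck_on k W g) \<and> (\<forall>q\<in>V. \<phi> q \<in> W \<longrightarrow> f q = g (\<phi> q))"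

definition smooth_at :: "('p set \<times> ('p \<Rightarrow> 'e::euclidean_space)) set \<Rightarrow> ('p \<Rightarrow> real) \<Rightarrow> 'p \<Rightarrow> bool" where
  "smooth_at A f p \<longleftrightarrow> (\<exists>(V,\<phi>)\<in>A. p \<in> V \<and> (\<exists>W g. chart_rep V \<phi> f p W g))"

lemma chart_rep_mono:
  "chart_rep V \<phi> f p W g \<Longrightarrow> open O' \<Longrightarrow> \<phi> p \<in> O' \<Longrightarrow> O' \<subseteq> W \<Longrightarrow> chart_rep V \<phi> f p O' g"
  unfolding chart_rep_def using Ck_on_mono by blast

locale manifold =
  fixes E :: "'e::euclidean_space set"
    and A :: "('p::{t2_space,second_countable_topology} set \<times> ('p \<Rightarrow> 'e)) set"
  assumes manifold: "smooth_manifold E A"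
begin

section \<open>Topology of charts\<close>

lemma subspace: "subspace E"
  using manifold by (simp add: smooth_manifold_def)

lemma chart_exists: obtains V \<phi> where "(V,\<phi>) \<in> A" "p \<in> V"
proof -
  have "p \<in> (\<Union>(U,\<phi>)\<in>A. U)" using manifold by (simp add: smooth_manifold_def)
  then show ?thesis using that by auto
qed

context
  fixes V \<phi> assumes chart: "(V,\<phi>) \<in> A"
begin

lemma chart_open: "open V"
  and chart_openin: "openin (top_of_set E) (\<phi> ` V)"
  and chart_homeomorphism: "homeomorphism V (\<phi> ` V) \<phi> (inv_into V \<phi>)"
  using manifold chart by (auto simp: smooth_manifold_def)

lemma chart_inv: "q \<in> V \<Longrightarrow> inv_into V \<phi> (\<phi> q) = q"
  using chart_homeomorphism by (auto simp: homeomorphism_def)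

lemma chart_inj: "q \<in> V \<Longrightarrow> q' \<in> V \<Longrightarrow> \<phi> q = \<phi> q' \<Longrightarrow> q = q'"
  using chart_inv by metis

lemma chart_in_E: "q \<in> V \<Longrightarrow> \<phi> q \<in> E"
  using openin_subset[OF chart_openin] by auto

lemma chart_continuous: "continuous_on V \<phi>" "continuous_on (\<phi> ` V) (inv_into V \<phi>)"
  using chart_homeomorphism by (auto simp: homeomorphism_def)

lemma chart_open_preimage: "open W \<Longrightarrow> open {q\<in>V. \<phi> q \<in> W}"
proof -
  assume "open W"
  moreover have "V \<inter> \<phi> -` W = {q\<in>V. \<phi> q \<in> W}" by auto
  ultimately show ?thesis using continuous_open_preimage[OF chart_continuous(1) chart_open] by metis
qed

lemma chart_open_image:
  assumes "open U"
  obtains W where "open W" "\<phi> ` (U \<inter> V) = E \<inter> W"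
proof -
  have "openin (top_of_set (\<phi> ` V)) (\<phi> ` V \<inter> inv_into V \<phi> -` U)"
    using chart_continuous(2) assms continuous_openin_preimage_gen by blast
  moreover have "\<phi> ` V \<inter> inv_into V \<phi> -` U = \<phi> ` (U \<inter> V)" by (auto simp: chart_inv)
  ultimately have "openin (top_of_set E) (\<phi> ` (U \<inter> V))"
    using openin_trans chart_openin by metis
  then show ?thesis using that by (auto simp: openin_open)
qed

lemma chart_open_image_ball:
  assumes "open U" "p \<in> U" "p \<in> V"
  obtains r where "r > 0" "E \<inter> ball (\<phi> p) r \<subseteq> \<phi> ` (U \<inter> V)"
proof -
  obtain W where W: "open W" "\<phi> ` (U \<inter> V) = E \<inter> W" using chart_open_image[OF assms(1)] .
  then have "\<phi> p \<in> W" using assms by auto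
  then obtain r where "r > 0" "ball (\<phi> p) r \<subseteq> W" using W(1) open_contains_ball by metis
  then show ?thesis using that[of r] W(2) by blast
qed

lemma chart_rep_restrict:
  assumes "chart_rep V \<phi> f p W g" "open U" "p \<in> U" "p \<in> V"
  obtains W' where "chart_rep V \<phi> f p W' g" "W' \<subseteq> W" "\<And>q. q \<in> V \<Longrightarrow> \<phi> q \<in> W' \<Longrightarrow> q \<in> U"
proof -
  obtain O' where O': "open O'" "\<phi> ` (U \<inter> V) = E \<inter> O'" using chart_open_image[OF assms(2)] .
  show ?thesis
  proof (rule that[of "W \<inter> O'"])
    have "\<phi> p \<in> O'" using O'(2) assms by auto
    then show "chart_rep V \<phi> f p (W \<inter> O') g"
      using assms(1) O'(1) by (intro chart_rep_mono[OF assms(1)]) (auto simp: chart_rep_def)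
    show "q \<in> U" if "q \<in> V" "\<phi> q \<in> W \<inter> O'" for q
    proof -
      have "\<phi> q \<in> \<phi> ` (U \<inter> V)" using O' that chart_in_E by auto
      then show ?thesis using that chart_inj by auto
    qed
  qed simp
qed

end

text \<open>Any chart around \<open>p\<close> can replace the one that witnesses
  \<open>smooth_at\<close>: compose the given extension with an ambient extension
  \<open>\<tau>\<close> of the transition map.\<close>

lemma smooth_at_chart:
  assumes "smooth_at A f p" "(V,\<phi>) \<in> A" "p \<in> V"
  obtains W g where "chart_rep V \<phi> f p W g"
proof -
  obtain V0 \<phi>0 W0 g0 where 0: "(V0,\<phi>0) \<in> A" "p \<in> V0" "chart_rep V0 \<phi>0 f p W0 g0"
    using assms(1) by (auto simp: smooth_at_def)
  have "smooth_on (\<phi> ` (V \<inter> V0)) (\<phi>0 \<circ> inv_into V \<phi>)"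
    using manifold assms(2) 0(1) unfolding smooth_manifold_def by blast
  moreover have "\<phi> p \<in> \<phi> ` (V \<inter> V0)" using assms(3) 0(2) by blast
  ultimately obtain W1 \<tau> where \<tau>: "open W1" "\<phi> p \<in> W1" "\<And>k. Ck_on k W1 \<tau>"
    "\<And>y. y \<in> \<phi> ` (V \<inter> V0) \<inter> W1 \<Longrightarrow> \<tau> y = (\<phi>0 \<circ> inv_into V \<phi>) y"
    unfolding smooth_on_def by metis
  obtain O' where O': "open O'" "\<phi> ` (V0 \<inter> V) = E \<inter> O'"
    using chart_open_image[OF assms(2) chart_open[OF 0(1)]] .
  \<comment> \<open>\<open>O'\<close> cuts the image of the chart overlap out of \<open>E\<close>;
    at chart points outside \<open>V0\<close> the map \<open>\<tau>\<close> need not be the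
    transition map.\<close>
  define W where "W = (W1 \<inter> \<tau> -` W0) \<inter> O'"
  have oW: "open W"
    unfolding W_def using \<tau>(1,3) 0(3) O'(1) Ck_on_continuous_on
    by (intro open_Int continuous_open_preimage) (auto simp: chart_rep_def)
  have in_W: "q \<in> V0 \<and> \<phi> q \<in> W1 \<and> \<tau> (\<phi> q) = \<phi>0 q" if "q \<in> V" "\<phi> q \<in> O'" "\<phi> q \<in> W1" for q
  proof -
    have "\<phi> q \<in> \<phi> ` (V0 \<inter> V)" using that O'(2) chart_in_E[OF assms(2)] by auto
    then have "q \<in> V0" using that chart_inj[OF assms(2)] by auto
    then show ?thesis using \<tau>(4)[of "\<phi> q"] that chart_inv[OF assms(2)] by auto
  qed
  have pO: "\<phi> p \<in> O'" using O'(2) assms(3) 0(2) by auto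
  have "chart_rep V \<phi> f p W (\<lambda>z. g0 (\<tau> z))"
    unfolding chart_rep_def
  proof (intro conjI allI ballI impI)
    show "\<phi> p \<in> W" using in_W[OF assms(3) pO \<tau>(2)] pO 0(3) by (auto simp: W_def chart_rep_def)
    show "Ck_on k W (\<lambda>z. g0 (\<tau> z))" for k
      using 0(3) Ck_on_mono[OF \<tau>(3), of W]
      by (intro Ck_on_compose[OF oW, of W0 k g0]) (auto simp: chart_rep_def W_def)
    show "f q = g0 (\<tau> (\<phi> q))" if "q \<in> V" "\<phi> q \<in> W" for q
      using in_W[of q] that 0(3) by (auto simp: W_def chart_rep_def)
  qed (rule oW)
  then show ?thesis using that by blast
qed

lemma Cinf_iff:
  assumes "open U"
  shows "f \<in> Cinf A U \<longleftrightarrow> f \<in> extensional U \<and> (\<forall>p\<in>U. smooth_at A f p)"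
proof (intro iffI conjI ballI)
  assume f: "f \<in> Cinf A U"
  then show "f \<in> extensional U" by (simp add: Cinf_def)
  fix p assume p: "p \<in> U"
  obtain V \<phi> where V: "(V,\<phi>) \<in> A" "p \<in> V" using chart_exists .
  have "smooth_on (\<phi> ` (U \<inter> V)) (f \<circ> inv_into V \<phi>)" using f V by (auto simp: Cinf_def)
  moreover have "\<phi> p \<in> \<phi> ` (U \<inter> V)" using p V by auto
  ultimately obtain W g where g: "open W" "\<phi> p \<in> W" "\<And>k. Ck_on k W g"
    "\<And>y. y \<in> \<phi> ` (U \<inter> V) \<inter> W \<Longrightarrow> g y = (f \<circ> inv_into V \<phi>) y"
    unfolding smooth_on_def by metis
  obtain O' where O': "open O'" "\<phi> ` (U \<inter> V) = E \<inter> O'" using chart_open_image[OF V(1) assms] .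
  have "chart_rep V \<phi> f p (W \<inter> O') g"
    unfolding chart_rep_def
  proof (intro conjI allI ballI impI)
    show "\<phi> p \<in> W \<inter> O'" using g(2) O'(2) p V by auto
    show "Ck_on k (W \<inter> O') g" for k using Ck_on_mono[OF g(3)] by blast
    show "f q = g (\<phi> q)" if "q \<in> V" "\<phi> q \<in> W \<inter> O'" for q
      using g(4)[of "\<phi> q"] that O'(2) chart_in_E[OF V(1)] chart_inv[OF V(1)] by auto
  qed (use g O' in auto)
  then show "smooth_at A f p" using V by (auto simp: smooth_at_def)
next
  assume f: "f \<in> extensional U \<and> (\<forall>p\<in>U. smooth_at A f p)"
  have "smooth_on (\<phi> ` (U \<inter> V)) (f \<circ> inv_into V \<phi>)" if V: "(V,\<phi>) \<in> A" for V \<phi>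
    unfolding smooth_on_def
  proof
    fix y assume "y \<in> \<phi> ` (U \<inter> V)"
    then obtain p where p: "p \<in> U" "p \<in> V" "y = \<phi> p" by auto
    then obtain W g where W: "chart_rep V \<phi> f p W g" using smooth_at_chart V f by metis
    then have "\<forall>z\<in>\<phi> ` (U \<inter> V) \<inter> W. g z = (f \<circ> inv_into V \<phi>) z"
      using chart_inv[OF V] by (auto simp: chart_rep_def)
    then show "\<exists>W g. open W \<and> y \<in> W \<and> (\<forall>k. Ck_on k W g) \<and> (\<forall>z\<in>\<phi> ` (U \<inter> V) \<inter> W. g z = (f \<circ> inv_into V \<phi>) z)"
      using W p(3) unfolding chart_rep_def by blast
  qed
  then show "f \<in> Cinf A U" using f by (auto simp: Cinf_def)
qed

lemma Cinf_UNIV_iff: "f \<in> Cinf A UNIV \<longleftrightarrow> (\<forall>p. smooth_at A f p)"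
  by (simp add: Cinf_iff)

section \<open>Pointwise calculus of smooth functions\<close>

lemma smooth_at_cong:
  assumes "smooth_at A f p" "open U" "p \<in> U" "\<And>q. q \<in> U \<Longrightarrow> f q = f' q"
  shows "smooth_at A f' p"
proof -
  obtain V \<phi> W g where V: "(V,\<phi>) \<in> A" "p \<in> V" "chart_rep V \<phi> f p W g"
    using assms(1) by (auto simp: smooth_at_def)
  obtain W' where W': "chart_rep V \<phi> f p W' g" "\<And>q. q \<in> V \<Longrightarrow> \<phi> q \<in> W' \<Longrightarrow> q \<in> U"
    using chart_rep_restrict[OF V(1,3) assms(2,3) V(2)] by metis
  then have "chart_rep V \<phi> f' p W' g" using assms(4) by (auto simp: chart_rep_def)
  then show ?thesis using V by (auto simp: smooth_at_def)
qed

lemma smooth_at_restrict: "open U \<Longrightarrow> p \<in> U \<Longrightarrow> smooth_at A f p \<Longrightarrow> smooth_at A (restrict f U) p"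
  by (erule smooth_at_cong) auto

lemma smooth_at_chart_comp:
  assumes "(V,\<phi>) \<in> A" "p \<in> V" "open W" "\<phi> p \<in> W" "\<And>k. Ck_on k W g"
  shows "smooth_at A (\<lambda>q. g (\<phi> q)) p"
proof -
  have "chart_rep V \<phi> (\<lambda>q. g (\<phi> q)) p W g" using assms by (simp add: chart_rep_def)
  then show ?thesis using assms by (auto simp: smooth_at_def)
qed

lemma smooth_at_const: "smooth_at A (\<lambda>q. c) p"
proof -
  obtain V \<phi> where V: "(V,\<phi>) \<in> A" "p \<in> V" using chart_exists .
  show ?thesis using smooth_at_chart_comp[OF V open_UNIV UNIV_I Ck_on_const[OF open_UNIV]] .
qed

lemma smooth_at_binary:
  assumes "smooth_at A f p" "smooth_at A g p"
    and op: "\<And>k W f g. open W \<Longrightarrow> Ck_on k W f \<Longrightarrow> Ck_on k W g \<Longrightarrow> Ck_on k W (\<lambda>z::'e. op (f z) (g z))"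
  shows "smooth_at A (\<lambda>q. op (f q) (g q)) p"
proof -
  obtain V \<phi> where V: "(V,\<phi>) \<in> A" "p \<in> V" using chart_exists .
  obtain W1 f' where 1: "chart_rep V \<phi> f p W1 f'" using smooth_at_chart[OF assms(1) V] .
  obtain W2 g' where 2: "chart_rep V \<phi> g p W2 g'" using smooth_at_chart[OF assms(2) V] .
  have "chart_rep V \<phi> (\<lambda>q. op (f q) (g q)) p (W1 \<inter> W2) (\<lambda>z. op (f' z) (g' z))"
    using 1 2 unfolding chart_rep_def
    by (auto intro!: op elim: Ck_on_mono)
  then show ?thesis using V by (auto simp: smooth_at_def)
qed

lemmas smooth_at_add = smooth_at_binary[where op = "(+)", OF _ _ Ck_on_add]
lemmas smooth_at_mult = smooth_at_binary[where op = "(*)", OF _ _ Ck_on_mult]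

lemma smooth_at_sum: "(\<And>i. i \<in> S \<Longrightarrow> smooth_at A (f i) p) \<Longrightarrow> smooth_at A (\<lambda>q. \<Sum>i\<in>S. f i q) p"
  by (induction S rule: infinite_finite_induct) (auto intro: smooth_at_const smooth_at_add)

text \<open>Made for the flow: \<open>T\<close> is known only through its coordinate expression
  \<open>\<Psi>\<close>, and a representative of \<open>f\<close> composed with
  \<open>\<Psi>\<close> represents the pullback.\<close>

lemma chart_transport_smooth_at:
  assumes "smooth_at A f (T p)" and V: "(V,\<phi>) \<in> A" "p \<in> V" "T p \<in> V" and U: "open U" "p \<in> U"
    and \<Psi>: "\<And>k. Ck_on k UNIV \<Psi>" and T: "\<And>q. q \<in> U \<Longrightarrow> q \<in> V \<and> T q \<in> V \<and> \<phi> (T q) = \<Psi> (\<phi> q)"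
  shows "smooth_at A (\<lambda>q. f (T q)) p"
proof -
  obtain W g where W: "chart_rep V \<phi> f (T p) W g" using smooth_at_chart[OF assms(1) V(1,3)] .
  have oW: "open (\<Psi> -` W)"
    using W Ck_on_continuous_on[OF \<Psi>] by (intro open_vimage) (auto simp: chart_rep_def)
  have "Ck_on k (\<Psi> -` W) (\<lambda>z. g (\<Psi> z))" for k
    using W Ck_on_mono[OF \<Psi>, of "\<Psi> -` W"] by (intro Ck_on_compose[OF oW, of W k g]) (auto simp: chart_rep_def)
  moreover have "\<phi> p \<in> \<Psi> -` W" using T[OF U(2)] W by (auto simp: chart_rep_def)
  ultimately have "smooth_at A (\<lambda>q. g (\<Psi> (\<phi> q))) p"
    by (intro smooth_at_chart_comp[OF V(1,2) oW])
  then show ?thesis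
  proof (rule smooth_at_cong)
    show "open (U \<inter> {q\<in>V. \<phi> q \<in> \<Psi> -` W})" using U(1) chart_open_preimage[OF V(1) oW] by blast
    show "p \<in> U \<inter> {q\<in>V. \<phi> q \<in> \<Psi> -` W}" using U V \<open>\<phi> p \<in> \<Psi> -` W\<close> by auto
    show "g (\<Psi> (\<phi> q)) = f (T q)" if "q \<in> U \<inter> {q\<in>V. \<phi> q \<in> \<Psi> -` W}" for q
      using that T[of q] W by (auto simp: chart_rep_def)
  qed
qed

text \<open>The closed set \<open>C\<close> is what permits extension by zero: its complement is
  open, and together with the chart domain it covers the manifold.\<close>

lemma manifold_bump:
  assumes "open U" "p \<in> U"
  obtains h U' C where "h \<in> Cinf A UNIV" "open U'" "p \<in> U'" "\<And>q. q \<in> U' \<Longrightarrow> h q = (1::real)"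
    "closed C" "C \<subseteq> U" "\<And>q. q \<notin> C \<Longrightarrow> h q = 0"
proof -
  obtain V \<phi> where V: "(V,\<phi>) \<in> A" "p \<in> V" using chart_exists .
  obtain r where r: "r > 0" "E \<inter> ball (\<phi> p) r \<subseteq> \<phi> ` (U \<inter> V)"
    using chart_open_image_ball[OF V(1) assms V(2)] .
  have "0 < r/3" "r/3 < r/2" using r by auto
  then obtain \<beta> :: "'e \<Rightarrow> real" where \<beta>: "\<And>k. Ck_on k UNIV \<beta>"
    "\<And>z. z \<in> cball (\<phi> p) (r/3) \<Longrightarrow> \<beta> z = 1" "\<And>z. z \<notin> ball (\<phi> p) (r/2) \<Longrightarrow> \<beta> z = 0"
    using smooth_bump[of "r/3" "r/2" "\<phi> p"] by metis
  define h where "h q = (if q \<in> V then \<beta> (\<phi> q) else 0)" for q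
  define C where "C = inv_into V \<phi> ` (E \<inter> cball (\<phi> p) (r/2))"
  have sub: "E \<inter> cball (\<phi> p) (r/2) \<subseteq> \<phi> ` (U \<inter> V)" using r by force
  have "compact (E \<inter> cball (\<phi> p) (r/2))"
    using closed_subspace[OF subspace] compact_cball by (intro closed_Int_compact)
  \<comment> \<open>Closedness in the whole manifold is obtained from compactness in the chart and
    the Hausdorff property.\<close>
  then have "compact C"
    unfolding C_def using sub
    by (intro compact_continuous_image continuous_on_subset[OF chart_continuous(2)[OF V(1)]]) auto
  then have C: "closed C" using compact_imp_closed by blast
  have CUV: "C \<subseteq> U \<inter> V" using sub chart_inv[OF V(1)] by (auto simp: C_def)
  have h0: "h q = 0" if "q \<notin> C" for q
  proof (rule ccontr)
    assume "h q \<noteq> 0"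
    then have q: "q \<in> V" "\<phi> q \<in> ball (\<phi> p) (r/2)" using \<beta>(3) by (auto simp: h_def split: if_splits)
    then have "\<phi> q \<in> E \<inter> cball (\<phi> p) (r/2)" using chart_in_E[OF V(1)] by auto
    then have "q \<in> C" unfolding C_def using chart_inv[OF V(1) q(1)] by (metis imageI)
    then show False using that by simp
  qed
  have "smooth_at A h q" for q
  proof (cases "q \<in> V")
    case True
    have "smooth_at A (\<lambda>q. \<beta> (\<phi> q)) q" using smooth_at_chart_comp[OF V(1) True open_UNIV UNIV_I \<beta>(1)] .
    then show ?thesis by (rule smooth_at_cong[OF _ chart_open[OF V(1)] True]) (simp add: h_def)
  next
    case False
    then show ?thesis
      using CUV h0 C by (intro smooth_at_cong[OF smooth_at_const[of 0], of "- C"]) auto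
  qed
  then have "h \<in> Cinf A UNIV" by (simp add: Cinf_UNIV_iff)
  moreover have "open {q\<in>V. \<phi> q \<in> ball (\<phi> p) (r/3)}" by (rule chart_open_preimage[OF V(1) open_ball])
  ultimately show ?thesis
    using that[of h "{q\<in>V. \<phi> q \<in> ball (\<phi> p) (r/3)}" C] V r \<beta>(2) C CUV h0 by (auto simp: h_def)
qed

lemma smooth_extension:
  assumes "open U" "p \<in> U" "\<And>q. q \<in> U \<Longrightarrow> smooth_at A f q"
  obtains F U' where "F \<in> Cinf A UNIV" "open U'" "p \<in> U'" "U' \<subseteq> U" "\<And>q. q \<in> U' \<Longrightarrow> F q = f q"
proof -
  obtain h U' C where h: "h \<in> Cinf A UNIV" "open U'" "p \<in> U'" "\<And>q. q \<in> U' \<Longrightarrow> h q = (1::real)"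
    "closed C" "C \<subseteq> U" "\<And>q. q \<notin> C \<Longrightarrow> h q = 0" using manifold_bump[OF assms(1,2)] by metis
  have "smooth_at A (\<lambda>q. h q * f q) q" for q
  proof (cases "q \<in> U")
    case True
    then show ?thesis using assms(3) h(1) by (intro smooth_at_mult) (auto simp: Cinf_UNIV_iff)
  next
    case False
    then show ?thesis
      using h by (intro smooth_at_cong[OF smooth_at_const[of 0], of "- C"]) auto
  qed
  then show ?thesis using that[of "\<lambda>q. h q * f q" "U' \<inter> U"] h assms by (auto simp: Cinf_UNIV_iff)
qed

end

section \<open>Brackets as derivations\<close>

locale bracket_manifold = manifold E A
  for E :: "'e::euclidean_space set"
    and A :: "('p::{t2_space,second_countable_topology} set \<times> ('p \<Rightarrow> 'e)) set" +
  fixes br :: "'p bracket"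
  assumes leibniz: "leibniz_bracket A br"
begin

lemma Cinf_UNIV_const: "(\<lambda>q. c) \<in> Cinf A UNIV"
  and Cinf_UNIV_add: "F \<in> Cinf A UNIV \<Longrightarrow> G \<in> Cinf A UNIV \<Longrightarrow> (\<lambda>q. F q + G q) \<in> Cinf A UNIV"
  and Cinf_UNIV_mult: "F \<in> Cinf A UNIV \<Longrightarrow> G \<in> Cinf A UNIV \<Longrightarrow> (\<lambda>q. F q * G q) \<in> Cinf A UNIV"
  by (auto simp: Cinf_UNIV_iff intro: smooth_at_const smooth_at_add smooth_at_mult)

lemma Cinf_UNIV_sum: "(\<And>i. i \<in> S \<Longrightarrow> F i \<in> Cinf A UNIV) \<Longrightarrow> (\<lambda>q. \<Sum>i\<in>S. F i q) \<in> Cinf A UNIV"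
  by (auto simp: Cinf_UNIV_iff intro: smooth_at_sum)

section \<open>Derivation rules and locality of the bracket\<close>

lemma br_closed: "F \<in> Cinf A UNIV \<Longrightarrow> G \<in> Cinf A UNIV \<Longrightarrow> br F G \<in> Cinf A UNIV"
  and br_skew: "F \<in> Cinf A UNIV \<Longrightarrow> G \<in> Cinf A UNIV \<Longrightarrow> br F G x = - br G F x"
  using leibniz unfolding leibniz_bracket_def by (blast, metis)

lemma br_linear:
  "H \<in> Cinf A UNIV \<Longrightarrow> F \<in> Cinf A UNIV \<Longrightarrow> G \<in> Cinf A UNIV \<Longrightarrow>
    br H (\<lambda>x. a * F x + b * G x) = (\<lambda>x. a * br H F x + b * br H G x)"
  using leibniz unfolding leibniz_bracket_def by blast

lemma br_mult:
  "H \<in> Cinf A UNIV \<Longrightarrow> F \<in> Cinf A UNIV \<Longrightarrow> G \<in> Cinf A UNIV \<Longrightarrow>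
    br H (\<lambda>x. F x * G x) = (\<lambda>x. br H F x * G x + F x * br H G x)"
  using leibniz unfolding leibniz_bracket_def by blast

lemma br_add:
  "H \<in> Cinf A UNIV \<Longrightarrow> F \<in> Cinf A UNIV \<Longrightarrow> G \<in> Cinf A UNIV \<Longrightarrow>
    br H (\<lambda>x. F x + G x) = (\<lambda>x. br H F x + br H G x)"
  using br_linear[of H F G 1 1] by simp

lemma br_const:
  assumes "H \<in> Cinf A UNIV"
  shows "br H (\<lambda>x. c) = (\<lambda>x. 0)"
proof -
  have "br H (\<lambda>x. 1) x = 0" for x
    using fun_cong[OF br_mult[OF assms Cinf_UNIV_const[of 1] Cinf_UNIV_const[of 1]], of x] by simp
  then show ?thesis
    using br_linear[OF assms Cinf_UNIV_const[of 1] Cinf_UNIV_const[of 1], of c 0] by simp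
qed

lemma br_sum:
  assumes H: "H \<in> Cinf A UNIV" and F: "\<And>i. i \<in> S \<Longrightarrow> F i \<in> Cinf A UNIV"
  shows "br H (\<lambda>x. \<Sum>i\<in>S. F i x) = (\<lambda>x. \<Sum>i\<in>S. br H (F i) x)"
  using F by (induction S rule: infinite_finite_induct)
    (auto simp: br_const[OF H] br_add[OF H] Cinf_UNIV_sum)

text \<open>With a bump \<open>h\<close> that is 1 near \<open>x\<close> and 0 off \<open>U\<close>,
  the product of \<open>F - G\<close> and \<open>h\<close> is identically 0. By the Leibniz rule its
  bracket at \<open>x\<close> reduces to that of \<open>F - G\<close>, because \<open>F - G\<close>
  vanishes at \<open>x\<close>.\<close>

lemma br_local:
  assumes H: "H \<in> Cinf A UNIV" and F: "F \<in> Cinf A UNIV" and G: "G \<in> Cinf A UNIV"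
    and U: "open U" "x \<in> U" "\<And>q. q \<in> U \<Longrightarrow> F q = G q"
  shows "br H F x = br H G x"
proof -
  obtain h U' C where h: "h \<in> Cinf A UNIV" "open U'" "x \<in> U'" "\<And>q. q \<in> U' \<Longrightarrow> h q = (1::real)"
    "closed C" "C \<subseteq> U" "\<And>q. q \<notin> C \<Longrightarrow> h q = 0" using manifold_bump[OF U(1,2)] by metis
  define D where "D q = 1 * F q + (- 1) * G q" for q
  have D: "D \<in> Cinf A UNIV"
    unfolding D_def by (intro Cinf_UNIV_add Cinf_UNIV_mult Cinf_UNIV_const F G)
  have "(\<lambda>q. D q * h q) = (\<lambda>q. 0)"
    using U(3) h(6,7) by (intro ext) (auto simp: D_def)
  then have "0 = br H D x * h x + D x * br H h x"
    using br_mult[OF H D h(1)] br_const[OF H, of 0] by metis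
  then have "br H D x = 0" using h U by (simp add: D_def)
  then show ?thesis using br_linear[OF H F G, of 1 "-1"] by (simp add: D_def[abs_def])
qed

lemma local_bracket_eq:
  assumes F: "F \<in> Cinf A UNIV" "\<forall>\<^sub>F y in nhds x. F y = f y" and G: "G \<in> Cinf A UNIV" "\<forall>\<^sub>F y in nhds x. G y = g y"
    and x: "x \<in> U"
  shows "local_bracket A br U f g x = br F G x"
proof -
  have eq: "br F' G' x = br F G x"
    if F': "F' \<in> Cinf A UNIV" "\<forall>\<^sub>F y in nhds x. F' y = f y" and G': "G' \<in> Cinf A UNIV" "\<forall>\<^sub>F y in nhds x. G' y = g y"
    for F' G'
  proof -
    have "\<forall>\<^sub>F y in nhds x. F' y = F y" using F'(2) F(2) by eventually_elim simp
    then have 1: "br G F' x = br G F x"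
      unfolding eventually_nhds using br_local[OF G(1) F'(1) F(1)] by blast
    have "\<forall>\<^sub>F y in nhds x. G' y = G y" using G'(2) G(2) by eventually_elim simp
    then have "br F' G' x = br F' G x"
      unfolding eventually_nhds using br_local[OF F'(1) G'(1) G(1)] by blast
    then show ?thesis using 1 br_skew[OF F'(1) G(1), of x] br_skew[OF F(1) G(1), of x] by simp
  qed
  have "(THE c. \<exists>F\<in>Cinf A UNIV. \<exists>G\<in>Cinf A UNIV.
     (\<forall>\<^sub>F y in nhds x. F y = f y) \<and> (\<forall>\<^sub>F y in nhds x. G y = g y) \<and> c = br F G x) = br F G x"
    by (rule the_equality) (use F G eq in blast)+
  then show ?thesis using x by (simp add: local_bracket_def)
qed

end

section \<open>Hamiltonian vector fields in charts\<close>

context manifold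
begin

lemma projection_exists:
  obtains \<pi> :: "'e \<Rightarrow> 'e" where "bounded_linear \<pi>" "\<And>x. \<pi> x \<in> E" "\<And>x. x \<in> E \<Longrightarrow> \<pi> x = x"
proof -
  obtain \<pi> :: "'e \<Rightarrow> 'e" where "range \<pi> \<subseteq> E" "linear \<pi>" "\<forall>v\<in>E. \<pi> (id v) = v"
    using linear_exists_left_inverse_on[OF linear_id subspace inj_on_id] by auto
  then show ?thesis using that[of \<pi>] by (auto simp: linear_conv_bounded_linear)
qed

lemma smooth_extension_chart:
  assumes V: "(V,\<phi>) \<in> A" "q \<in> V" and g: "\<And>k. Ck_on k UNIV g"
  shows "\<exists>G U'. G \<in> Cinf A UNIV \<and> open U' \<and> q \<in> U' \<and> (\<forall>x\<in>U'. G x = g (\<phi> x))"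
proof (rule smooth_extension[OF chart_open[OF V(1)] V(2)])
  show "smooth_at A (\<lambda>x. g (\<phi> x)) x" if "x \<in> V" for x
    by (rule smooth_at_chart_comp[OF V(1) that open_UNIV UNIV_I g])
qed blast

end

lemma chart_rep_has_derivative:
  "chart_rep V \<phi> f q W g \<Longrightarrow> (g has_derivative frechet_derivative g (at (\<phi> q))) (at (\<phi> q))"
  unfolding chart_rep_def using Ck_on_has_derivative by blast

context bracket_manifold
begin

text \<open>Near \<open>q\<close>, Hadamard's lemma writes \<open>F\<close> as a constant plus
  products of coordinate differences, which vanish at \<open>q\<close>, with smooth factors. The
  Leibniz rule leaves only the brackets of the coordinates, weighted by the partial derivatives of
  \<open>g\<close>.\<close>

lemma derivation_chart_rep:
  assumes V: "(V,\<phi>) \<in> A" and H: "H \<in> Cinf A UNIV"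
    and c: "\<And>b. b \<in> Basis \<Longrightarrow> c b \<in> Cinf A UNIV"
    and U: "open U" "q \<in> U" "U \<subseteq> V" "\<And>q b. q \<in> U \<Longrightarrow> b \<in> Basis \<Longrightarrow> c b q = \<phi> q \<bullet> b"
    and F: "F \<in> Cinf A UNIV" "chart_rep V \<phi> F q W g"
  shows "br H F q = frechet_derivative g (at (\<phi> q)) (\<Sum>b\<in>Basis. br H (c b) q *\<^sub>R b)"
proof -
  have q: "q \<in> V" using U by auto
  obtain r where r: "r > 0" "ball (\<phi> q) r \<subseteq> W" using F(2) open_contains_ball unfolding chart_rep_def by metis
  have "0 < r/3" "r/3 < r/2" using r by auto
  then obtain \<beta> :: "'e \<Rightarrow> real" where \<beta>: "\<And>k. Ck_on k UNIV \<beta>"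
    "\<And>z. z \<in> cball (\<phi> q) (r/3) \<Longrightarrow> \<beta> z = 1" "\<And>z. z \<notin> ball (\<phi> q) (r/2) \<Longrightarrow> \<beta> z = 0"
    using smooth_bump[of "r/3" "r/2" "\<phi> q"] by metis
  \<comment> \<open>The cutoff makes the representative global, as \<open>hadamard_smooth\<close>
    requires, without changing it near \<open>\<phi> q\<close>.\<close>
  define g' where "g' z = \<beta> z *\<^sub>R g z" for z
  have g'_eq: "g' z = g z" if "z \<in> ball (\<phi> q) (r/3)" for z using \<beta>(2)[of z] that by (simp add: g'_def)
  have Ck_g': "Ck_on k UNIV g'" for k
    unfolding g'_def
  proof (rule Ck_on_cutoff[of W "cball (\<phi> q) (r/2)"])
    show "cball (\<phi> q) (r/2) \<subseteq> W" using r by force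
  qed (use F(2) \<beta> in \<open>auto simp: chart_rep_def\<close>)
  obtain K where K: "\<And>k b. Ck_on k UNIV (K b)"
    "\<And>z. g' z - g' (\<phi> q) = (\<Sum>b\<in>Basis. ((z - \<phi> q) \<bullet> b) *\<^sub>R K b z)"
    "\<And>b. K b (\<phi> q) = frechet_derivative g' (at (\<phi> q)) b"
    using hadamard_smooth[of g' "\<phi> q", OF Ck_g'] by blast
  have "(g has_derivative frechet_derivative g' (at (\<phi> q))) (at (\<phi> q))"
    by (rule has_derivative_transform_within_open[OF Ck_on_has_derivative[OF Ck_g'[of "Suc 0"] UNIV_I], of "ball (\<phi> q) (r/3)"])
       (use r g'_eq in auto)
  from frechet_derivative_at[OF this] have K_q: "K b (\<phi> q) = frechet_derivative g (at (\<phi> q)) b" for b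
    by (simp add: K(3))
  have "\<exists>G U'. G \<in> Cinf A UNIV \<and> open U' \<and> q \<in> U' \<and> (\<forall>x\<in>U'. G x = K b (\<phi> x))" for b
    using smooth_extension_chart[OF V q K(1)] .
  then obtain G U' where G: "\<And>b. G b \<in> Cinf A UNIV" "\<And>b. open (U' b)" "\<And>b. q \<in> U' b"
    "\<And>b x. x \<in> U' b \<Longrightarrow> G b x = K b (\<phi> x)" by metis
  define T where "T b x = (c b x + - (\<phi> q \<bullet> b)) * G b x" for b x
  have T: "T b \<in> Cinf A UNIV" if "b \<in> Basis" for b
    unfolding T_def using c[OF that] G(1) by (intro Cinf_UNIV_add Cinf_UNIV_mult Cinf_UNIV_const)
  have S: "(\<lambda>x. \<Sum>b\<in>Basis. T b x) \<in> Cinf A UNIV" by (intro Cinf_UNIV_sum T)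
  define N where "N = U \<inter> {x\<in>V. \<phi> x \<in> ball (\<phi> q) (r/3)} \<inter> (\<Inter>b\<in>Basis. U' b)"
  have "br H F q = br H (\<lambda>x. F q + (\<Sum>b\<in>Basis. T b x)) q"
  proof (rule br_local[OF H F(1)])
    show "open N"
      unfolding N_def
      by (intro open_Int open_INT U(1) chart_open_preimage[OF V open_ball] G(2) finite_Basis ballI)
    show "q \<in> N" using U q r G(3) by (auto simp: N_def)
    fix x assume x: "x \<in> N"
    have "F x = g' (\<phi> x)" using x r F(2) g'_eq by (force simp: N_def chart_rep_def)
    moreover have "F q = g' (\<phi> q)" using q r F(2) g'_eq by (auto simp: chart_rep_def)
    moreover have "((\<phi> x - \<phi> q) \<bullet> b) *\<^sub>R K b (\<phi> x) = T b x" if "b \<in> Basis" for b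
      using x that U(4) G(4) by (auto simp: N_def T_def inner_diff_left)
    ultimately show "F x = F q + (\<Sum>b\<in>Basis. T b x)" using K(2)[of "\<phi> x"] by simp
  qed (intro Cinf_UNIV_add Cinf_UNIV_const S)
  also have "\<dots> = (\<Sum>b\<in>Basis. br H (T b) q)"
    using br_add[OF H Cinf_UNIV_const S, of "F q"] br_const[OF H] br_sum[OF H, of Basis T] T by simp
  also have "\<dots> = (\<Sum>b\<in>Basis. br H (c b) q * K b (\<phi> q))"
  proof (rule sum.cong[OF refl])
    fix b :: 'e assume b: "b \<in> Basis"
    have "br H (\<lambda>x. c b x + - (\<phi> q \<bullet> b)) q = br H (c b) q"
      by (simp only: br_add[OF H c[OF b] Cinf_UNIV_const] br_const[OF H] add_0_right)
    then show "br H (T b) q = br H (c b) q * K b (\<phi> q)"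
      unfolding T_def br_mult[OF H Cinf_UNIV_add[OF c[OF b] Cinf_UNIV_const] G(1)]
      using U(4)[OF U(2) b] G(4)[OF G(3)] by simp
  qed
  also have "\<dots> = frechet_derivative g (at (\<phi> q)) (\<Sum>b\<in>Basis. br H (c b) q *\<^sub>R b)"
    using has_derivative_linear[OF chart_rep_has_derivative[OF F(2)]]
    by (simp add: K_q linear_sum linear_scale)
  finally show ?thesis .
qed

end

text \<open>\<open>Y\<close> is an ambient vector field that represents the Hamiltonian one over
  \<open>B\<close>; tangency to \<open>E\<close> keeps its flow on chart points. \<open>K\<close>
  will give uniqueness of curves and \<open>M\<close> a speed limit. The global functions
  \<open>c b\<close> continue the coordinates, because integral curves are tested against global
  functions only.\<close>

locale flow_chart = bracket_manifold E A br
  for E :: "'e::euclidean_space set"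
    and A :: "('p::{t2_space,second_countable_topology} set \<times> ('p \<Rightarrow> 'e)) set"
    and br :: "'p bracket" +
  fixes H :: "'p \<Rightarrow> real" and V \<phi> and B :: "'e set" and Y :: "'e \<Rightarrow> 'e" and K M :: real and c :: "'e \<Rightarrow> 'p \<Rightarrow> real"
  assumes chart: "(V,\<phi>) \<in> A"
    and B: "open B" "E \<inter> B \<subseteq> \<phi> ` V"
    and Y_Ck: "\<And>k. Ck_on k UNIV Y" and Y_Lip: "\<And>x y. norm (Y x - Y y) \<le> K * norm (x - y)"
    and Y_E: "\<And>z. Y z \<in> E" and Y_bound: "\<And>z. norm (Y z) \<le> M"
    and coord: "\<And>b. b \<in> Basis \<Longrightarrow> c b \<in> Cinf A UNIV"
      "\<And>b q. b \<in> Basis \<Longrightarrow> q \<in> V \<Longrightarrow> \<phi> q \<in> B \<Longrightarrow> c b q = \<phi> q \<bullet> b"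
    and vf_rep: "\<And>q F W g. q \<in> V \<Longrightarrow> \<phi> q \<in> B \<Longrightarrow> F \<in> Cinf A UNIV \<Longrightarrow> chart_rep V \<phi> F q W g \<Longrightarrow>
      br H F q = frechet_derivative g (at (\<phi> q)) (Y (\<phi> q))"

context bracket_manifold
begin

lemma flow_chart_exists:
  assumes V: "(V,\<phi>) \<in> A" "q0 \<in> V" and H: "H \<in> Cinf A UNIV" and U0: "open U0" "q0 \<in> U0"
  obtains R Y K M c where "R > 0" "E \<inter> ball (\<phi> q0) R \<subseteq> \<phi> ` (U0 \<inter> V)"
    "flow_chart E A br H V \<phi> (ball (\<phi> q0) R) Y K M c"
proof -
  obtain \<pi> :: "'e \<Rightarrow> 'e" where \<pi>: "bounded_linear \<pi>" "\<And>x. \<pi> x \<in> E" "\<And>x. x \<in> E \<Longrightarrow> \<pi> x = x"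
    using projection_exists by metis
  have "\<exists>G U'. G \<in> Cinf A UNIV \<and> open U' \<and> q0 \<in> U' \<and> (\<forall>x\<in>U'. G x = \<phi> x \<bullet> b)" for b
    by (rule smooth_extension_chart[OF V Ck_on_bounded_linear_id[OF open_UNIV bounded_linear_inner_left]])
  then obtain c U' where c: "\<And>b. c b \<in> Cinf A UNIV" "\<And>b. open (U' b)" "\<And>b. q0 \<in> U' b"
    "\<And>b x. x \<in> U' b \<Longrightarrow> c b x = \<phi> x \<bullet> b" by metis
  define U where "U = U0 \<inter> V \<inter> (\<Inter>b\<in>Basis. U' b)"
  have U: "open U" "q0 \<in> U" "U \<subseteq> V"
    unfolding U_def using U0 V c chart_open[OF V(1)] by (auto intro!: open_INT)
  obtain r1 where r1: "r1 > 0" "E \<inter> ball (\<phi> q0) r1 \<subseteq> \<phi> ` (U \<inter> V)"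
    using chart_open_image_ball[OF V(1) U(1,2) V(2)] .
  have in_U: "q \<in> U" if "q \<in> V" "\<phi> q \<in> ball (\<phi> q0) r1" for q
  proof -
    have "\<phi> q \<in> \<phi> ` (U \<inter> V)" using r1 that chart_in_E[OF V(1)] by auto
    then show ?thesis using chart_inj[OF V(1)] that by auto
  qed
  have "\<exists>W g. chart_rep V \<phi> (br H (c b)) q0 W g" for b
  proof -
    have "smooth_at A (br H (c b)) q0" using br_closed[OF H c(1)] by (simp add: Cinf_UNIV_iff)
    from smooth_at_chart[OF this V] show ?thesis by metis
  qed
  then obtain W g where Wg: "\<And>b. chart_rep V \<phi> (br H (c b)) q0 (W b) (g b)" by metis
  define W' where "W' = (\<Inter>b\<in>Basis. \<pi> -` W b)"
  have "open W'"
    unfolding W'_def using Wg linear_continuous_on[OF \<pi>(1)]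
    by (intro open_INT ballI finite_Basis open_vimage) (auto simp: chart_rep_def)
  moreover have "\<phi> q0 \<in> W'"
    using Wg \<pi>(3) chart_in_E[OF V] by (auto simp: W'_def chart_rep_def)
  ultimately obtain r2 where r2: "r2 > 0" "ball (\<phi> q0) r2 \<subseteq> W'" using open_contains_ball by metis
  define r where "r = min r1 r2"
  have r: "r > 0" "0 < r/3" "r/3 < r/2" using r1 r2 by (auto simp: r_def)
  obtain \<beta> :: "'e \<Rightarrow> real" where \<beta>: "\<And>k. Ck_on k UNIV \<beta>"
    "\<And>z. z \<in> cball (\<phi> q0) (r/3) \<Longrightarrow> \<beta> z = 1" "\<And>z. z \<notin> ball (\<phi> q0) (r/2) \<Longrightarrow> \<beta> z = 0"
    using smooth_bump[OF r(2,3), of "\<phi> q0"] by metis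
  \<comment> \<open>The inner \<open>\<pi>\<close> extends the components from chart points to the
    ambient space, the outer one makes the field tangent to \<open>E\<close>, and
    \<open>\<beta>\<close> gives it compact support.\<close>
  define Y where "Y z = \<beta> z *\<^sub>R \<pi> (\<Sum>b\<in>Basis. g b (\<pi> z) *\<^sub>R b)" for z
  have Y_Ck: "Ck_on k UNIV Y" for k
    unfolding Y_def
  proof (rule Ck_on_cutoff[OF \<open>open W'\<close> closed_cball])
    show "cball (\<phi> q0) (r/2) \<subseteq> W'" using r2 r by (force simp: r_def)
    have "Ck_on k W' (\<lambda>z. g b (\<pi> z))" if "b \<in> Basis" for b
    proof (rule Ck_on_compose[OF \<open>open W'\<close> _ _ Ck_on_bounded_linear_id[OF \<open>open W'\<close> \<pi>(1)]])
      show "open (W b)" "Ck_on k (W b) (g b)" using Wg[of b] by (auto simp: chart_rep_def)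
    qed (use that in \<open>auto simp: W'_def\<close>)
    then show "Ck_on k W' (\<lambda>z. \<pi> (\<Sum>b\<in>Basis. g b (\<pi> z) *\<^sub>R b))"
      by (intro Ck_on_bounded_linear[OF _ \<pi>(1)] Ck_on_sum Ck_on_scaleR Ck_on_const \<open>open W'\<close>)
  qed (use \<beta> in auto)
  have Y0: "Y z = 0" if "z \<notin> cball (\<phi> q0) (r/2)" for z
    using \<beta>(3)[of z] that by (simp add: Y_def)
  obtain K where K: "\<And>x y. norm (Y x - Y y) \<le> K * norm (x - y)"
    using compact_support_Lipschitz[OF Y_Ck compact_cball Y0] by blast
  obtain M' where "\<And>z. z \<in> cball (\<phi> q0) (r/2) \<Longrightarrow> norm (Y z) \<le> M'"
    using continuous_on_compact_norm_bound[OF continuous_on_subset[OF Ck_on_continuous_on[OF Y_Ck] subset_UNIV] compact_cball] by blast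
  then have M: "norm (Y z) \<le> max 0 M'" for z
    using Y0[of z] by (cases "z \<in> cball (\<phi> q0) (r/2)") (auto simp: le_max_iff_disj)
  show ?thesis
  proof (rule that[of "r/3"])
    show "E \<inter> ball (\<phi> q0) (r/3) \<subseteq> \<phi> ` (U0 \<inter> V)"
      using r1 r by (force simp: r_def U_def)
    show "flow_chart E A br H V \<phi> (ball (\<phi> q0) (r/3)) Y K (max 0 M') c"
    proof unfold_locales
      show "E \<inter> ball (\<phi> q0) (r/3) \<subseteq> \<phi> ` V" using r1 r by (force simp: r_def U_def)
      show "Y z \<in> E" for z unfolding Y_def using \<pi>(2) subspace by (simp add: subspace_scale)
      show "c b q = \<phi> q \<bullet> b" if "b \<in> Basis" "q \<in> V" "\<phi> q \<in> ball (\<phi> q0) (r/3)" for b q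
        using in_U[of q] that r c(4) by (auto simp: r_def U_def)
      fix q F W1 h
      assume q: "q \<in> V" "\<phi> q \<in> ball (\<phi> q0) (r/3)" and F: "F \<in> Cinf A UNIV" "chart_rep V \<phi> F q W1 h"
      have qU: "q \<in> U" using in_U[of q] q r by (auto simp: r_def)
      have \<pi>q: "\<pi> (\<phi> q) = \<phi> q" using \<pi>(3) chart_in_E[OF V(1) q(1)] .
      have "\<phi> q \<in> ball (\<phi> q0) r2" using q(2) r by (auto simp: r_def)
      then have "\<phi> q \<in> W'" using r2(2) by blast
      then have gb: "g b (\<pi> (\<phi> q)) = br H (c b) q" if "b \<in> Basis" for b
        using Wg[of b] that q(1) \<pi>q by (auto simp: W'_def chart_rep_def)
      define v where "v = (\<Sum>b\<in>Basis. br H (c b) q *\<^sub>R b)"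
      have "Y (\<phi> q) = \<pi> v"
        unfolding Y_def v_def using \<beta>(2)[of "\<phi> q"] q(2) gb by simp
      \<comment> \<open>The representative \<open>h\<close> is replaced by its composition with
        \<open>\<pi>\<close>, which represents \<open>F\<close> as well. Its derivative applies
        \<open>\<pi>\<close> to \<open>v\<close>, and this is exactly
        \<open>Y (\<phi> q)\<close>.\<close>
      moreover have "br H F q = frechet_derivative (\<lambda>z. h (\<pi> z)) (at (\<phi> q)) v"
        unfolding v_def
      proof (rule derivation_chart_rep[OF V(1) H c(1) U(1) qU U(3) _ F(1)])
        show "c b q' = \<phi> q' \<bullet> b" if "q' \<in> U" "b \<in> Basis" for q' b
          using that c(4) by (auto simp: U_def)
        have "open (\<pi> -` W1)"
          using F(2) linear_continuous_on[OF \<pi>(1)] by (intro open_vimage) (auto simp: chart_rep_def)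
        moreover have "Ck_on k (\<pi> -` W1) (\<lambda>z. h (\<pi> z))" for k
        proof (rule Ck_on_compose[OF \<open>open (\<pi> -` W1)\<close> _ _ Ck_on_bounded_linear_id[OF \<open>open (\<pi> -` W1)\<close> \<pi>(1)]])
          show "open W1" "Ck_on k W1 h" using F(2) by (auto simp: chart_rep_def)
        qed auto
        ultimately show "chart_rep V \<phi> F q (\<pi> -` W1) (\<lambda>z. h (\<pi> z))"
          using F(2) \<pi>q \<pi>(3)[OF chart_in_E[OF V(1)]] unfolding chart_rep_def by simp
      qed
      moreover have "((\<lambda>z. h (\<pi> z)) has_derivative (\<lambda>v. frechet_derivative h (at (\<phi> q)) (\<pi> v))) (at (\<phi> q))"
        by (rule has_derivative_compose[OF bounded_linear_imp_has_derivative[OF \<pi>(1)]])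
           (simp add: \<pi>q chart_rep_has_derivative[OF F(2)])
      from frechet_derivative_at[OF this]
      have "frechet_derivative (\<lambda>z. h (\<pi> z)) (at (\<phi> q)) v = frechet_derivative h (at (\<phi> q)) (\<pi> v)" by metis
      ultimately show "br H F q = frechet_derivative h (at (\<phi> q)) (Y (\<phi> q))" by simp
    qed (use V Y_Ck K M c in auto)
  qed (use r in simp)
qed

end

section \<open>Integral curves\<close>

context flow_chart
begin

text \<open>Each coordinate of the curve is locally the value of a global function
  \<open>c b\<close>, to which the defining equation applies; the components are then reassembled
  over the basis.\<close>

lemma integral_curve_in_chart:
  assumes \<gamma>: "integral_curve A (br H) J \<gamma>" and s: "s \<in> J" "\<gamma> s \<in> V" "\<phi> (\<gamma> s) \<in> B"
  shows "((\<lambda>t. \<phi> (\<gamma> t)) has_vector_derivative Y (\<phi> (\<gamma> s))) (at s)"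
proof -
  define J' where "J' = J \<inter> \<gamma> -` {q\<in>V. \<phi> q \<in> B}"
  have "continuous_on J \<gamma>" "open J" using \<gamma> by (auto simp: integral_curve_def)
  then have J': "open J'" "s \<in> J'"
    unfolding J'_def using s continuous_open_preimage[OF _ _ chart_open_preimage[OF chart B(1)]] by auto
  have "((\<lambda>t. \<phi> (\<gamma> t) \<bullet> b) has_vector_derivative Y (\<phi> (\<gamma> s)) \<bullet> b) (at s)" if b: "b \<in> Basis" for b
  proof (rule has_vector_derivative_transform_within_open[OF _ J'])
    have "chart_rep V \<phi> (c b) (\<gamma> s) B (\<lambda>z. z \<bullet> b)"
      using s B coord(2)[OF b] by (auto simp: chart_rep_def intro!: Ck_on_bounded_linear_id bounded_linear_inner_left)
    from vf_rep[OF s(2,3) coord(1)[OF b] this]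
    have "br H (c b) (\<gamma> s) = Y (\<phi> (\<gamma> s)) \<bullet> b"
      using frechet_derivative_at[OF bounded_linear_imp_has_derivative[OF bounded_linear_inner_left[of b]]] by metis
    moreover have "((\<lambda>t. c b (\<gamma> t)) has_real_derivative br H (c b) (\<gamma> s)) (at s)"
      using \<gamma> s(1) coord(1)[OF b] unfolding integral_curve_def by blast
    ultimately show "((\<lambda>t. c b (\<gamma> t)) has_vector_derivative Y (\<phi> (\<gamma> s)) \<bullet> b) (at s)"
      by (simp add: has_real_derivative_iff_has_vector_derivative)
    show "c b (\<gamma> t) = \<phi> (\<gamma> t) \<bullet> b" if "t \<in> J'" for t using that coord(2)[OF b] by (auto simp: J'_def)
  qed
  then have "((\<lambda>t. \<Sum>b\<in>Basis. (\<phi> (\<gamma> t) \<bullet> b) *\<^sub>R b) has_vector_derivative (\<Sum>b\<in>Basis. (Y (\<phi> (\<gamma> s)) \<bullet> b) *\<^sub>R b)) (at s)"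
    by (intro has_vector_derivative_sum bounded_linear.has_vector_derivative[OF bounded_linear_scaleR_left])
  then show ?thesis by (simp add: euclidean_representation)
qed

lemma integral_curve_from_chart:
  assumes J: "open J" "is_interval J" and z: "\<And>s. s \<in> J \<Longrightarrow> z s \<in> E \<inter> B"
    "\<And>s. s \<in> J \<Longrightarrow> (z has_vector_derivative Y (z s)) (at s)"
  shows "integral_curve A (br H) J (\<lambda>s. inv_into V \<phi> (z s))"
  unfolding integral_curve_def
proof (intro conjI ballI J)
  let ?\<gamma> = "\<lambda>s. inv_into V \<phi> (z s)"
  have \<gamma>: "?\<gamma> s \<in> V" "\<phi> (?\<gamma> s) = z s" if "s \<in> J" for s
  proof -
    have "z s \<in> \<phi> ` V" using z(1)[OF that] B(2) by blast
    then show "?\<gamma> s \<in> V" "\<phi> (?\<gamma> s) = z s" by (simp_all add: inv_into_into f_inv_into_f)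
  qed
  have cz: "continuous_on J z"
    by (intro continuous_at_imp_continuous_on ballI has_vector_derivative_continuous[OF z(2)])
  show "continuous_on J ?\<gamma>"
    using z(1) B(2) by (intro continuous_on_compose2[OF chart_continuous(2)[OF chart] cz]) blast
  fix s F assume s: "s \<in> J" and F: "F \<in> Cinf A UNIV"
  then obtain W g where W: "chart_rep V \<phi> F (?\<gamma> s) W g"
    using smooth_at_chart[OF _ chart \<gamma>(1)[OF s], of F] by (auto simp: Cinf_UNIV_iff)
  have W': "open (J \<inter> z -` W)" "s \<in> J \<inter> z -` W"
    using W cz J(1) s \<gamma>(2)[OF s] by (auto simp: chart_rep_def intro!: continuous_open_preimage)
  have d: "(g has_derivative frechet_derivative g (at (z s))) (at (z s))"
    using chart_rep_has_derivative[OF W] \<gamma>(2)[OF s] by simp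
  have "((\<lambda>t. g (z t)) has_derivative (\<lambda>h. frechet_derivative g (at (z s)) (h *\<^sub>R Y (z s)))) (at s)"
    using has_derivative_compose[OF z(2)[OF s, unfolded has_vector_derivative_def] d] .
  then have "((\<lambda>t. g (z t)) has_vector_derivative frechet_derivative g (at (z s)) (Y (z s))) (at s)"
    by (simp add: has_vector_derivative_def linear_scale[OF has_derivative_linear[OF d]])
  then have "((\<lambda>t. F (?\<gamma> t)) has_vector_derivative frechet_derivative g (at (z s)) (Y (z s))) (at s)"
    by (rule has_vector_derivative_transform_within_open[OF _ W'])
       (use W \<gamma> in \<open>auto simp: chart_rep_def\<close>)
  moreover have "br H F (?\<gamma> s) = frechet_derivative g (at (z s)) (Y (z s))"
    using vf_rep[OF \<gamma>(1)[OF s] _ F W] \<gamma>(2)[OF s] z(1)[OF s] by simp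
  ultimately show "((\<lambda>t. F (?\<gamma> t)) has_real_derivative br H F (?\<gamma> s)) (at s)"
    by (simp add: has_real_derivative_iff_has_vector_derivative)
qed

end

context bracket_manifold
begin

text \<open>The times of agreement form an open set by uniqueness in a chart, and the times of
  disagreement one by the Hausdorff property. The common interval is connected.\<close>

lemma integral_curve_unique:
  assumes H: "H \<in> Cinf A UNIV"
    and \<gamma>1: "integral_curve A (br H) J1 \<gamma>1" and \<gamma>2: "integral_curve A (br H) J2 \<gamma>2"
    and s0: "s0 \<in> J1 \<inter> J2" "\<gamma>1 s0 = \<gamma>2 s0" and t: "t \<in> J1 \<inter> J2"
  shows "\<gamma>1 t = \<gamma>2 t"
proof -
  define J where "J = J1 \<inter> J2"
  have J: "open J" "connected J" "continuous_on J \<gamma>1" "continuous_on J \<gamma>2"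
    using \<gamma>1 \<gamma>2 unfolding integral_curve_def J_def
    by (auto intro: is_interval_connected is_interval_Int continuous_on_subset)
  define S where "S = {s\<in>J. \<gamma>1 s = \<gamma>2 s}"
  have "open S"
    unfolding open_contains_ball
  proof
    fix s assume s: "s \<in> S"
    obtain V \<phi> where V: "(V,\<phi>) \<in> A" "\<gamma>1 s \<in> V" using chart_exists .
    obtain R Y K M c where R: "R > 0" and fc: "flow_chart E A br H V \<phi> (ball (\<phi> (\<gamma>1 s)) R) Y K M c"
      using flow_chart_exists[OF V H open_UNIV UNIV_I] by metis
    interpret flow_chart E A br H V \<phi> "ball (\<phi> (\<gamma>1 s)) R" Y K M c by (rule fc)
    let ?N = "{q\<in>V. \<phi> q \<in> ball (\<phi> (\<gamma>1 s)) R}"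
    define N' where "N' = (J \<inter> \<gamma>1 -` ?N) \<inter> (J \<inter> \<gamma>2 -` ?N)"
    have "open N'"
      unfolding N'_def using J chart_open_preimage[OF V(1) open_ball] by (intro open_Int continuous_open_preimage)
    moreover have "s \<in> N'" using s V R by (auto simp: S_def N'_def)
    ultimately obtain e where e: "e > 0" "cball s e \<subseteq> N'" using open_contains_cball by blast
    have in_N: "s + \<tau> \<in> J" "\<gamma>1 (s + \<tau>) \<in> ?N" "\<gamma>2 (s + \<tau>) \<in> ?N" if "\<bar>\<tau>\<bar> \<le> e" for \<tau>
      using e(2) that by (auto simp: dist_real_def subset_eq N'_def)
    \<comment> \<open>Time is recentred at \<open>s\<close>, since \<open>ode_zero_unique\<close>
      starts at 0.\<close>
    have "\<phi> (\<gamma>1 (s + \<tau>)) - \<phi> (\<gamma>2 (s + \<tau>)) = 0" if "\<bar>\<tau>\<bar> \<le> e" for \<tau>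
    proof (rule ode_zero_unique[OF _ Y_Lip _ that])
      fix \<tau>' assume \<tau>': "\<bar>\<tau>'\<bar> \<le> e"
      have "((\<lambda>\<tau>. \<phi> (\<gamma> (s + \<tau>))) has_vector_derivative Y (\<phi> (\<gamma> (s + \<tau>')))) (at \<tau>')"
        if "integral_curve A (br H) J' \<gamma>" "J \<subseteq> J'" "\<gamma> (s + \<tau>') \<in> ?N" for J' \<gamma>
      proof -
        have *: "((\<lambda>\<tau>. s + \<tau>) has_vector_derivative 1) (at \<tau>')"
          unfolding has_real_derivative_iff_has_vector_derivative[symmetric] by (auto intro!: derivative_eq_intros)
        show ?thesis
          using vector_diff_chain_at[OF * integral_curve_in_chart[OF that(1)]] that in_N(1)[OF \<tau>'] by (auto simp: o_def)
      qed
      from this[OF \<gamma>1 _ in_N(2)[OF \<tau>']] this[OF \<gamma>2 _ in_N(3)[OF \<tau>']]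
      show "((\<lambda>\<tau>. \<phi> (\<gamma>1 (s + \<tau>)) - \<phi> (\<gamma>2 (s + \<tau>))) has_vector_derivative
         Y (\<phi> (\<gamma>1 (s + \<tau>'))) - Y (\<phi> (\<gamma>2 (s + \<tau>')))) (at \<tau>')"
        by (intro has_vector_derivative_diff) (auto simp: J_def)
    qed (use s in \<open>simp add: S_def\<close>)
    then have "\<gamma>1 (s + \<tau>) = \<gamma>2 (s + \<tau>)" if "\<bar>\<tau>\<bar> \<le> e" for \<tau>
      using that in_N[OF that] chart_inj[OF V(1)] by auto
    then have "s + \<tau> \<in> S" if "\<bar>\<tau>\<bar> \<le> e" for \<tau>
      using that in_N(1)[OF that] by (auto simp: S_def)
    then have "ball s e \<subseteq> S"
      by (metis (no_types, opaque_lifting) add_diff_cancel_left' diff_add_cancel dist_commute dist_real_def less_imp_le mem_ball subsetI add.commute)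
    then show "\<exists>e>0. ball s e \<subseteq> S" using e(1) by blast
  qed
  moreover have "open (J - S)"
    unfolding open_subopen[of "J - S"]
  proof
    fix s assume s: "s \<in> J - S"
    then obtain N1 N2 where N: "open N1" "open N2" "\<gamma>1 s \<in> N1" "\<gamma>2 s \<in> N2" "N1 \<inter> N2 = {}"
      using hausdorff[of "\<gamma>1 s" "\<gamma>2 s"] by (auto simp: S_def)
    then have "open ((J \<inter> \<gamma>1 -` N1) \<inter> (J \<inter> \<gamma>2 -` N2))"
      using J by (intro open_Int continuous_open_preimage)
    moreover have "(J \<inter> \<gamma>1 -` N1) \<inter> (J \<inter> \<gamma>2 -` N2) \<subseteq> J - S" using N(5) by (auto simp: S_def)
    ultimately show "\<exists>T. open T \<and> s \<in> T \<and> T \<subseteq> J - S" using s N by blast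
  qed
  ultimately have "S \<inter> J = {} \<or> (J - S) \<inter> J = {}"
    by (intro connectedD[OF J(2)]) auto
  then show ?thesis using s0 t by (auto simp: S_def J_def)
qed

lemma flow_eq:
  assumes H: "H \<in> Cinf A UNIV" and \<gamma>: "integral_curve A (br H) J \<gamma>" "0 \<in> J" "t \<in> J"
  shows "flow_defined A (br H) t (\<gamma> 0)" "flow A (br H) t (\<gamma> 0) = \<gamma> t"
proof -
  show "flow_defined A (br H) t (\<gamma> 0)" using \<gamma> by (auto simp: flow_defined_def)
  show "flow A (br H) t (\<gamma> 0) = \<gamma> t"
    unfolding flow_def
  proof (rule the_equality)
    fix y assume "\<exists>J' \<gamma>'. integral_curve A (br H) J' \<gamma>' \<and> 0 \<in> J' \<and> t \<in> J' \<and> \<gamma>' 0 = \<gamma> 0 \<and> \<gamma>' t = y"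
    then obtain J' \<gamma>' where *: "integral_curve A (br H) J' \<gamma>'" "0 \<in> J'" "t \<in> J'" "\<gamma>' 0 = \<gamma> 0" "\<gamma>' t = y" by blast
    have "\<gamma>' t = \<gamma> t" by (rule integral_curve_unique[OF H *(1) \<gamma>(1), of 0]) (use * \<gamma> in auto)
    then show "y = \<gamma> t" using * by simp
  qed (use \<gamma> in blast)
qed

end

section \<open>Local flows\<close>

locale local_flow = flow_chart E A br H V \<phi> "ball (\<phi> q0) R" Y K M c
  for E :: "'e::euclidean_space set"
    and A :: "('p::{t2_space,second_countable_topology} set \<times> ('p \<Rightarrow> 'e)) set"
    and br :: "'p bracket" and H V \<phi> q0 R Y K M c +
  fixes \<Phi> :: "real \<Rightarrow> 'e \<Rightarrow> 'e"
  assumes H: "H \<in> Cinf A UNIV" and q0: "q0 \<in> V" and R: "R > 0"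
    and \<Phi>_Ck: "\<And>k. Ck_on k UNIV (\<lambda>(t,z). \<Phi> t z)" and \<Phi>_0: "\<And>z. \<Phi> 0 z = z"
    and \<Phi>_deriv: "\<And>t z. ((\<lambda>t. \<Phi> t z) has_vector_derivative Y (\<Phi> t z)) (at t)"
begin

text \<open>The part of the solution that \<open>\<pi>\<close> removes has derivative
  \<open>Y - \<pi> Y = 0\<close> along the curve, and it vanishes at time 0.\<close>

lemma \<Phi>_in_E: "z \<in> E \<Longrightarrow> \<Phi> t z \<in> E"
proof -
  assume z: "z \<in> E"
  obtain \<pi> :: "'e \<Rightarrow> 'e" where \<pi>: "bounded_linear \<pi>" "\<And>x. \<pi> x \<in> E" "\<And>x. x \<in> E \<Longrightarrow> \<pi> x = x"
    using projection_exists by metis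
  have "((\<lambda>t. \<Phi> t z - \<pi> (\<Phi> t z)) has_vector_derivative 0) (at t)" for t
    using has_vector_derivative_diff[OF \<Phi>_deriv[where z = z and t = t]
        bounded_linear.has_vector_derivative[OF \<pi>(1) \<Phi>_deriv[where z = z and t = t]]]
      \<pi>(3)[OF Y_E] by simp
  from zero_derivative_eq[OF this, of t 0] have "\<Phi> t z = \<pi> (\<Phi> t z)" by (simp add: \<Phi>_0 \<pi>(3) z)
  then show ?thesis using \<pi>(2) by metis
qed

lemma \<Phi>_add: "\<Phi> s (\<Phi> t z) = \<Phi> (s + t) z"
proof -
  have "\<Phi> s (\<Phi> t z) - \<Phi> (s + t) z = 0"
  proof (rule ode_zero_unique[where d = "\<lambda>s. \<Phi> s (\<Phi> t z) - \<Phi> (s + t) z" and r = "\<bar>s\<bar>"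
        and d' = "\<lambda>s. Y (\<Phi> s (\<Phi> t z)) - Y (\<Phi> (s + t) z)" and t = s])
    fix s
    have "((\<lambda>s. s + t) has_vector_derivative 1) (at s)"
      unfolding has_real_derivative_iff_has_vector_derivative[symmetric] by (auto intro!: derivative_eq_intros)
    from vector_diff_chain_at[OF this \<Phi>_deriv[where z = z]]
    have "((\<lambda>s. \<Phi> (s + t) z) has_vector_derivative Y (\<Phi> (s + t) z)) (at s)" by (simp add: o_def)
    then show "((\<lambda>s. \<Phi> s (\<Phi> t z) - \<Phi> (s + t) z) has_vector_derivative Y (\<Phi> s (\<Phi> t z)) - Y (\<Phi> (s + t) z)) (at s)"
      by (rule has_vector_derivative_diff[OF \<Phi>_deriv])
  qed (auto simp: \<Phi>_0 intro: Y_Lip)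
  then show ?thesis by simp
qed

lemma M_nonneg: "M \<ge> 0" using norm_ge_zero Y_bound order_trans by blast

lemma \<Phi>_displacement: "norm (\<Phi> t z - z) \<le> M * \<bar>t\<bar>"
proof -
  \<comment> \<open>The case \<open>n = 0\<close>, with \<open>K = 1\<close>, of the integration
    step.\<close>
  have "norm (\<Phi> t z - z) \<le> M * (1 * \<bar>t\<bar>) ^ Suc 0 / fact (Suc 0)"
  proof (rule power_bound_step[where f' = "\<lambda>t. Y (\<Phi> t z)" and r = "\<bar>t\<bar>"])
    show "((\<lambda>t. \<Phi> t z - z) has_vector_derivative Y (\<Phi> s z)) (at s)" for s
      using \<Phi>_deriv by (simp add: has_vector_derivative_diff_const)
  qed (use M_nonneg Y_bound \<Phi>_0 in auto)
  then show ?thesis by simp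
qed

lemma \<Phi>_Ck_space: "Ck_on k UNIV (\<Phi> t)"
  using Ck_on_compose[OF open_UNIV open_UNIV \<Phi>_Ck[of k] Ck_on_Pair[OF open_UNIV Ck_on_const Ck_on_ident], of t]
  by simp

text \<open>Within this time the speed limit \<open>M\<close> allows a displacement of less than a
  quarter of \<open>R\<close>; the summand 1 covers \<open>M = 0\<close>.\<close>

definition \<epsilon> :: real where "\<epsilon> = R / 4 / (M + 1)"

text \<open>\<open>k\<close> counts quarters of \<open>R\<close>, and flowing for a time below
  \<open>\<epsilon>\<close> costs one of them. The final neighbourhood is \<open>nbhd 1\<close>;
  pullback is proved on \<open>nbhd 2\<close>, which contains its images; images of
  \<open>nbhd 2\<close> lie in \<open>nbhd 3\<close>, still inside the ball of radius
  \<open>R\<close>.\<close>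

definition nbhd :: "real \<Rightarrow> 'p set" where "nbhd k = {q\<in>V. \<phi> q \<in> ball (\<phi> q0) (k * (R / 4))}"

lemma \<epsilon>_pos: "\<epsilon> > 0" using R M_nonneg by (simp add: \<epsilon>_def)

lemma nbhd_open: "open (nbhd k)"
  unfolding nbhd_def by (rule chart_open_preimage[OF chart open_ball])

lemma \<Phi>_small:
  assumes "\<bar>t\<bar> < \<epsilon>"
  shows "norm (\<Phi> t z - z) < R / 4"
proof -
  have "norm (\<Phi> t z - z) \<le> (M + 1) * \<bar>t\<bar>" using \<Phi>_displacement[of t z] by (simp add: algebra_simps)
  also have "\<dots> < (M + 1) * \<epsilon>" using assms M_nonneg by (intro mult_strict_left_mono) auto
  also have "\<dots> = \<epsilon> * (M + 1)" by (rule mult.commute)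
  also have "M + 1 \<noteq> 0" using M_nonneg by linarith
  then have "\<epsilon> * (M + 1) = R / 4" by (rule nonzero_eq_divide_eq[THEN iffD1, OF _ \<epsilon>_def])
  finally show ?thesis .
qed

lemma \<Phi>_ball:
  assumes "\<bar>t\<bar> < \<epsilon>" "z \<in> ball (\<phi> q0) (k * (R / 4))"
  shows "\<Phi> t z \<in> ball (\<phi> q0) ((k + 1) * (R / 4))"
proof -
  have "dist (\<phi> q0) (\<Phi> t z) \<le> dist (\<phi> q0) z + norm (\<Phi> t z - z)"
    using dist_triangle[of "\<phi> q0" "\<Phi> t z" z] by (simp add: dist_norm norm_minus_commute)
  then show ?thesis using \<Phi>_small[OF assms(1), of z] assms(2) by (auto simp: algebra_simps add_divide_distrib)
qed

definition curve :: "'p \<Rightarrow> real \<Rightarrow> 'p" where "curve q s = inv_into V \<phi> (\<Phi> s (\<phi> q))"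

lemma flow_local:
  assumes "q \<in> nbhd 2"
  shows "integral_curve A (br H) {-\<epsilon><..<\<epsilon>} (curve q)"
    and "\<bar>t\<bar> < \<epsilon> \<Longrightarrow> flow_defined A (br H) t q"
    and "\<bar>t\<bar> < \<epsilon> \<Longrightarrow> flow A (br H) t q = curve q t"
    and "\<bar>t\<bar> < \<epsilon> \<Longrightarrow> flow A (br H) t q \<in> V"
    and "\<bar>t\<bar> < \<epsilon> \<Longrightarrow> \<phi> (flow A (br H) t q) = \<Phi> t (\<phi> q)"
proof -
  have q: "q \<in> V" "\<phi> q \<in> ball (\<phi> q0) (2 * (R / 4))" using assms by (auto simp: nbhd_def)
  have in_B: "\<Phi> s (\<phi> q) \<in> E \<inter> ball (\<phi> q0) R" if "s \<in> {-\<epsilon><..<\<epsilon>}" for s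
    using \<Phi>_ball[OF _ q(2), of s] that \<Phi>_in_E[OF chart_in_E[OF chart q(1)]] R by (auto simp: abs_less_iff)
  show ic: "integral_curve A (br H) {-\<epsilon><..<\<epsilon>} (curve q)"
    unfolding curve_def by (rule integral_curve_from_chart[OF _ _ in_B \<Phi>_deriv]) auto
  have \<gamma>0: "curve q 0 = q" using chart_inv[OF chart q(1)] by (simp add: \<Phi>_0 curve_def)
  assume "\<bar>t\<bar> < \<epsilon>"
  then have t: "0 \<in> {-\<epsilon><..<\<epsilon>}" "t \<in> {-\<epsilon><..<\<epsilon>}" using \<epsilon>_pos by (auto simp: abs_less_iff)
  note fl = flow_eq[OF H ic t, unfolded \<gamma>0]
  show "flow_defined A (br H) t q" "flow A (br H) t q = curve q t" by (rule fl)+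
  have "\<Phi> t (\<phi> q) \<in> \<phi> ` V" using in_B[OF t(2)] B by blast
  then show "flow A (br H) t q \<in> V" "\<phi> (flow A (br H) t q) = \<Phi> t (\<phi> q)"
    by (simp_all add: fl curve_def inv_into_into f_inv_into_f)
qed

lemma flow_nbhd:
  assumes "q \<in> nbhd k" "k \<le> 2" "\<bar>t\<bar> < \<epsilon>"
  shows "flow A (br H) t q \<in> nbhd (k + 1)"
proof -
  have "k * (R / 4) \<le> 2 * (R / 4)" using assms R by (intro mult_right_mono) auto
  then have "q \<in> nbhd 2" using assms(1) by (auto simp: nbhd_def mult.commute)
  then show ?thesis
    using flow_local(4,5)[of q t] assms(3) \<Phi>_ball[OF assms(3), of "\<phi> q" k] assms(1) by (auto simp: nbhd_def)
qed

lemma flow_inverse: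
  assumes "q \<in> nbhd 1" "\<bar>t\<bar> < \<epsilon>"
  shows "flow A (br H) (- t) (flow A (br H) t q) = q"
proof -
  have 1: "flow A (br H) t q \<in> nbhd 2" using flow_nbhd[OF assms(1) _ assms(2)] by simp
  have 2: "q \<in> nbhd 2" using assms(1) R by (auto simp: nbhd_def)
  have "\<phi> (flow A (br H) (- t) (flow A (br H) t q)) = \<phi> q"
    using flow_local(5)[OF 1, of "- t"] flow_local(5)[OF 2 assms(2)] assms(2) \<Phi>_add[of "- t" t] by (simp add: \<Phi>_0)
  then show ?thesis
    using chart_inj[OF chart flow_local(4)[OF 1, of "- t"]] assms by (auto simp: nbhd_def)
qed

text \<open>In coordinates the image under time \<open>t\<close> is a preimage under
  \<open>\<Phi> (- t)\<close>, so continuity is enough. Invariance of \<open>E\<close> ensures that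
  preimage points come from \<open>U\<close>.\<close>

lemma flow_open:
  assumes "open U" "U \<subseteq> nbhd 2" "\<bar>t\<bar> < \<epsilon>"
  shows "open (flow A (br H) t ` U)"
proof -
  have UV: "U \<subseteq> V" using assms(2) by (auto simp: nbhd_def)
  obtain W where W: "open W" "\<phi> ` (U \<inter> V) = E \<inter> W" using chart_open_image[OF chart assms(1)] .
  have oW: "open (\<Phi> (- t) -` W)" by (rule open_vimage[OF W(1) Ck_on_continuous_on[OF \<Phi>_Ck_space]])
  have "flow A (br H) t ` U = {q\<in>V. \<phi> q \<in> \<Phi> (- t) -` W}"
  proof (intro equalityI subsetI)
    fix y assume "y \<in> flow A (br H) t ` U"
    then obtain q where q: "q \<in> U" "y = flow A (br H) t q" by blast
    then have "\<Phi> (- t) (\<phi> y) = \<phi> q"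
      using flow_local(5)[of q t] assms \<Phi>_add[of "- t" t] by (auto simp: \<Phi>_0)
    moreover have "\<phi> q \<in> W" using W q UV by auto
    ultimately show "y \<in> {q\<in>V. \<phi> q \<in> \<Phi> (- t) -` W}"
      using flow_local(4)[of q t] q assms by auto
  next
    fix y assume y: "y \<in> {q\<in>V. \<phi> q \<in> \<Phi> (- t) -` W}"
    then have "\<Phi> (- t) (\<phi> y) \<in> E \<inter> W" using \<Phi>_in_E chart_in_E[OF chart] by auto
    then obtain q where q: "q \<in> U" "\<Phi> (- t) (\<phi> y) = \<phi> q" using W(2) by auto
    then have "\<phi> (flow A (br H) t q) = \<phi> y"
      using flow_local(5)[of q t] assms \<Phi>_add[of t "- t"] by (metis (no_types) \<Phi>_0 add.right_inverse subsetD)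
    then have "y = flow A (br H) t q"
      using chart_inj[OF chart] flow_local(4)[of q t] q(1) y assms by auto
    then show "y \<in> flow A (br H) t ` U" using q by blast
  qed
  then show ?thesis using chart_open_preimage[OF chart oW] by simp
qed

lemma flow_smooth_at:
  assumes "smooth_at A f (flow A (br H) t q)" "q \<in> nbhd 2" "\<bar>t\<bar> < \<epsilon>"
  shows "smooth_at A (\<lambda>q. f (flow A (br H) t q)) q"
proof (rule chart_transport_smooth_at[where T = "flow A (br H) t" and \<Psi> = "\<Phi> t", OF assms(1) chart])
  show "q' \<in> V \<and> flow A (br H) t q' \<in> V \<and> \<phi> (flow A (br H) t q') = \<Phi> t (\<phi> q')" if "q' \<in> nbhd 2" for q'
    using flow_local(4,5)[OF that assms(3)] that by (auto simp: nbhd_def)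
  show "q \<in> V" using assms(2) by (simp add: nbhd_def)
qed (fact nbhd_open assms(2) \<Phi>_Ck_space flow_local(4)[OF assms(2,3)])+

end

section \<open>Flows preserving a finitely generated ideal\<close>

text \<open>The number \<open>N\<close> of generators is not bounded by any type. Vectors of length \<open>N\<close> are therefore
  encoded in one Banach space, that of bounded continuous functions on the line, by their values
  at the natural numbers; hat functions play the role of the unit vectors.\<close>

instance bcontfun :: (metric_space, banach) banach ..

definition unit_seq :: "nat \<Rightarrow> real \<Rightarrow>\<^sub>C real" where
  "unit_seq i = Bcontfun (\<lambda>x. max 0 (1 - \<bar>x - real i\<bar>))"

definition seq_nth :: "(real \<Rightarrow>\<^sub>C real) \<Rightarrow> nat \<Rightarrow> real" where
  "seq_nth f k = apply_bcontfun f (real k)"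

lemma seq_nth_unit_seq: "seq_nth (unit_seq i) k = (if k = i then 1 else 0)"
proof -
  have "(\<lambda>x. max 0 (1 - \<bar>x - real i\<bar>)) \<in> bcontfun"
    by (rule bcontfun_normI[of _ 1]) (auto intro!: continuous_intros)
  moreover have "\<bar>real k - real i\<bar> \<ge> 1" if "k \<noteq> i" using that by linarith
  ultimately show ?thesis by (simp add: seq_nth_def unit_seq_def Bcontfun_inverse)
qed

lemma bounded_linear_seq_nth: "bounded_linear (\<lambda>f. seq_nth f k)"
  unfolding seq_nth_def
  by (rule bounded_linear_intro[of _ 1])
     (simp_all add: plus_bcontfun.rep_eq scaleR_bcontfun.rep_eq norm_bounded del: real_norm_def)

text \<open>A combination of constant rank one operators, so that smoothness of the matrix reduces
  to smoothness of its scalar entries.\<close>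

definition seq_matrix :: "nat \<Rightarrow> (nat \<Rightarrow> nat \<Rightarrow> real) \<Rightarrow> (real \<Rightarrow>\<^sub>C real) \<Rightarrow>\<^sub>L (real \<Rightarrow>\<^sub>C real)" where
  "seq_matrix N a = (\<Sum>i<N. \<Sum>j<N. a i j *\<^sub>R Blinfun (\<lambda>y. seq_nth y j *\<^sub>R unit_seq i))"

lemma seq_matrix_apply:
  "blinfun_apply (seq_matrix N a) y = (\<Sum>i<N. (\<Sum>j<N. a i j * seq_nth y j) *\<^sub>R unit_seq i)"
proof -
  have "blinfun_apply (Blinfun (\<lambda>y. seq_nth y j *\<^sub>R unit_seq i)) y = seq_nth y j *\<^sub>R unit_seq i" for i j
    by (intro bounded_linear_Blinfun_apply[THEN fun_cong] bounded_linear_scaleR_const bounded_linear_seq_nth)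
  then show ?thesis
    by (simp add: seq_matrix_def blinfun.sum_left blinfun.scaleR_left scaleR_sum_left)
qed

lemma seq_nth_sum:
  "seq_nth (\<Sum>i\<in>S. f i) k = (\<Sum>i\<in>S. seq_nth (f i) k)"
  using linear_sum[OF bounded_linear.linear[OF bounded_linear_seq_nth]] .

lemma seq_nth_combination:
  "seq_nth (\<Sum>i<N. x i *\<^sub>R unit_seq i) k = (if k < N then x k else 0)"
  using linear_scale[OF bounded_linear.linear[OF bounded_linear_seq_nth]]
  by (simp add: seq_nth_sum seq_nth_unit_seq if_distrib cong: if_cong)

context manifold
begin

text \<open>Structure functions live on chart points only, but the linear equation needs
  coefficients that are smooth on the whole ambient space. Agreement on a smaller closed ball is the
  price.\<close>

lemma chart_function_extension:
  assumes V: "(V,\<phi>) \<in> A" and sub: "E \<inter> ball z0 R \<subseteq> \<phi> ` V"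
    and f: "\<And>q. q \<in> V \<Longrightarrow> \<phi> q \<in> ball z0 R \<Longrightarrow> smooth_at A f q" and r: "0 < r" "r < R"
  shows "\<exists>\<alpha>. (\<forall>k. Ck_on k UNIV \<alpha>) \<and> (\<forall>q\<in>V. \<phi> q \<in> cball z0 r \<longrightarrow> f q = \<alpha> (\<phi> q))"
proof -
  obtain \<pi> :: "'e \<Rightarrow> 'e" where \<pi>: "bounded_linear \<pi>" "\<And>x. \<pi> x \<in> E" "\<And>x. x \<in> E \<Longrightarrow> \<pi> x = x"
    using projection_exists by metis
  have c\<pi>: "continuous_on UNIV \<pi>" by (rule linear_continuous_on[OF \<pi>(1)])
  obtain r' where r': "r < r'" "r' < R" using dense[OF r(2)] by blast
  obtain \<beta> :: "'e \<Rightarrow> real" where \<beta>: "\<And>k. Ck_on k UNIV \<beta>"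
    "\<And>z. z \<in> cball z0 r \<Longrightarrow> \<beta> z = 1" "\<And>z. z \<notin> ball z0 r' \<Longrightarrow> \<beta> z = 0"
    using smooth_bump[OF r(1) r'(1), of z0] by metis
  define W where "W = \<pi> -` ball z0 R"
  have W: "open W" unfolding W_def by (rule open_vimage[OF open_ball c\<pi>])
  define h where "h z = f (inv_into V \<phi> (\<pi> z))" for z
  have Ck_h: "Ck_on k W h" for k
  proof (rule Ck_on_local)
    fix z assume "z \<in> W"
    define p where "p = inv_into V \<phi> (\<pi> z)"
    have "\<pi> z \<in> \<phi> ` V" using \<open>z \<in> W\<close> sub \<pi>(2) by (auto simp: W_def)
    then have p: "p \<in> V" "\<phi> p = \<pi> z" by (simp_all add: p_def inv_into_into f_inv_into_f)
    then have "smooth_at A f p" using f \<open>z \<in> W\<close> by (simp add: W_def)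
    then obtain W1 g where g: "chart_rep V \<phi> f p W1 g" using smooth_at_chart[OF _ V p(1)] by metis
    define W2 where "W2 = W \<inter> \<pi> -` W1"
    have W2: "open W2" "z \<in> W2"
      unfolding W2_def using W g p \<open>z \<in> W\<close> c\<pi> by (auto simp: chart_rep_def intro!: open_vimage)
    have "Ck_on k W2 (\<lambda>z. g (\<pi> z))"
    proof (rule Ck_on_compose[OF W2(1) _ _ Ck_on_bounded_linear_id[OF W2(1) \<pi>(1)]])
      show "open W1" "Ck_on k W1 g" using g by (auto simp: chart_rep_def)
    qed (auto simp: W2_def)
    then have "Ck_on k W2 h"
    proof (rule Ck_on_cong[OF W2(1), rotated])
      fix y assume y: "y \<in> W2"
      then have "\<pi> y \<in> \<phi> ` V" using sub \<pi>(2) by (auto simp: W_def W2_def)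
      then show "g (\<pi> y) = h y"
        using g y unfolding chart_rep_def h_def W2_def by (auto simp: inv_into_into f_inv_into_f)
    qed
    then show "\<exists>W. open W \<and> z \<in> W \<and> Ck_on k W h" using W2 by blast
  qed
  \<comment> \<open>The cutoff is evaluated at \<open>\<pi> z\<close>: the projection may increase
    distances, so a bound on \<open>z\<close> itself would not place \<open>\<pi> z\<close> in the
    ball where \<open>h\<close> is controlled.\<close>
  have "Ck_on k UNIV (\<lambda>z. \<beta> (\<pi> z) *\<^sub>R h z)" for k
  proof (rule Ck_on_cutoff[OF W _ _ Ck_h])
    show "closed (\<pi> -` cball z0 r')" by (rule closed_vimage[OF closed_cball c\<pi>])
    show "\<pi> -` cball z0 r' \<subseteq> W" using r' by (auto simp: W_def)
    show "Ck_on k UNIV (\<lambda>z. \<beta> (\<pi> z))"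
      by (rule Ck_on_compose[OF open_UNIV open_UNIV \<beta>(1) Ck_on_bounded_linear_id[OF open_UNIV \<pi>(1)]]) simp
    show "\<beta> (\<pi> z) = 0" if "z \<notin> \<pi> -` cball z0 r'" for z using that by (intro \<beta>(3)) auto
  qed
  moreover have "f q = \<beta> (\<pi> (\<phi> q)) *\<^sub>R h (\<phi> q)" if "q \<in> V" "\<phi> q \<in> cball z0 r" for q
    using that chart_in_E[OF V] chart_inv[OF V] by (simp add: \<pi>(3) h_def \<beta>(2))
  ultimately show ?thesis by blast
qed

end

locale ideal_flow = local_flow E A br H V \<phi> q0 R Y K M c \<Phi>
  for E :: "'e::euclidean_space set"
    and A :: "('p::{t2_space,second_countable_topology} set \<times> ('p \<Rightarrow> 'e)) set"
    and br :: "'p bracket" and H V \<phi> q0 R Y K M c \<Phi> +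
  fixes I :: "'p fun_sheaf" and U0 :: "'p set" and N :: nat and g :: "nat \<Rightarrow> 'p \<Rightarrow> real"
  assumes U0: "open U0" "E \<inter> ball (\<phi> q0) R \<subseteq> \<phi> ` (U0 \<inter> V)"
    and g: "\<And>i. i < N \<Longrightarrow> g i \<in> Cinf A U0"
    and span: "\<And>W. open W \<Longrightarrow> W \<subseteq> U0 \<Longrightarrow> I W = Cinf_span A W N (\<lambda>i. restrict (g i) W)"
    and normalizer: "\<And>f. f \<in> I U0 \<Longrightarrow> local_bracket A br U0 (restrict H U0) f \<in> I U0"
begin

lemma nbhd_U0: "nbhd 3 \<subseteq> U0"
proof
  fix q assume q: "q \<in> nbhd 3"
  then have "\<phi> q \<in> E \<inter> ball (\<phi> q0) R" using chart_in_E[OF chart] R by (auto simp: nbhd_def)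
  then have "\<phi> q \<in> \<phi> ` (U0 \<inter> V)" using U0(2) by blast
  then show "q \<in> U0" using q chart_inj[OF chart] by (auto simp: nbhd_def)
qed

lemma generator_in_ideal: "i < N \<Longrightarrow> g i \<in> I U0"
proof -
  assume i: "i < N"
  define b where "b k = restrict (\<lambda>q. if k = i then 1 else 0 :: real) U0" for k
  have "b k \<in> Cinf A U0" for k
    using U0(1) unfolding b_def by (auto simp: Cinf_iff intro!: smooth_at_restrict smooth_at_const)
  moreover have "g i = (\<lambda>x\<in>U0. \<Sum>k<N. b k x * restrict (g k) U0 x)"
  proof
    fix x
    show "g i x = (\<lambda>x\<in>U0. \<Sum>k<N. b k x * restrict (g k) U0 x) x"
      using g[OF i] i by (cases "x \<in> U0") (auto simp: b_def Cinf_def extensional_def if_distrib[of "\<lambda>y. y * _"] cong: if_cong)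
  qed
  ultimately show ?thesis unfolding span[OF U0(1) subset_refl] Cinf_span_def by blast
qed

text \<open>This is where \<open>H\<close> normalizing the sheaf enters: the bracket of
  \<open>H\<close> with a generator is again in the ideal, hence in the span of the
  generators.\<close>

lemma structure_functions:
  obtains a where "\<And>i j. i < N \<Longrightarrow> j < N \<Longrightarrow> a i j \<in> Cinf A U0"
    "\<And>i x. i < N \<Longrightarrow> x \<in> U0 \<Longrightarrow> local_bracket A br U0 (restrict H U0) (g i) x = (\<Sum>j<N. a i j x * g j x)"
proof -
  have "\<exists>b. (\<forall>j<N. b j \<in> Cinf A U0) \<and>
      (\<forall>x\<in>U0. local_bracket A br U0 (restrict H U0) (g i) x = (\<Sum>j<N. b j x * g j x))" if "i < N" for i
  proof -
    have "local_bracket A br U0 (restrict H U0) (g i) \<in> Cinf_span A U0 N (\<lambda>i. restrict (g i) U0)"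
      using normalizer[OF generator_in_ideal[OF that]] span[OF U0(1) subset_refl] by blast
    then show ?thesis by (auto simp: Cinf_span_def)
  qed
  then show ?thesis using that by metis
qed

text \<open>The equation of an integral curve speaks of global functions; near the point a generator
  agrees with one, whose bracket with \<open>H\<close> is the local bracket there.\<close>

lemma generator_derivative:
  assumes q: "q \<in> nbhd 2" and s: "\<bar>s\<bar> < \<epsilon>" and i: "i < N"
  shows "((\<lambda>s. g i (curve q s)) has_vector_derivative
    local_bracket A br U0 (restrict H U0) (g i) (curve q s)) (at s)"
proof -
  let ?J = "{-\<epsilon><..<\<epsilon>}"
  note ic = flow_local(1)[OF q]
  have x: "curve q s \<in> U0"
    using flow_nbhd[OF q _ s] flow_local(3)[OF q s] nbhd_U0 by auto
  obtain G U' where G: "G \<in> Cinf A UNIV" "open U'" "curve q s \<in> U'" "U' \<subseteq> U0" "\<And>x. x \<in> U' \<Longrightarrow> G x = g i x"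
    using smooth_extension[OF U0(1) x, of "g i"] g[OF i] by (auto simp: Cinf_iff[OF U0(1)])
  have "local_bracket A br U0 (restrict H U0) (g i) (curve q s) = br H G (curve q s)"
    using G x U0(1) by (intro local_bracket_eq[OF H _ G(1)]) (auto simp: eventually_nhds)
  moreover have "((\<lambda>s. g i (curve q s)) has_vector_derivative br H G (curve q s)) (at s)"
  proof (rule has_vector_derivative_transform_within_open)
    show "((\<lambda>s. G (curve q s)) has_vector_derivative br H G (curve q s)) (at s)"
      using ic s G(1) by (auto simp: integral_curve_def abs_less_iff has_real_derivative_iff_has_vector_derivative)
    show "open (?J \<inter> curve q -` U')"
      using ic G(2) by (intro continuous_open_preimage) (auto simp: integral_curve_def)
  qed (use s G in \<open>auto simp: abs_less_iff\<close>)
  ultimately show ?thesis by simp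
qed

text \<open>\<open>m t i j\<close> is the \<open>i\<close>-th entry of the solution
  \<open>w j\<close> that starts at the \<open>j\<close>-th unit vector. Along the orbit of
  \<open>q\<close> the generators and the combination of the \<open>w j\<close> with the constant
  coefficients \<open>g j q\<close> solve the same linear equation with the same initial
  value.\<close>

lemma flow_generators:
  obtains m :: "real \<Rightarrow> nat \<Rightarrow> nat \<Rightarrow> 'p \<Rightarrow> real"
  where "\<And>t i j q. q \<in> V \<Longrightarrow> smooth_at A (m t i j) q"
    "\<And>t i q. \<bar>t\<bar> < \<epsilon> \<Longrightarrow> q \<in> nbhd 2 \<Longrightarrow> i < N \<Longrightarrow>
      g i (flow A (br H) t q) = (\<Sum>j<N. m t i j q * g j q)"
proof -
  obtain a where a: "\<And>i j. i < N \<Longrightarrow> j < N \<Longrightarrow> a i j \<in> Cinf A U0"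
    "\<And>i x. i < N \<Longrightarrow> x \<in> U0 \<Longrightarrow> local_bracket A br U0 (restrict H U0) (g i) x = (\<Sum>j<N. a i j x * g j x)"
    using structure_functions by blast
  \<comment> \<open>Indices beyond \<open>N\<close> receive an arbitrary constant, so that
    \<open>\<alpha>\<close> can be chosen for all \<open>i\<close> and \<open>j\<close> at
    once.\<close>
  have "\<exists>\<alpha>. (\<forall>k. Ck_on k UNIV \<alpha>) \<and> (i < N \<and> j < N \<longrightarrow> (\<forall>q\<in>V. \<phi> q \<in> cball (\<phi> q0) (3 * (R / 4)) \<longrightarrow> a i j q = \<alpha> (\<phi> q)))" for i j
  proof (cases "i < N \<and> j < N")
    case True
    have "smooth_at A (a i j) q" if "q \<in> V" "\<phi> q \<in> ball (\<phi> q0) R" for q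
    proof -
      have "\<phi> q \<in> \<phi> ` (U0 \<inter> V)" using U0(2) that chart_in_E[OF chart] by auto
      then have "q \<in> U0" using that chart_inj[OF chart] by auto
      then show ?thesis using a(1)[of i j] True U0(1) by (auto simp: Cinf_iff)
    qed
    moreover have "0 < 3 * (R / 4)" "3 * (R / 4) < R" using R by auto
    ultimately show ?thesis
      using chart_function_extension[OF chart B(2)] by metis
  next
    case False
    then show ?thesis using Ck_on_const[OF open_UNIV] by blast
  qed
  then obtain \<alpha> where \<alpha>: "\<And>i j k. Ck_on k UNIV (\<alpha> i j)"
    "\<And>i j q. i < N \<Longrightarrow> j < N \<Longrightarrow> q \<in> V \<Longrightarrow> \<phi> q \<in> cball (\<phi> q0) (3 * (R / 4)) \<Longrightarrow> a i j q = \<alpha> i j (\<phi> q)"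
    by metis
  define L where "L z = seq_matrix N (\<lambda>i j. \<alpha> i j (\<Phi> (fst z) (snd z)))" for z
  have Ck_\<Phi>: "Ck_on k UNIV (\<lambda>z. \<Phi> (fst z) (snd z))" for k using \<Phi>_Ck[of k] by (simp add: split_beta')
  have Ck_L: "Ck_on k UNIV L" for k
  proof -
    have "Ck_on k UNIV (\<lambda>z. \<alpha> i j (\<Phi> (fst z) (snd z)))" for i j
      by (rule Ck_on_compose[OF open_UNIV open_UNIV \<alpha>(1) Ck_\<Phi>]) simp
    then show ?thesis
      unfolding L_def seq_matrix_def by (intro Ck_on_sum Ck_on_scaleR Ck_on_const open_UNIV)
  qed
  have cL: "continuous_on UNIV (\<lambda>(t,z). L (t,z))" using Ck_on_continuous_on[OF Ck_L] by (simp add: split_beta')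
  have "\<exists>w. (\<forall>z. w 0 z = unit_seq j) \<and> (\<forall>t z. ((\<lambda>t. w t z) has_vector_derivative L (t,z) (w t z)) (at t))" for j
  proof (rule linear_ode_exists[where a = "\<lambda>t z. L (t,z)" and b = "\<lambda>_ _. 0" and c = "unit_seq j", OF cL])
  qed (auto intro: continuous_intros)
  then obtain w where w: "\<And>j z. w j 0 z = unit_seq j"
    "\<And>j t z. ((\<lambda>t. w j t z) has_vector_derivative L (t,z) (w j t z)) (at t)" by metis
  have Ck_w: "Ck_on k UNIV (\<lambda>z. seq_nth (w j t z) i)" for k j t i
  proof -
    have "Ck_on k UNIV (\<lambda>(t,z). w j t z)"
      by (rule linear_ode_Ck[OF Ck_L Ck_on_const[of _ _ 0]]) (use w in auto)
    from Ck_on_compose[OF open_UNIV open_UNIV this Ck_on_Pair[OF open_UNIV Ck_on_const Ck_on_ident], of t]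
    have "Ck_on k UNIV (w j t)" by simp
    then show ?thesis by (rule Ck_on_bounded_linear[OF open_UNIV bounded_linear_seq_nth])
  qed
  show ?thesis
  proof (rule that[of "\<lambda>t i j q. seq_nth (w j t (\<phi> q)) i"])
    show "smooth_at A (\<lambda>q. seq_nth (w j t (\<phi> q)) i) q" if "q \<in> V" for t i j q
      by (rule smooth_at_chart_comp[OF chart that open_UNIV UNIV_I Ck_w])
    fix t i q assume t: "\<bar>t\<bar> < \<epsilon>" and q: "q \<in> nbhd 2" and i: "i < N"
    define D where "D i s = g i (curve q s) - (\<Sum>j<N. g j q * seq_nth (w j s (\<phi> q)) i)" for i s
    \<comment> \<open>The errors \<open>D i s\<close> packed into one vector, so that the coupled
      system becomes a single linear equation.\<close>
    define d where "d s = (\<Sum>i<N. D i s *\<^sub>R unit_seq i)" for s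
    have D_deriv: "(D i has_vector_derivative (\<Sum>k<N. \<alpha> i k (\<Phi> s (\<phi> q)) * D k s)) (at s)"
      if s: "\<bar>s\<bar> < \<epsilon>" and i: "i < N" for s i
    proof -
      have x: "curve q s \<in> nbhd 3" and \<phi>x: "\<phi> (curve q s) = \<Phi> s (\<phi> q)"
        using flow_nbhd[OF q _ s] flow_local(3,5)[OF q s] by auto
      have "a i k (curve q s) = \<alpha> i k (\<Phi> s (\<phi> q))" if "k < N" for k
        using \<alpha>(2)[OF i that, of "curve q s"] x \<phi>x by (auto simp: nbhd_def)
      then have "local_bracket A br U0 (restrict H U0) (g i) (curve q s) = (\<Sum>k<N. \<alpha> i k (\<Phi> s (\<phi> q)) * g k (curve q s))"
        using a(2)[OF i, of "curve q s"] x nbhd_U0 by auto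
      then have 1: "((\<lambda>s. g i (curve q s)) has_vector_derivative (\<Sum>k<N. \<alpha> i k (\<Phi> s (\<phi> q)) * g k (curve q s))) (at s)"
        using generator_derivative[OF q s i] by simp
      have "((\<lambda>s. seq_nth (w j s (\<phi> q)) i) has_vector_derivative
          (\<Sum>k<N. \<alpha> i k (\<Phi> s (\<phi> q)) * seq_nth (w j s (\<phi> q)) k)) (at s)" for j
        using bounded_linear.has_vector_derivative[OF bounded_linear_seq_nth w(2)[of j "\<phi> q" s], of i] i
        by (simp add: L_def seq_matrix_apply seq_nth_combination)
      then have 2: "((\<lambda>s. \<Sum>j<N. g j q * seq_nth (w j s (\<phi> q)) i) has_vector_derivative
          (\<Sum>j<N. g j q * (\<Sum>k<N. \<alpha> i k (\<Phi> s (\<phi> q)) * seq_nth (w j s (\<phi> q)) k))) (at s)"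
        by (intro has_vector_derivative_sum has_vector_derivative_mult_right)
      have "(\<Sum>j<N. g j q * (\<Sum>k<N. \<alpha> i k (\<Phi> s (\<phi> q)) * seq_nth (w j s (\<phi> q)) k)) =
          (\<Sum>k<N. \<alpha> i k (\<Phi> s (\<phi> q)) * (\<Sum>j<N. g j q * seq_nth (w j s (\<phi> q)) k))"
        unfolding sum_distrib_left by (subst sum.swap) (simp add: mult_ac)
      then have "(\<Sum>k<N. \<alpha> i k (\<Phi> s (\<phi> q)) * g k (curve q s)) -
          (\<Sum>j<N. g j q * (\<Sum>k<N. \<alpha> i k (\<Phi> s (\<phi> q)) * seq_nth (w j s (\<phi> q)) k)) =
          (\<Sum>k<N. \<alpha> i k (\<Phi> s (\<phi> q)) * D k s)"
        by (simp add: D_def right_diff_distrib sum_subtractf)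
      with has_vector_derivative_diff[OF 1 2] show ?thesis unfolding D_def by simp
    qed
    have "continuous_on UNIV (\<lambda>s. L (s, \<phi> q))"
      by (rule continuous_on_compose2[OF Ck_on_continuous_on[OF Ck_L]]) (auto intro: continuous_intros)
    from continuous_on_compact_norm_bound[OF continuous_on_subset[OF this subset_UNIV] compact_Icc]
    obtain C where C: "\<And>s. s \<in> {-\<bar>t\<bar>..\<bar>t\<bar>} \<Longrightarrow> norm (L (s, \<phi> q)) \<le> C" by blast
    have "d t = 0"
    proof (rule ode_zero_unique[where r = "\<bar>t\<bar>" and d = d and d' = "\<lambda>s. L (s, \<phi> q) (d s)" and K = C])
      fix s assume s: "\<bar>s\<bar> \<le> \<bar>t\<bar>"
      have "L (s, \<phi> q) (d s) = (\<Sum>i<N. (\<Sum>k<N. \<alpha> i k (\<Phi> s (\<phi> q)) * D k s) *\<^sub>R unit_seq i)"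
        by (simp add: L_def seq_matrix_apply d_def seq_nth_combination)
      moreover have "(d has_vector_derivative (\<Sum>i<N. (\<Sum>k<N. \<alpha> i k (\<Phi> s (\<phi> q)) * D k s) *\<^sub>R unit_seq i)) (at s)"
        unfolding d_def using s t
        by (intro has_vector_derivative_sum bounded_linear.has_vector_derivative[OF bounded_linear_scaleR_left] D_deriv) auto
      ultimately show "(d has_vector_derivative L (s, \<phi> q) (d s)) (at s)" by simp
      show "norm (L (s, \<phi> q) (d s)) \<le> C * norm (d s)"
        using norm_blinfun[of "L (s, \<phi> q)" "d s"] mult_right_mono[OF C norm_ge_zero, of s "d s"] s by (auto simp: abs_le_iff)
    next
      have "curve q 0 = q" using q chart_inv[OF chart] by (auto simp: curve_def \<Phi>_0 nbhd_def)
      then have "D i 0 = 0" if "i < N" for i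
        using that by (simp add: D_def w(1) seq_nth_unit_seq if_distrib cong: if_cong)
      then show "d 0 = 0" by (simp add: d_def)
    qed simp
    then have "D i t = 0"
      using seq_nth_combination[of "\<lambda>i. D i t" N i] i by (simp add: d_def linear_0[OF bounded_linear.linear[OF bounded_linear_seq_nth]])
    then show "g i (flow A (br H) t q) = (\<Sum>j<N. seq_nth (w j t (\<phi> q)) i * g j q)"
      using flow_local(3)[OF q t] by (simp add: D_def mult.commute)
  qed
qed

lemma flow_pullback_ideal:
  assumes W: "open W" "W \<subseteq> nbhd 2" and t: "\<bar>t\<bar> < \<epsilon>" and f: "f \<in> I (flow A (br H) t ` W)"
  shows "(\<lambda>x\<in>W. f (flow A (br H) t x)) \<in> I W"
proof -
  let ?F = "flow A (br H) t"
  obtain m where m: "\<And>t i j q. q \<in> V \<Longrightarrow> smooth_at A (m t i j) q"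
    "\<And>t i q. \<bar>t\<bar> < \<epsilon> \<Longrightarrow> q \<in> nbhd 2 \<Longrightarrow> i < N \<Longrightarrow> g i (flow A (br H) t q) = (\<Sum>j<N. m t i j q * g j q)"
    using flow_generators by blast
  have FW: "open (?F ` W)" using flow_open[OF W t] .
  have FU: "?F ` W \<subseteq> U0" using flow_nbhd[of _ 2 t] W(2) t nbhd_U0 by auto
  have "W \<subseteq> U0"
  proof -
    have "nbhd 2 \<subseteq> nbhd 3" using R by (auto simp: nbhd_def)
    then show ?thesis using W(2) nbhd_U0 by blast
  qed
  obtain b where b: "\<And>i. i < N \<Longrightarrow> b i \<in> Cinf A (?F ` W)" "f = (\<lambda>x\<in>?F ` W. \<Sum>i<N. b i x * restrict (g i) (?F ` W) x)"
    using f unfolding span[OF FW FU] Cinf_span_def by blast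
  \<comment> \<open>Insert the transformation of the generators into the pulled back combination and
    exchange the sums: \<open>e j\<close> collects the coefficients of \<open>g j\<close>.\<close>
  define e where "e j = (\<lambda>x\<in>W. \<Sum>i<N. b i (?F x) * m t i j x)" for j
  have "e j \<in> Cinf A W" for j
    unfolding Cinf_iff[OF W(1)]
  proof (intro conjI ballI)
    fix p assume p: "p \<in> W"
    then have "p \<in> V" using W(2) by (auto simp: nbhd_def)
    have "smooth_at A (\<lambda>x. \<Sum>i<N. b i (?F x) * m t i j x) p"
    proof (intro smooth_at_sum smooth_at_mult m(1)[OF \<open>p \<in> V\<close>])
      fix i assume "i \<in> {..<N}"
      then have "smooth_at A (b i) (?F p)" using b(1) p Cinf_iff[OF FW] by blast
      then show "smooth_at A (\<lambda>x. b i (?F x)) p" using flow_smooth_at p W(2) t by blast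
    qed
    then show "smooth_at A (e j) p" unfolding e_def by (rule smooth_at_restrict[OF W(1) p])
  qed (simp add: e_def)
  moreover have "(\<lambda>x\<in>W. f (?F x)) = (\<lambda>x\<in>W. \<Sum>j<N. e j x * restrict (g j) W x)"
  proof (rule restrict_ext)
    fix x assume x: "x \<in> W"
    have "f (?F x) = (\<Sum>i<N. b i (?F x) * (\<Sum>j<N. m t i j x * g j x))"
      using b(2) x m(2)[OF t] W(2) by (auto simp: subset_iff intro!: sum.cong)
    also have "\<dots> = (\<Sum>j<N. e j x * restrict (g j) W x)"
      using x unfolding sum_distrib_left
      by (subst sum.swap) (simp add: e_def sum_distrib_left sum_distrib_right mult_ac)
    finally show "f (?F x) = (\<Sum>j<N. e j x * restrict (g j) W x)" .
  qed
  ultimately show ?thesis unfolding span[OF W(1) \<open>W \<subseteq> U0\<close>] Cinf_span_def by blast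
qed

text \<open>One inclusion is the pullback lemma for \<open>t\<close>. For the other, an element of
  \<open>I W\<close> is pulled back by time \<open>-t\<close> to the image of \<open>W\<close>,
  which is why \<open>W\<close> starts in the smaller set \<open>nbhd 1\<close>.\<close>

lemma flow_preserves_ideal:
  assumes W: "open W" "W \<subseteq> nbhd 1" and t: "\<bar>t\<bar> < \<epsilon>"
  shows "pullback (flow A (br H) t) W (I (flow A (br H) t ` W)) = I W"
proof
  let ?F = "flow A (br H)"
  have "nbhd 1 \<subseteq> nbhd 2" using R by (auto simp: nbhd_def)
  then have W2: "W \<subseteq> nbhd 2" using W(2) by blast
  show "pullback (?F t) W (I (?F t ` W)) \<subseteq> I W"
    using flow_pullback_ideal[OF W(1) W2 t] by (auto simp: pullback_def)
  show "I W \<subseteq> pullback (?F t) W (I (?F t ` W))"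
  proof
    fix k assume k: "k \<in> I W"
    have inv: "?F (- t) (?F t x) = x" if "x \<in> W" for x using flow_inverse[OF _ t] that W(2) by blast
    have "?F (- t) ` ?F t ` W = W" using inv by force
    then have "(\<lambda>y\<in>?F t ` W. k (?F (- t) y)) \<in> I (?F t ` W)"
      using flow_pullback_ideal[OF flow_open[OF W(1) W2 t], of "- t" k] k t flow_nbhd[of _ 1 t] W(2) by auto
    moreover have "k = (\<lambda>x\<in>W. (\<lambda>y\<in>?F t ` W. k (?F (- t) y)) (?F t x))"
    proof -
      have "W \<subseteq> U0" using W(2) nbhd_U0 R by (auto simp: nbhd_def subset_iff)
      then have "k \<in> extensional W" using k span[OF W(1)] by (auto simp: Cinf_span_def)
      then show ?thesis using inv by (intro extensionalityI[of k W]) auto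
    qed
    ultimately show "k \<in> pullback (?F t) W (I (?F t ` W))" unfolding pullback_def by blast
  qed
qed

text \<open>The preimage of \<open>W\<close> is an image under the flow for time \<open>-t\<close>,
  hence open by \<open>flow_open\<close>.\<close>

lemma flow_continuous:
  assumes "open W" "\<bar>t\<bar> < \<epsilon>"
  shows "open {x\<in>nbhd 1. flow A (br H) t x \<in> W}"
proof -
  let ?F = "flow A (br H)"
  have "open (W \<inter> ?F t ` nbhd 1)"
  proof (intro open_Int flow_open nbhd_open)
    show "nbhd 1 \<subseteq> nbhd 2" using R by (auto simp: nbhd_def)
  qed (fact assms)+
  moreover have "W \<inter> ?F t ` nbhd 1 \<subseteq> nbhd 2" using flow_nbhd[of _ 1 t] assms(2) by auto
  ultimately have "open (?F (- t) ` (W \<inter> ?F t ` nbhd 1))" using assms(2) by (intro flow_open) auto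
  moreover have "?F (- t) ` (W \<inter> ?F t ` nbhd 1) = {x\<in>nbhd 1. ?F t x \<in> W}"
    using flow_inverse[OF _ assms(2)] by force
  ultimately show ?thesis by simp
qed

end

section \<open>Local and global preservation\<close>

text \<open>Openness of the image belongs to the property, since the values of \<open>I\<close> on
  other sets carry no meaning and composing two such steps applies the second one to the image of
  the first.\<close>

definition preserves_sheaf ::
  "('p::topological_space set \<times> ('p \<Rightarrow> 'e::euclidean_space)) set \<Rightarrow> (('p \<Rightarrow> real) \<Rightarrow> ('p \<Rightarrow> real)) \<Rightarrow>
   'p fun_sheaf \<Rightarrow> real \<Rightarrow> 'p set \<Rightarrow> bool" where
  "preserves_sheaf A X I t U \<longleftrightarrow>
     open (flow A X t ` U) \<and> pullback (flow A X t) U (I (flow A X t ` U)) = I U"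

text \<open>The last two conclusions are shaped for propagation: preservation on all open subsets
  allows shrinking, and open preimages allow restricting to points that the flow carries into a
  given open set.\<close>

lemma preserves_sheaf_local:
  assumes "dynamical_I_Poisson_manifold E A br I H"
  obtains U \<epsilon> where "open U" "q0 \<in> U" "\<epsilon> > 0"
    "\<And>t x. \<bar>t\<bar> < \<epsilon> \<Longrightarrow> x \<in> U \<Longrightarrow> flow_defined A (br H) t x"
    "\<And>t U'. \<bar>t\<bar> < \<epsilon> \<Longrightarrow> open U' \<Longrightarrow> U' \<subseteq> U \<Longrightarrow> preserves_sheaf A (br H) I t U'"
    "\<And>t W. \<bar>t\<bar> < \<epsilon> \<Longrightarrow> open W \<Longrightarrow> open {x\<in>U. flow A (br H) t x \<in> W}"
proof -
  have IP: "I_Poisson_manifold E A br I" and Hn: "H \<in> sheaf_normalizer A br I"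
    using assms by (auto simp: dynamical_I_Poisson_manifold_def)
  interpret bracket_manifold E A br
    using IP by unfold_locales (auto simp: I_Poisson_manifold_def)
  have H: "H \<in> Cinf A UNIV" using Hn by (simp add: sheaf_normalizer_def)
  obtain V \<phi> where V: "(V,\<phi>) \<in> A" "q0 \<in> V" using chart_exists .
  obtain U0 N g where U0: "open U0" "q0 \<in> U0" and g: "\<forall>i<N. g i \<in> Cinf A U0"
    and span: "\<forall>W. open W \<and> W \<subseteq> U0 \<longrightarrow> I W = Cinf_span A W N (\<lambda>i. restrict (g i) W)"
  proof -
    have "locally_finitely_generated A I" using IP by (simp add: I_Poisson_manifold_def)
    from this[unfolded locally_finitely_generated_def, THEN spec, of q0] show ?thesis
      by (elim exE conjE) (rule that)
  qed
  obtain R Y K M c where R: "R > 0" "E \<inter> ball (\<phi> q0) R \<subseteq> \<phi> ` (U0 \<inter> V)"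
    and fc: "flow_chart E A br H V \<phi> (ball (\<phi> q0) R) Y K M c"
    using flow_chart_exists[OF V H U0] by blast
  interpret fc: flow_chart E A br H V \<phi> "ball (\<phi> q0) R" Y K M c by (rule fc)
  obtain \<Phi> where "\<And>k. Ck_on k UNIV (\<lambda>(t,x). \<Phi> t x)" "\<And>x. \<Phi> 0 x = x"
    "\<And>t x. ((\<lambda>t. \<Phi> t x) has_vector_derivative Y (\<Phi> t x)) (at t)"
    using flow_Ck[OF fc.Y_Ck fc.Y_Lip] by blast
  then interpret ideal_flow E A br H V \<phi> q0 R Y K M c \<Phi> I U0 N g
    using H V R U0 g span Hn by unfold_locales (auto simp: sheaf_normalizer_def)
  have sub: "nbhd 1 \<subseteq> nbhd 2" using R by (auto simp: nbhd_def)
  show ?thesis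
  proof (rule that[OF nbhd_open, of 1 \<epsilon>])
    show "q0 \<in> nbhd 1" using R V by (auto simp: nbhd_def)
    show "flow_defined A (br H) t x" if "\<bar>t\<bar> < \<epsilon>" "x \<in> nbhd 1" for t x
      using flow_local(2) that sub by blast
    show "preserves_sheaf A (br H) I t U'" if "\<bar>t\<bar> < \<epsilon>" "open U'" "U' \<subseteq> nbhd 1" for t U'
      unfolding preserves_sheaf_def
      using flow_preserves_ideal[OF that(2,3,1)] flow_open[OF that(2) _ that(1)] that(3) sub by blast
  qed (rule \<epsilon>_pos, rule flow_continuous)
qed

locale complete_hamiltonian = bracket_manifold E A br
  for E :: "'e::euclidean_space set"
    and A :: "('p::{t2_space,second_countable_topology} set \<times> ('p \<Rightarrow> 'e)) set"
    and br :: "'p bracket" +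
  fixes H :: "'p \<Rightarrow> real"
  assumes H: "H \<in> Cinf A UNIV" and complete: "complete_vf A (br H)"
begin

abbreviation F where "F \<equiv> flow A (br H)"

section \<open>The complete flow as a one-parameter group\<close>

lemma flow_0: "F 0 x = x"
  and flow_curve: "integral_curve A (br H) UNIV (\<lambda>t. F t x)"
proof -
  obtain \<gamma> where \<gamma>: "integral_curve A (br H) UNIV \<gamma>" "\<gamma> 0 = x"
    using complete unfolding complete_vf_def by metis
  have "F t x = \<gamma> t" for t using flow_eq(2)[OF H \<gamma>(1), of t] \<gamma>(2) by simp
  then show "F 0 x = x" "integral_curve A (br H) UNIV (\<lambda>t. F t x)" using \<gamma> by simp_all
qed

lemma flow_add: "F (s + t) x = F s (F t x)"
proof -
  have "integral_curve A (br H) UNIV (\<lambda>s. F (s + t) x)"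
    unfolding integral_curve_def
  proof (intro conjI ballI)
    have "continuous_on UNIV (\<lambda>t. F t x)" using flow_curve by (simp add: integral_curve_def)
    then show "continuous_on UNIV (\<lambda>s. F (s + t) x)"
      by (rule continuous_on_compose2) (auto intro: continuous_intros)
    fix s G assume "G \<in> Cinf A UNIV"
    then have "((\<lambda>t. G (F t x)) has_real_derivative br H G (F (s + t) x)) (at (s + t))"
      using flow_curve[of x] by (simp add: integral_curve_def)
    then show "((\<lambda>s. G (F (s + t) x)) has_real_derivative br H G (F (s + t) x)) (at s)"
      by (simp add: DERIV_shift)
  qed auto
  from flow_eq(2)[OF H this, of s] show ?thesis by simp
qed

lemma flow_minus: "F (- t) (F t x) = x" "F t (F (- t) x) = x"
  using flow_add[of "- t" t x] flow_add[of t "- t" x] by (simp_all add: flow_0)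

text \<open>Preservation composes along the orbit of \<open>x0\<close>, and around each time
  \<open>s\<close> the local result at \<open>F s x0\<close> connects all nearby times, forwards and
  backwards. The set of good times is therefore open and closed.\<close>

lemma preserves_sheaf_propagates:
  assumes loc: "\<And>q0. \<exists>U \<epsilon>. open U \<and> q0 \<in> U \<and> \<epsilon> > 0 \<and>
     (\<forall>t. \<bar>t\<bar> < \<epsilon> \<longrightarrow> (\<forall>U'. open U' \<and> U' \<subseteq> U \<longrightarrow> preserves_sheaf A (br H) I t U') \<and>
       (\<forall>W. open W \<longrightarrow> open {x\<in>U. F t x \<in> W}))"
  shows "\<exists>U. open U \<and> x0 \<in> U \<and> (\<forall>U'. open U' \<and> U' \<subseteq> U \<longrightarrow> preserves_sheaf A (br H) I t U')"
proof -
  \<comment> \<open>Openness of preimages is carried along, because it makes the shrunken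
    neighbourhood \<open>U2\<close> open.\<close>
  define P where "P t U \<longleftrightarrow> open U \<and> x0 \<in> U \<and>
    (\<forall>U'. open U' \<and> U' \<subseteq> U \<longrightarrow> preserves_sheaf A (br H) I t U') \<and> (\<forall>W. open W \<longrightarrow> open {x\<in>U. F t x \<in> W})" for t U
  have step: "\<exists>d>0. \<forall>s1 s2. \<bar>s1 - s\<bar> < d \<longrightarrow> \<bar>s2 - s\<bar> < d \<longrightarrow> Ex (P s1) \<longrightarrow> Ex (P s2)" for s
  proof -
    from loc[of "F s x0"] obtain Uy \<epsilon> where *: "open Uy" "F s x0 \<in> Uy" "\<epsilon> > 0"
      "\<forall>t. \<bar>t\<bar> < \<epsilon> \<longrightarrow> (\<forall>U'. open U' \<and> U' \<subseteq> Uy \<longrightarrow> preserves_sheaf A (br H) I t U') \<and>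
       (\<forall>W. open W \<longrightarrow> open {x\<in>Uy. F t x \<in> W})"
      by (elim exE conjE) (rule that)
    then have Uy: "open Uy" "F s x0 \<in> Uy" "\<epsilon> > 0"
      "\<And>t U'. \<bar>t\<bar> < \<epsilon> \<Longrightarrow> open U' \<Longrightarrow> U' \<subseteq> Uy \<Longrightarrow> preserves_sheaf A (br H) I t U'"
      "\<And>t W. \<bar>t\<bar> < \<epsilon> \<Longrightarrow> open W \<Longrightarrow> open {x\<in>Uy. F t x \<in> W}"
      by simp_all
    have "open ((\<lambda>s. F s x0) -` Uy)"
      using flow_curve[of x0] by (intro open_vimage Uy) (simp add: integral_curve_def)
    then obtain d' where d': "d' > 0" "ball s d' \<subseteq> (\<lambda>s. F s x0) -` Uy"
      using Uy(2) open_contains_ball by (metis vimageI2)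
    \<comment> \<open>The bound \<open>d'\<close> keeps the orbit inside \<open>Uy\<close>, and
      \<open>\<epsilon> / 2\<close> makes two times within \<open>d\<close> of \<open>s\<close>
      differ by less than \<open>\<epsilon>\<close>.\<close>
    define d where "d = min d' (\<epsilon> / 2)"
    have "Ex (P s2)" if s: "\<bar>s1 - s\<bar> < d" "\<bar>s2 - s\<bar> < d" and "P s1 U" for s1 s2 U
    proof
      define r where "r = s2 - s1"
      have r: "\<bar>r\<bar> < \<epsilon>" using s unfolding r_def d_def by linarith
      have Fr: "F s2 x = F r (F s1 x)" for x using flow_add[of r s1 x] by (simp add: r_def)
      define U2 where "U2 = {x\<in>U. F s1 x \<in> Uy}"
      have U2: "open U2" "U2 \<subseteq> U" using \<open>P s1 U\<close> Uy(1) by (auto simp: P_def U2_def)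
      have "s1 \<in> ball s d'" using s(1) by (simp add: dist_real_def d_def abs_minus_commute)
      then have "x0 \<in> U2" using d'(2) \<open>P s1 U\<close> by (auto simp: P_def U2_def)
      moreover have "preserves_sheaf A (br H) I s2 U'" if U': "open U'" "U' \<subseteq> U2" for U'
      proof -
        have 1: "preserves_sheaf A (br H) I s1 U'" using \<open>P s1 U\<close> U' U2 unfolding P_def by blast
        have "F s1 ` U' \<subseteq> Uy" using U'(2) by (auto simp: U2_def)
        then have 2: "preserves_sheaf A (br H) I r (F s1 ` U')"
          using Uy(4)[OF r] 1 unfolding preserves_sheaf_def by blast
        have im: "F s2 ` U' = F r ` F s1 ` U'" by (simp add: image_image Fr)
        have "pullback (F s2) U' J = pullback (F s1) U' (pullback (F r) (F s1 ` U') J)" for J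
          unfolding pullback_def image_image by (intro image_cong refl) (auto simp: Fr)
        then show ?thesis using 1 2 unfolding preserves_sheaf_def im by simp
      qed
      moreover have "open {x\<in>U2. F s2 x \<in> W}" if "open W" for W
      proof -
        have "{x\<in>U2. F s2 x \<in> W} = {x\<in>U. F s1 x \<in> {y\<in>Uy. F r y \<in> W}}" by (auto simp: U2_def Fr)
        moreover have "open {x\<in>U. F s1 x \<in> {y\<in>Uy. F r y \<in> W}}"
          using \<open>P s1 U\<close> Uy(5)[OF r that] unfolding P_def by blast
        ultimately show ?thesis by simp
      qed
      ultimately show "P s2 U2" using U2(1) by (simp add: P_def)
    qed
    moreover have "d > 0" using d'(1) Uy(3) by (simp add: d_def)
    ultimately show ?thesis by blast
  qed
  define S where "S = {s. Ex (P s)}"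
  \<comment> \<open>The implication in \<open>step\<close> holds in both directions, since
    \<open>s1\<close> and \<open>s2\<close> may be exchanged; hence both sets are open.\<close>
  have "open S" "open (- S)"
    unfolding open_dist using step[unfolded dist_real_def[symmetric]]
    by (auto simp: S_def dist_real_def) (metis abs_zero diff_self)+
  then have "S = {} \<or> S = UNIV" using clopen[of S] by (simp add: closed_def)
  moreover have "0 \<in> S"
  proof -
    from loc[of x0] obtain U \<epsilon> where "open U" "x0 \<in> U" "\<epsilon> > 0"
      "\<forall>t. \<bar>t\<bar> < \<epsilon> \<longrightarrow> (\<forall>U'. open U' \<and> U' \<subseteq> U \<longrightarrow> preserves_sheaf A (br H) I t U') \<and>
       (\<forall>W. open W \<longrightarrow> open {x\<in>U. F t x \<in> W})"
      by (elim exE conjE) (rule that)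
    then have "P 0 U" unfolding P_def by simp
    then show ?thesis by (auto simp: S_def)
  qed
  ultimately have "t \<in> S" by blast
  then show ?thesis unfolding S_def P_def by blast
qed

text \<open>Preservation on small pieces is compared with restriction, and the sheaf property
  assembles the pieces on either side. The inverse \<open>F (- t)\<close> defines the global
  candidate on the image.\<close>

lemma preserves_sheaf_glue:
  assumes sheaf: "subsheaf_Cinf A I" and V: "open V"
    and loc: "\<And>x. x \<in> V \<Longrightarrow> \<exists>U. open U \<and> x \<in> U \<and> (\<forall>U'. open U' \<and> U' \<subseteq> U \<longrightarrow> preserves_sheaf A (br H) I t U')"
  shows "preserves_sheaf A (br H) I t V"
proof -
  define \<U> where "\<U> = {U. open U \<and> U \<subseteq> V \<and> preserves_sheaf A (br H) I t U}"
  have V_eq: "V = \<Union>\<U>"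
  proof
    show "V \<subseteq> \<Union>\<U>"
    proof
      fix x assume "x \<in> V"
      then obtain U where "open U" "x \<in> U" "\<forall>U'. open U' \<and> U' \<subseteq> U \<longrightarrow> preserves_sheaf A (br H) I t U'"
        using loc by blast
      then have "U \<inter> V \<in> \<U>" "x \<in> U \<inter> V" using V \<open>x \<in> V\<close> by (auto simp: \<U>_def)
      then show "x \<in> \<Union>\<U>" by blast
    qed
  qed (auto simp: \<U>_def)
  have FV_eq: "F t ` V = \<Union>((`) (F t) ` \<U>)" using V_eq by blast
  have FU: "open (F t ` U)" "pullback (F t) U (I (F t ` U)) = I U" if "U \<in> \<U>" for U
    using that by (auto simp: \<U>_def preserves_sheaf_def)
  have FV: "open (F t ` V)" unfolding FV_eq using FU(1) by blast
  have sub_Cinf: "I U \<subseteq> Cinf A U" if "open U" for U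
    using sheaf that by (simp add: subsheaf_Cinf_def)
  have res: "restrict f W \<in> I W" if "f \<in> I U" "open U" "open W" "W \<subseteq> U" for f U W
    using sheaf that unfolding subsheaf_Cinf_def by blast
  have glue: "f \<in> I (\<Union>\<W>)"
    if op: "\<And>W. W \<in> \<W> \<Longrightarrow> open W" and ext: "f \<in> extensional (\<Union>\<W>)"
      and r: "\<And>W. W \<in> \<W> \<Longrightarrow> restrict f W \<in> I W" for \<W> f
  proof -
    have "smooth_at A f p" if p: "p \<in> W" "W \<in> \<W>" for p W
    proof (rule smooth_at_cong[OF _ op[OF p(2)] p(1)])
      show "smooth_at A (restrict f W) p"
        using sub_Cinf[OF op[OF p(2)]] r[OF p(2)] p(1) Cinf_iff[OF op[OF p(2)]] by blast
    qed simp
    then have "f \<in> Cinf A (\<Union>\<W>)" using op ext by (subst Cinf_iff) auto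
    then show ?thesis
      using sheaf[unfolded subsheaf_Cinf_def, THEN conjunct2, THEN conjunct2, rule_format, of \<W> f] op r by blast
  qed
  have "pullback (F t) V (I (F t ` V)) = I V"
  proof
    show "pullback (F t) V (I (F t ` V)) \<subseteq> I V"
    proof
      fix k assume "k \<in> pullback (F t) V (I (F t ` V))"
      then obtain f where f: "f \<in> I (F t ` V)" "k = (\<lambda>x\<in>V. f (F t x))" by (auto simp: pullback_def)
      have "restrict k U \<in> I U" if U: "U \<in> \<U>" for U
      proof -
        have UV: "U \<subseteq> V" using U by (simp add: \<U>_def)
        then have "restrict f (F t ` U) \<in> I (F t ` U)" using res[OF f(1) FV FU(1)[OF U]] by blast
        then have "(\<lambda>x\<in>U. restrict f (F t ` U) (F t x)) \<in> I U"
          using FU(2)[OF U] unfolding pullback_def by blast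
        moreover have "(\<lambda>x\<in>U. restrict f (F t ` U) (F t x)) = restrict k U"
          using UV f(2) by (intro restrict_ext) auto
        ultimately show ?thesis by simp
      qed
      moreover have "k \<in> extensional (\<Union>\<U>)" using f(2) V_eq by simp
      ultimately show "k \<in> I V"
        unfolding V_eq by (intro glue) (simp_all add: \<U>_def)
    qed
    show "I V \<subseteq> pullback (F t) V (I (F t ` V))"
    proof
      fix k assume k: "k \<in> I V"
      define f where "f = (\<lambda>y\<in>F t ` V. k (F (- t) y))"
      have "restrict f (F t ` U) \<in> I (F t ` U)" if U: "U \<in> \<U>" for U
      proof -
        have UV: "U \<subseteq> V" "open U" using U by (auto simp: \<U>_def)
        then have "restrict k U \<in> pullback (F t) U (I (F t ` U))"
          unfolding FU(2)[OF U] using res[OF k V] by blast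
        then obtain f' where f': "f' \<in> I (F t ` U)" "restrict k U = (\<lambda>x\<in>U. f' (F t x))"
          by (auto simp: pullback_def)
        \<comment> \<open>The local preimage of \<open>restrict k U\<close> is forced to be
          \<open>k\<close> composed with \<open>F (- t)\<close>; values outside the domain agree
          because both functions are extensional.\<close>
        have "f' = restrict f (F t ` U)"
        proof (rule extensionalityI)
          show "f' \<in> extensional (F t ` U)" using f'(1) sub_Cinf[OF FU(1)[OF U]] by (auto simp: Cinf_def)
          fix y assume "y \<in> F t ` U"
          then obtain x where x: "x \<in> U" "y = F t x" by blast
          have "k x = f' (F t x)" using fun_cong[OF f'(2), of x] x by simp
          then show "f' y = restrict f (F t ` U) y"
            using x UV by (auto simp: f_def flow_minus)
        qed simp
        then show ?thesis using f'(1) by simp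
      qed
      then have "f \<in> I (F t ` V)"
        unfolding FV_eq by (intro glue) (use FU(1) FV_eq in \<open>auto simp: f_def\<close>)
      moreover have "k = (\<lambda>x\<in>V. f (F t x))"
      proof (rule extensionalityI)
        show "k \<in> extensional V" using k sub_Cinf[OF V] by (auto simp: Cinf_def)
      qed (auto simp: f_def flow_minus)
      ultimately show "k \<in> pullback (F t) V (I (F t ` V))" by (auto simp: pullback_def)
    qed
  qed
  then show ?thesis using FV by (simp add: preserves_sheaf_def)
qed

end

theorem proposition4p18:
  fixes E :: "'e::euclidean_space set"
    and A :: "('p::{t2_space,second_countable_topology} set \<times> ('p \<Rightarrow> 'e)) set"
    and br :: "'p bracket"
    and I :: "'p fun_sheaf"
    and H :: "'p \<Rightarrow> real"
  defines "X \<equiv> hamiltonian_vf br H"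
  assumes "dynamical_I_Poisson_manifold E A br I H"
  shows "(\<forall>q0. \<exists>U \<epsilon>. open U \<and> q0 \<in> U \<and> \<epsilon> > 0 \<and>
            (\<forall>t\<in>{-\<epsilon><..<\<epsilon>}.
               (\<forall>x\<in>U. flow_defined A X t x) \<and>
               open (flow A X t ` U) \<and>
               pullback (flow A X t) U (I (flow A X t ` U)) = I U)) \<and>
         (complete_vf A X \<longrightarrow>
            (\<forall>t. (\<forall>V. open V \<longrightarrow>
                    open (flow A X t ` V) \<and>
                    pullback (flow A X t) V (I (flow A X t ` V)) = I V) \<and>
                 pullback (flow A X t) UNIV (I UNIV) = I UNIV))"
proof -
  have X: "X = br H" by (simp add: X_def hamiltonian_vf_def)
  show ?thesis
    unfolding X
  proof (intro conjI impI)
    show "\<forall>q0. \<exists>U \<epsilon>. open U \<and> q0 \<in> U \<and> \<epsilon> > 0 \<and>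
            (\<forall>t\<in>{-\<epsilon><..<\<epsilon>}. (\<forall>x\<in>U. flow_defined A (br H) t x) \<and> open (flow A (br H) t ` U) \<and>
               pullback (flow A (br H) t) U (I (flow A (br H) t ` U)) = I U)"
    proof
      fix q0
      obtain U \<epsilon> where U: "open U" "q0 \<in> U" "\<epsilon> > 0"
        "\<And>t x. \<bar>t\<bar> < \<epsilon> \<Longrightarrow> x \<in> U \<Longrightarrow> flow_defined A (br H) t x"
        "\<And>t U'. \<bar>t\<bar> < \<epsilon> \<Longrightarrow> open U' \<Longrightarrow> U' \<subseteq> U \<Longrightarrow> preserves_sheaf A (br H) I t U'"
        "\<And>t W. \<bar>t\<bar> < \<epsilon> \<Longrightarrow> open W \<Longrightarrow> open {x\<in>U. flow A (br H) t x \<in> W}"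
        by (rule preserves_sheaf_local[OF assms(2), of q0]) (rule that)
      then show "\<exists>U \<epsilon>. open U \<and> q0 \<in> U \<and> \<epsilon> > 0 \<and>
            (\<forall>t\<in>{-\<epsilon><..<\<epsilon>}. (\<forall>x\<in>U. flow_defined A (br H) t x) \<and> open (flow A (br H) t ` U) \<and>
               pullback (flow A (br H) t) U (I (flow A (br H) t ` U)) = I U)"
        unfolding preserves_sheaf_def
        by (intro exI[of _ U] exI[of _ \<epsilon>]) (auto simp: abs_less_iff)
    qed
    assume "complete_vf A (br H)"
    moreover have "smooth_manifold E A" "leibniz_bracket A br" "H \<in> Cinf A UNIV" and sheaf: "subsheaf_Cinf A I"
      using assms(2)
      by (auto simp: dynamical_I_Poisson_manifold_def I_Poisson_manifold_def sheaf_normalizer_def)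
    ultimately interpret complete_hamiltonian E A br H by unfold_locales
    have "\<exists>U \<epsilon>. open U \<and> q0 \<in> U \<and> \<epsilon> > 0 \<and>
     (\<forall>t. \<bar>t\<bar> < \<epsilon> \<longrightarrow> (\<forall>U'. open U' \<and> U' \<subseteq> U \<longrightarrow> preserves_sheaf A (br H) I t U') \<and>
       (\<forall>W. open W \<longrightarrow> open {x\<in>U. F t x \<in> W}))" for q0
    proof (rule preserves_sheaf_local[OF assms(2), of q0])
      fix U \<epsilon> assume "open U" "q0 \<in> U" "\<epsilon> > 0"
        "\<And>t U'. \<bar>t\<bar> < \<epsilon> \<Longrightarrow> open U' \<Longrightarrow> U' \<subseteq> U \<Longrightarrow> preserves_sheaf A (br H) I t U'"
        "\<And>t W. \<bar>t\<bar> < \<epsilon> \<Longrightarrow> open W \<Longrightarrow> open {x\<in>U. F t x \<in> W}"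
      then show ?thesis by (intro exI[of _ U] exI[of _ \<epsilon>]) simp
    qed
    note preserves_sheaf_glue[OF sheaf _ preserves_sheaf_propagates[OF this]]
    then have pres: "open (F t ` V)" "pullback (F t) V (I (F t ` V)) = I V" if "open V" for t V
      using that unfolding preserves_sheaf_def by blast+
    \<comment> \<open>Surjectivity, from the flow for time \<open>-t\<close>, turns the case of the
      whole manifold into the last claim.\<close>
    have "F t ` UNIV = UNIV" for t using flow_minus(2) by (metis surjI)
    then have "pullback (F t) UNIV (I UNIV) = I UNIV" for t using pres(2)[OF open_UNIV, of t] by simp
    then show "\<forall>t. (\<forall>V. open V \<longrightarrow> open (F t ` V) \<and> pullback (F t) V (I (F t ` V)) = I V) \<and>
                 pullback (F t) UNIV (I UNIV) = I UNIV"
      using pres by blast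
  qed
qed

end
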